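(* If $\mathcal{H}$ is a Hopf algebra in $\mathrm{SupLat}$ and $\mathcal{R}$ is a co-quasitriangular structure on $\mathcal{H}$, then the induced braiding $\Gamma:\mathcal{H}\otimes\mathcal{H}\to\mathcal{H}\otimes\mathcal{H}$, $$\Gamma(a,b)=\mathcal{R}(a_{(1)},b_{(1)}).(b_{(2)},a_{(2)}).\mathcal{R}^{-1}(a_{(3)},b_{(3)}),$$ restricts to a braiding operator $r$ on the group $R(\mathcal{H})$, the remnant of $\mathcal{H}$.
   Context: $\mathrm{SupLat}$ is the category whose objects are complete lattices (posets in which every subset $S$ has a join $\vee S$) and whose morphisms are maps preserving arbitrary joins. The least element is denoted $\emptyset$. $\mathcal{L}\otimes\mathcal{M}$ is the complete lattice through which every map $\mathcal{L}\times\mathcal{M}\to\mathcal{K}$ preserving joins separately in each variable factors uniquely as a join-preserving morphism; $(l,m)$ denotes the image of a pair. The unit object is $\mathcal{P}(1)=\{\emptyset,1\}$ (with its multiplication $1.1=1$, other products $\emptyset$), and it acts on any lattice by $1.l=l$, $\emptyset.l=\emptyset$. The symmetry is $(l,m)\mapsto(m,l)$. A Hopf algebra in $\mathrm{SupLat}$ is a complete lattice $\mathcal{H}$ with join-preserving morphisms $m:\mathcal{H}\otimes\mathcal{H}\to\mathcal{H}$ (written $a.b$), $\Delta:\mathcal{H}\to\mathcal{H}\otimes\mathcal{H}$, $\epsilon:\mathcal{H}\to\mathcal{P}(1)$, an element $1\in\mathcal{H}$ and an invertible join-preserving morphism $S:\mathcal{H}\to\mathcal{H}$ such that: $m$ is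 associative with two-sided unit $1$; $(\Delta\otimes\mathrm{id})\Delta=(\mathrm{id}\otimes\Delta)\Delta$ and $(\epsilon\otimes\mathrm{id})\Delta=\mathrm{id}=(\mathrm{id}\otimes\epsilon)\Delta$; $\Delta(1)=(1,1)$, $\epsilon(1)=1$, $\epsilon(h.h')=1$ iff $\epsilon(h)=\epsilon(h')=1$, and $\Delta(h.h')=\Delta(h).\Delta(h')$ componentwise; and $m(\mathrm{id}\otimes S)\Delta(h)=m(S\otimes\mathrm{id})\Delta(h)$ equals $1$ if $\epsilon(h)=1$ and $\emptyset$ otherwise. Sweedler notation: $\Delta(a)=\vee(a_{(1)},a_{(2)})$, iterated coproducts $a_{(1)},a_{(2)},a_{(3)}$, etc.; expressions in Sweedler notation denote the join over all terms. A co-quasitriangular structure on $\mathcal{H}$ is a join-preserving $\mathcal{R}:\mathcal{H}\otimes\mathcal{H}\to\mathcal{P}(1)$ with a join-preserving convolution inverse $\mathcal{R}^{-1}$, i.e. $\mathcal{R}^{-1}(a_{(1)},b_{(1)}).\mathcal{R}(a_{(2)},b_{(2)})=\epsilon(a).\epsilon(b)=\mathcal{R}(a_{(1)},b_{(1)}).\mathcal{R}^{-1}(a_{(2)},b_{(2)})$, such that for all $a,b,c\in\mathcal{H}$: $\mathcal{R}(a.b,c)=\mathcal{R}(b,c_{(1)}).\mathcal{R}(a,c_{(2)})$; $\mathcal{R}(a,b.c)=\mathcal{R}(a_{(1)},b).\mathcal{R}(a_{(2)},c)$; $\mathcal{R}(b_{(1)},a_{(1)})\,a_{(2)}.b_{(2)}=b_{(1)}.a_{(1)}\,\mathcal{R}(b_{(2)},a_{(2)})$.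 Remnant: let $D=\vee\epsilon^{-1}(\emptyset)$, let $\mathcal{Q}$ be the quotient of $\mathcal{H}$ by $h\sim h\vee D$ (ordered by $\overline{a}\le\overline{b}$ iff $a\vee D\le b\vee D$), $\pi:\mathcal{H}\to\mathcal{Q}$, $\pi(h)=\overline{h}$, and $\iota:\mathcal{Q}\to\mathcal{H}$, $\iota(\overline{h})=h\vee D$. $\mathcal{Q}$ has a Hopf algebra structure making $\pi$ a Hopf algebra morphism, and with it $\mathcal{Q}$ is isomorphic to the group algebra $\mathcal{P}(R(\mathcal{H}))$ of a group $R(\mathcal{H})$, the remnant (group algebra of $G$: $\{g\}.\{h\}=\{gh\}$, $\Delta\{g\}=(\{g\},\{g\})$, $\epsilon\{g\}=1$, $S\{g\}=\{g^{-1}\}$). Concretely $R(\mathcal{H})$ consists of the elements $q\neq\emptyset$ of $\mathcal{Q}$ with $\Delta(q)=(q,q)$, with the product of $\mathcal{Q}$. "$\Gamma$ restricts to $r$" means: $\xi=(\pi\otimes\pi)\Gamma(\iota\otimes\iota):\mathcal{Q}\otimes\mathcal{Q}\to\mathcal{Q}\otimes\mathcal{Q}$, where $\mathcal{Q}\otimes\mathcal{Q}\cong\mathcal{P}(R(\mathcal{H})\times R(\mathcal{H}))$, sends singletons to singletons, and $r:R(\mathcal{H})\times R(\mathcal{H})\to R(\mathcal{H})\times R(\mathcal{H})$ is the map given by $\{r(g,h)\}=\xi(\{g\},\{h\})$. A braiding operator on a group $(G,m,e)$ is a map $r:G\times G\to G\times G$ such that for all $f,g,h\in G$: $m\,r(g,h)=g.h$;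 $r(e,g)=(g,e)$ and $r(g,e)=(e,g)$; $r(g.h,f)=(\mathrm{id}\times m)(r\times\mathrm{id})(g,r(h,f))$; $r(g,h.f)=(m\times\mathrm{id})(\mathrm{id}\times r)(r(g,h),f)$. *)

theory Defs
  imports "HOL-Algebra.Group"
begin

section \<open>Complete lattices and join-preserving maps\<close>

text \<open>
  Objects of SupLat are the complete lattices of HOL-Algebra (with explicit carriers). All maps
  between them matter only on carriers. The join of the empty family makes the maps below
  preserve the least element.
\<close>

definition sup_mor ::
  "('a, 'm) gorder_scheme \<Rightarrow> ('b, 'n) gorder_scheme \<Rightarrow> ('a \<Rightarrow> 'b) set"
  where "sup_mor L M =
    {f. f \<in> carrier L \<rightarrow> carrier M \<and>
        (\<forall>A \<subseteq> carrier L. f (\<Squnion>\<^bsub>L\<^esub> A) = \<Squnion>\<^bsub>M\<^esub> (f ` A))}"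

definition sup_bimor ::
  "('a, 'm) gorder_scheme \<Rightarrow> ('b, 'n) gorder_scheme \<Rightarrow> ('c, 'k) gorder_scheme
    \<Rightarrow> ('a \<Rightarrow> 'b \<Rightarrow> 'c) \<Rightarrow> bool"
  where "sup_bimor L M K \<beta> \<longleftrightarrow>
    (\<forall>l \<in> carrier L. \<beta> l \<in> sup_mor M K) \<and>
    (\<forall>m \<in> carrier M. (\<lambda>l. \<beta> l m) \<in> sup_mor L K)"

text \<open>The unit object: the truth values, \<^term>\<open>True\<close> being the nonempty subset of the point.\<close>

definition unit_lat :: "bool gorder"
  where "unit_lat = \<lparr>carrier = UNIV, eq = (=), le = (\<longrightarrow>)\<rparr>"

definition scale :: "('a, 'm) gorder_scheme \<Rightarrow> bool \<Rightarrow> 'a \<Rightarrow> 'a"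
  where "scale L t l = (if t then l else \<bottom>\<^bsub>L\<^esub>)"


section \<open>The tensor product\<close>

text \<open>
  An element of the tensor product is encoded as the set of all pairs whose elementary tensor
  lies below it; the sets arising in this way are the ones closed under joins, and under
  passage to smaller elements, separately in each variable. The lemmas \<open>tensor_complete_lattice\<close>,
  \<open>pure_bimor\<close>, \<open>ext_mor\<close>, \<open>ext_pure\<close> and \<open>ext_unique\<close> below establish the universal property.
\<close>

definition bi_ideal ::
  "('a, 'm) gorder_scheme \<Rightarrow> ('b, 'n) gorder_scheme \<Rightarrow> ('a \<times> 'b) set \<Rightarrow> bool"
  where "bi_ideal L M I \<longleftrightarrow>
    I \<subseteq> carrier L \<times> carrier M \<and>
    (\<forall>A \<subseteq> carrier L. \<forall>m \<in> carrier M. (\<Squnion>\<^bsub>L\<^esub> A, m) \<in> I \<longleftrightarrow> (\<forall>a \<in> A. (a, m) \<in> I)) \<and>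
    (\<forall>l \<in> carrier L. \<forall>B \<subseteq> carrier M. (l, \<Squnion>\<^bsub>M\<^esub> B) \<in> I \<longleftrightarrow> (\<forall>b \<in> B. (l, b) \<in> I))"

definition tensor ::
  "('a, 'm) gorder_scheme \<Rightarrow> ('b, 'n) gorder_scheme \<Rightarrow> ('a \<times> 'b) set gorder"
  where "tensor L M = \<lparr>carrier = {I. bi_ideal L M I}, eq = (=), le = (\<subseteq>)\<rparr>"

definition pure ::
  "('a, 'm) gorder_scheme \<Rightarrow> ('b, 'n) gorder_scheme \<Rightarrow> 'a \<Rightarrow> 'b \<Rightarrow> ('a \<times> 'b) set"
  where "pure L M l m = \<Inter> {I. bi_ideal L M I \<and> (l, m) \<in> I}"

text \<open>
  \<open>ext K \<beta>\<close> is the morphism out of the tensor product induced by \<open>\<beta>\<close>. As \<open>x\<close> is the join of the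
  elementary tensors of its members, \<open>ext K (\<lambda>u v. E) x\<close> is the Sweedler-style join of \<open>E\<close> over
  all terms \<open>(u, v)\<close> of \<open>x\<close>.
\<close>

definition ext :: "('c, 'k) gorder_scheme \<Rightarrow> ('a \<Rightarrow> 'b \<Rightarrow> 'c) \<Rightarrow> ('a \<times> 'b) set \<Rightarrow> 'c"
  where "ext K \<beta> x = \<Squnion>\<^bsub>K\<^esub> ((\<lambda>(l, m). \<beta> l m) ` x)"

text \<open>In \<open>tensor_map L' M' f g\<close> the lattices are the codomains of \<open>f\<close> and \<open>g\<close>.\<close>

definition tensor_map ::
  "('c, 'm) gorder_scheme \<Rightarrow> ('d, 'n) gorder_scheme \<Rightarrow> ('a \<Rightarrow> 'c) \<Rightarrow> ('b \<Rightarrow> 'd)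
    \<Rightarrow> ('a \<times> 'b) set \<Rightarrow> ('c \<times> 'd) set"
  where "tensor_map L' M' f g = ext (tensor L' M') (\<lambda>l m. pure L' M' (f l) (g m))"

definition tensor_assoc ::
  "('a, 'm) gorder_scheme \<Rightarrow> ('b, 'n) gorder_scheme \<Rightarrow> ('c, 'k) gorder_scheme
    \<Rightarrow> (('a \<times> 'b) set \<times> 'c) set \<Rightarrow> ('a \<times> ('b \<times> 'c) set) set"
  where "tensor_assoc L M N =
    ext (tensor L (tensor M N))
      (\<lambda>t n. ext (tensor L (tensor M N)) (\<lambda>l m. pure L (tensor M N) l (pure M N m n)) t)"

definition left_unitor :: "('a, 'm) gorder_scheme \<Rightarrow> (bool \<times> 'a) set \<Rightarrow> 'a"
  where "left_unitor L = ext L (\<lambda>t l. scale L t l)"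

definition right_unitor :: "('a, 'm) gorder_scheme \<Rightarrow> ('a \<times> bool) set \<Rightarrow> 'a"
  where "right_unitor L = ext L (\<lambda>l t. scale L t l)"


subsection \<open>The universal property\<close>

lemma unit_lat_complete_lattice: "complete_lattice unit_lat"
proof
  fix A :: "bool set"
  show "\<exists>s. least unit_lat s (Upper unit_lat A)"
    by (rule exI[of _ "True \<in> A"]) (auto simp: least_def Upper_def unit_lat_def)
  show "\<exists>s. greatest unit_lat s (Lower unit_lat A)"
    by (rule exI[of _ "\<forall>a \<in> A. a"]) (auto simp: greatest_def Lower_def unit_lat_def)
qed (auto simp: unit_lat_def)

lemma bi_ideal_Inter:
  assumes "\<And>I. I \<in> F \<Longrightarrow> bi_ideal L M I" "F \<noteq> {}"
  shows "bi_ideal L M (\<Inter> F)"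
proof -
  obtain I where "I \<in> F" using assms(2) by blast
  then have sub: "\<Inter> F \<subseteq> carrier L \<times> carrier M"
    using assms(1)[of I] unfolding bi_ideal_def by (meson Inter_lower order_trans)
  have 1: "(\<Squnion>\<^bsub>L\<^esub> A, m) \<in> \<Inter> F \<longleftrightarrow> (\<forall>a \<in> A. (a, m) \<in> \<Inter> F)"
    if "A \<subseteq> carrier L" "m \<in> carrier M" for A m
  proof -
    have "\<forall>I \<in> F. (\<Squnion>\<^bsub>L\<^esub> A, m) \<in> I \<longleftrightarrow> (\<forall>a \<in> A. (a, m) \<in> I)"
      using assms(1) that unfolding bi_ideal_def by simp
    then show ?thesis by (meson Inter_iff)
  qed
  have 2: "(l, \<Squnion>\<^bsub>M\<^esub> B) \<in> \<Inter> F \<longleftrightarrow> (\<forall>b \<in> B. (l, b) \<in> \<Inter> F)"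
    if "B \<subseteq> carrier M" "l \<in> carrier L" for B l
  proof -
    have "\<forall>I \<in> F. (l, \<Squnion>\<^bsub>M\<^esub> B) \<in> I \<longleftrightarrow> (\<forall>b \<in> B. (l, b) \<in> I)"
      using assms(1) that unfolding bi_ideal_def by simp
    then show ?thesis by (meson Inter_iff)
  qed
  show ?thesis
    unfolding bi_ideal_def by (intro conjI allI ballI impI sub 1 2)
qed

lemma bi_ideal_top:
  assumes "complete_lattice L" "complete_lattice M"
  shows "bi_ideal L M (carrier L \<times> carrier M)"
proof -
  interpret L: complete_lattice L by fact
  interpret M: complete_lattice M by fact
  show ?thesis unfolding bi_ideal_def by auto
qed

lemma tensor_complete_lattice:
  assumes "complete_lattice L" "complete_lattice M"
  shows "complete_lattice (tensor L M)"
proof -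
  have po: "partial_order (tensor L M)"
    by unfold_locales (auto simp: tensor_def)
  then interpret partial_order "tensor L M" .
  have top: "\<exists>g. greatest (tensor L M) g (carrier (tensor L M))"
    using bi_ideal_top[OF assms]
    by (intro exI[of _ "carrier L \<times> carrier M"])
      (auto simp: greatest_def tensor_def bi_ideal_def)
  have inf: "\<exists>i. greatest (tensor L M) i (Lower (tensor L M) A)"
    if A: "A \<subseteq> carrier (tensor L M)" "A \<noteq> {}" for A
  proof (rule exI[of _ "\<Inter> A"])
    have "bi_ideal L M (\<Inter> A)"
      using A by (intro bi_ideal_Inter) (auto simp: tensor_def)
    then show "greatest (tensor L M) (\<Inter> A) (Lower (tensor L M) A)"
      using A by (auto simp: greatest_def Lower_def tensor_def)
  qed
  show ?thesis
    using complete_lattice_criterion1[OF top inf] .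
qed

lemma bi_ideal_pure:
  assumes "complete_lattice L" "complete_lattice M" "l \<in> carrier L" "m \<in> carrier M"
  shows "bi_ideal L M (pure L M l m)" "(l, m) \<in> pure L M l m"
proof -
  show "bi_ideal L M (pure L M l m)" unfolding pure_def
  proof (rule bi_ideal_Inter)
    show "{I. bi_ideal L M I \<and> (l, m) \<in> I} \<noteq> {}"
      using bi_ideal_top[OF assms(1,2)] assms(3,4) by blast
  qed simp
  show "(l, m) \<in> pure L M l m" by (auto simp: pure_def)
qed

lemma pure_subset_iff:
  assumes "complete_lattice L" "complete_lattice M" "bi_ideal L M x"
    and "l \<in> carrier L" "m \<in> carrier M"
  shows "pure L M l m \<subseteq> x \<longleftrightarrow> (l, m) \<in> x"
  using bi_ideal_pure[OF assms(1,2,4,5)] assms(3) by (auto simp: pure_def)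

lemma complete_lattice_sup_le_iff:
  assumes "complete_lattice K" "A \<subseteq> carrier K" "k \<in> carrier K"
  shows "\<Squnion>\<^bsub>K\<^esub> A \<sqsubseteq>\<^bsub>K\<^esub> k \<longleftrightarrow> (\<forall>a \<in> A. a \<sqsubseteq>\<^bsub>K\<^esub> k)"
proof -
  interpret K: complete_lattice K by fact
  show ?thesis
  proof
    assume le: "\<Squnion>\<^bsub>K\<^esub> A \<sqsubseteq>\<^bsub>K\<^esub> k"
    show "\<forall>a \<in> A. a \<sqsubseteq>\<^bsub>K\<^esub> k"
    proof
      fix a assume "a \<in> A"
      then have "a \<sqsubseteq>\<^bsub>K\<^esub> \<Squnion>\<^bsub>K\<^esub> A" "a \<in> carrier K"
        using K.sup_upper[OF assms(2)] assms(2) by auto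
      then show "a \<sqsubseteq>\<^bsub>K\<^esub> k"
        using K.le_trans[OF _ le] K.sup_closed[OF assms(2)] assms(3) by blast
    qed
  next
    assume "\<forall>a \<in> A. a \<sqsubseteq>\<^bsub>K\<^esub> k"
    then show "\<Squnion>\<^bsub>K\<^esub> A \<sqsubseteq>\<^bsub>K\<^esub> k"
      using K.sup_least[OF assms(2,3)] by blast
  qed
qed

lemma pure_bimor:
  assumes L: "complete_lattice L" and M: "complete_lattice M"
  shows "sup_bimor L M (tensor L M) (pure L M)"
proof -
  let ?T = "tensor L M"
  interpret L: complete_lattice L by fact
  interpret M: complete_lattice M by fact
  interpret T: complete_lattice ?T by (rule tensor_complete_lattice[OF L M])
  have cl: "pure L M l m \<in> carrier ?T" if "l \<in> carrier L" "m \<in> carrier M" for l m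
    using bi_ideal_pure[OF L M that] by (simp add: tensor_def)
  have char: "pure L M l m \<sqsubseteq>\<^bsub>?T\<^esub> x \<longleftrightarrow> (l, m) \<in> x"
    if "x \<in> carrier ?T" "l \<in> carrier L" "m \<in> carrier M" for l m x
    using pure_subset_iff[OF L M _ that(2,3)] that(1) by (simp add: tensor_def)
  have bi: "bi_ideal L M x" if "x \<in> carrier ?T" for x using that by (simp add: tensor_def)
  have eqI: "u = v"
    if "u \<in> carrier ?T" "v \<in> carrier ?T"
      and "\<And>x. x \<in> carrier ?T \<Longrightarrow> u \<sqsubseteq>\<^bsub>?T\<^esub> x \<longleftrightarrow> v \<sqsubseteq>\<^bsub>?T\<^esub> x" for u v
    using that by (meson T.le_antisym T.le_refl)
  have 1: "pure L M l (\<Squnion>\<^bsub>M\<^esub> B) = \<Squnion>\<^bsub>?T\<^esub> (pure L M l ` B)"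
    if l: "l \<in> carrier L" and B: "B \<subseteq> carrier M" for l B
  proof (rule eqI)
    have sub: "pure L M l ` B \<subseteq> carrier ?T" using cl l B by blast
    show "pure L M l (\<Squnion>\<^bsub>M\<^esub> B) \<in> carrier ?T" using cl l B by simp
    show "\<Squnion>\<^bsub>?T\<^esub> (pure L M l ` B) \<in> carrier ?T" using sub by simp
    fix x assume x: "x \<in> carrier ?T"
    have "pure L M l (\<Squnion>\<^bsub>M\<^esub> B) \<sqsubseteq>\<^bsub>?T\<^esub> x \<longleftrightarrow> (\<forall>b \<in> B. (l, b) \<in> x)"
      using char[OF x l, of "\<Squnion>\<^bsub>M\<^esub> B"] bi[OF x] l B unfolding bi_ideal_def by simp
    also have "\<dots> \<longleftrightarrow> (\<forall>b \<in> B. pure L M l b \<sqsubseteq>\<^bsub>?T\<^esub> x)"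
      using char[OF x l] B by blast
    also have "\<dots> \<longleftrightarrow> \<Squnion>\<^bsub>?T\<^esub> (pure L M l ` B) \<sqsubseteq>\<^bsub>?T\<^esub> x"
      using complete_lattice_sup_le_iff[OF T.complete_lattice_axioms sub x] by simp
    finally show "pure L M l (\<Squnion>\<^bsub>M\<^esub> B) \<sqsubseteq>\<^bsub>?T\<^esub> x \<longleftrightarrow> \<Squnion>\<^bsub>?T\<^esub> (pure L M l ` B) \<sqsubseteq>\<^bsub>?T\<^esub> x" .
  qed
  have 2: "pure L M (\<Squnion>\<^bsub>L\<^esub> A) m = \<Squnion>\<^bsub>?T\<^esub> ((\<lambda>l. pure L M l m) ` A)"
    if m: "m \<in> carrier M" and A: "A \<subseteq> carrier L" for m A
  proof (rule eqI)
    have sub: "(\<lambda>l. pure L M l m) ` A \<subseteq> carrier ?T" using cl m A by blast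
    show "pure L M (\<Squnion>\<^bsub>L\<^esub> A) m \<in> carrier ?T" using cl m A by simp
    show "\<Squnion>\<^bsub>?T\<^esub> ((\<lambda>l. pure L M l m) ` A) \<in> carrier ?T" using sub by simp
    fix x assume x: "x \<in> carrier ?T"
    have "pure L M (\<Squnion>\<^bsub>L\<^esub> A) m \<sqsubseteq>\<^bsub>?T\<^esub> x \<longleftrightarrow> (\<forall>a \<in> A. (a, m) \<in> x)"
      using char[OF x _ m, of "\<Squnion>\<^bsub>L\<^esub> A"] bi[OF x] m A unfolding bi_ideal_def by simp
    also have "\<dots> \<longleftrightarrow> (\<forall>a \<in> A. pure L M a m \<sqsubseteq>\<^bsub>?T\<^esub> x)"
      using char[OF x _ m] A by blast
    also have "\<dots> \<longleftrightarrow> \<Squnion>\<^bsub>?T\<^esub> ((\<lambda>l. pure L M l m) ` A) \<sqsubseteq>\<^bsub>?T\<^esub> x"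
      using complete_lattice_sup_le_iff[OF T.complete_lattice_axioms sub x] by simp
    finally show "pure L M (\<Squnion>\<^bsub>L\<^esub> A) m \<sqsubseteq>\<^bsub>?T\<^esub> x
      \<longleftrightarrow> \<Squnion>\<^bsub>?T\<^esub> ((\<lambda>l. pure L M l m) ` A) \<sqsubseteq>\<^bsub>?T\<^esub> x" .
  qed
  show ?thesis
    unfolding sup_bimor_def sup_mor_def using cl 1 2 by auto
qed

context
  fixes L :: "('a, 'm) gorder_scheme" and M :: "('b, 'n) gorder_scheme"
    and K :: "('c, 'k) gorder_scheme" and \<beta> :: "'a \<Rightarrow> 'b \<Rightarrow> 'c"
  assumes L: "complete_lattice L" and M: "complete_lattice M" and K: "complete_lattice K"
    and \<beta>: "sup_bimor L M K \<beta>"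
begin

interpretation L: complete_lattice L by (rule L)
interpretation M: complete_lattice M by (rule M)
interpretation K: complete_lattice K by (rule K)
interpretation T: complete_lattice "tensor L M" by (rule tensor_complete_lattice[OF L M])

private lemma \<beta>_closed: "l \<in> carrier L \<Longrightarrow> m \<in> carrier M \<Longrightarrow> \<beta> l m \<in> carrier K"
  using \<beta> unfolding sup_bimor_def sup_mor_def by auto

private lemma image_closed:
  assumes "bi_ideal L M x" shows "(\<lambda>(l, m). \<beta> l m) ` x \<subseteq> carrier K"
  using assms \<beta>_closed unfolding bi_ideal_def by auto

private lemma bi_ideal_below:
  assumes k: "k \<in> carrier K"
  shows "bi_ideal L M {(l, m) \<in> carrier L \<times> carrier M. \<beta> l m \<sqsubseteq>\<^bsub>K\<^esub> k}"
proof -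
  have 1: "\<beta> (\<Squnion>\<^bsub>L\<^esub> A) m \<sqsubseteq>\<^bsub>K\<^esub> k \<longleftrightarrow> (\<forall>a \<in> A. \<beta> a m \<sqsubseteq>\<^bsub>K\<^esub> k)"
    if A: "A \<subseteq> carrier L" and m: "m \<in> carrier M" for A m
  proof -
    have "\<beta> (\<Squnion>\<^bsub>L\<^esub> A) m = \<Squnion>\<^bsub>K\<^esub> ((\<lambda>l. \<beta> l m) ` A)"
      using \<beta> A m unfolding sup_bimor_def sup_mor_def by blast
    moreover have "(\<lambda>l. \<beta> l m) ` A \<subseteq> carrier K" using A m \<beta>_closed by blast
    ultimately show ?thesis using complete_lattice_sup_le_iff[OF K _ k] by simp
  qed
  have 2: "\<beta> l (\<Squnion>\<^bsub>M\<^esub> B) \<sqsubseteq>\<^bsub>K\<^esub> k \<longleftrightarrow> (\<forall>b \<in> B. \<beta> l b \<sqsubseteq>\<^bsub>K\<^esub> k)"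
    if B: "B \<subseteq> carrier M" and l: "l \<in> carrier L" for B l
  proof -
    have "\<beta> l (\<Squnion>\<^bsub>M\<^esub> B) = \<Squnion>\<^bsub>K\<^esub> (\<beta> l ` B)"
      using \<beta> B l unfolding sup_bimor_def sup_mor_def by blast
    moreover have "\<beta> l ` B \<subseteq> carrier K" using B l \<beta>_closed by blast
    ultimately show ?thesis using complete_lattice_sup_le_iff[OF K _ k] by simp
  qed
  show ?thesis
    unfolding bi_ideal_def using 1 2 by (auto simp: subset_iff)
qed

private lemma ext_closed: "bi_ideal L M x \<Longrightarrow> ext K \<beta> x \<in> carrier K"
  unfolding ext_def using image_closed by simp

private lemma ext_le_iff:
  assumes "bi_ideal L M x" "k \<in> carrier K"
  shows "ext K \<beta> x \<sqsubseteq>\<^bsub>K\<^esub> k \<longleftrightarrow>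
    x \<subseteq> {(l, m) \<in> carrier L \<times> carrier M. \<beta> l m \<sqsubseteq>\<^bsub>K\<^esub> k}"
  unfolding ext_def complete_lattice_sup_le_iff[OF K image_closed[OF assms(1)] assms(2)]
  using assms(1) unfolding bi_ideal_def by auto

private lemma K_eqI:
  assumes "u \<in> carrier K" "v \<in> carrier K"
    and "\<And>k. k \<in> carrier K \<Longrightarrow> u \<sqsubseteq>\<^bsub>K\<^esub> k \<longleftrightarrow> v \<sqsubseteq>\<^bsub>K\<^esub> k"
  shows "u = v"
  using assms by (meson K.le_antisym K.le_refl)

lemma ext_mor: "ext K \<beta> \<in> sup_mor (tensor L M) K"
proof -
  have "ext K \<beta> (\<Squnion>\<^bsub>tensor L M\<^esub> X) = \<Squnion>\<^bsub>K\<^esub> (ext K \<beta> ` X)"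
    if X: "X \<subseteq> carrier (tensor L M)" for X
  proof (rule K_eqI)
    have bX: "bi_ideal L M x" if "x \<in> X" for x using X that by (auto simp: tensor_def)
    have bS: "bi_ideal L M (\<Squnion>\<^bsub>tensor L M\<^esub> X)"
      using T.sup_closed[OF X] by (simp add: tensor_def)
    have sub: "ext K \<beta> ` X \<subseteq> carrier K" using bX ext_closed by blast
    show "ext K \<beta> (\<Squnion>\<^bsub>tensor L M\<^esub> X) \<in> carrier K" using bS ext_closed by blast
    show "\<Squnion>\<^bsub>K\<^esub> (ext K \<beta> ` X) \<in> carrier K" using sub by simp
    fix k assume k: "k \<in> carrier K"
    let ?J = "{(l, m) \<in> carrier L \<times> carrier M. \<beta> l m \<sqsubseteq>\<^bsub>K\<^esub> k}"
    have J: "?J \<in> carrier (tensor L M)" using bi_ideal_below[OF k] by (simp add: tensor_def)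
    have "ext K \<beta> (\<Squnion>\<^bsub>tensor L M\<^esub> X) \<sqsubseteq>\<^bsub>K\<^esub> k \<longleftrightarrow> \<Squnion>\<^bsub>tensor L M\<^esub> X \<subseteq> ?J"
      by (rule ext_le_iff[OF bS k])
    also have "\<dots> \<longleftrightarrow> (\<forall>x \<in> X. x \<subseteq> ?J)"
      using complete_lattice_sup_le_iff[OF T.complete_lattice_axioms X J]
      by (simp add: tensor_def)
    also have "\<dots> \<longleftrightarrow> (\<forall>x \<in> X. ext K \<beta> x \<sqsubseteq>\<^bsub>K\<^esub> k)"
      using ext_le_iff[OF bX k] by simp
    also have "\<dots> \<longleftrightarrow> \<Squnion>\<^bsub>K\<^esub> (ext K \<beta> ` X) \<sqsubseteq>\<^bsub>K\<^esub> k"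
      using complete_lattice_sup_le_iff[OF K sub k] by simp
    finally show "ext K \<beta> (\<Squnion>\<^bsub>tensor L M\<^esub> X) \<sqsubseteq>\<^bsub>K\<^esub> k \<longleftrightarrow>
      \<Squnion>\<^bsub>K\<^esub> (ext K \<beta> ` X) \<sqsubseteq>\<^bsub>K\<^esub> k" .
  qed
  then show ?thesis
    unfolding sup_mor_def using ext_closed by (auto simp: tensor_def)
qed

lemma ext_pure:
  assumes "l \<in> carrier L" "m \<in> carrier M"
  shows "ext K \<beta> (pure L M l m) = \<beta> l m"
proof (rule K_eqI)
  have b: "bi_ideal L M (pure L M l m)" using bi_ideal_pure[OF L M assms] by blast
  show "ext K \<beta> (pure L M l m) \<in> carrier K" using b ext_closed by blast
  show "\<beta> l m \<in> carrier K" using assms \<beta>_closed by blast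
  fix k assume k: "k \<in> carrier K"
  show "ext K \<beta> (pure L M l m) \<sqsubseteq>\<^bsub>K\<^esub> k \<longleftrightarrow> \<beta> l m \<sqsubseteq>\<^bsub>K\<^esub> k"
    using ext_le_iff[OF b k] pure_subset_iff[OF L M bi_ideal_below[OF k] assms] assms by simp
qed

lemma ext_unique:
  assumes f: "f \<in> sup_mor (tensor L M) K"
    and eq: "\<And>l m. l \<in> carrier L \<Longrightarrow> m \<in> carrier M \<Longrightarrow> f (pure L M l m) = \<beta> l m"
    and x: "x \<in> carrier (tensor L M)"
  shows "f x = ext K \<beta> x"
proof -
  let ?P = "(\<lambda>(l, m). pure L M l m) ` x"
  have bx: "bi_ideal L M x" using x by (simp add: tensor_def)
  then have xs: "\<And>l m. (l, m) \<in> x \<Longrightarrow> l \<in> carrier L \<and> m \<in> carrier M"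
    unfolding bi_ideal_def by auto
  have P: "?P \<subseteq> carrier (tensor L M)"
    using xs bi_ideal_pure[OF L M] by (auto simp: tensor_def)
  have le: "p \<sqsubseteq>\<^bsub>tensor L M\<^esub> x" if p: "p \<in> ?P" for p
  proof -
    obtain l m where lm: "(l, m) \<in> x" "p = pure L M l m" using p by auto
    then have "pure L M l m \<subseteq> x" using xs[OF lm(1)] pure_subset_iff[OF L M bx] by simp
    then show ?thesis using lm(2) by (simp add: tensor_def)
  qed
  have "\<Squnion>\<^bsub>tensor L M\<^esub> ?P \<sqsubseteq>\<^bsub>tensor L M\<^esub> x"
    using complete_lattice_sup_le_iff[OF T.complete_lattice_axioms P x] le by blast
  moreover have "x \<sqsubseteq>\<^bsub>tensor L M\<^esub> \<Squnion>\<^bsub>tensor L M\<^esub> ?P"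
  proof -
    have "(l, m) \<in> \<Squnion>\<^bsub>tensor L M\<^esub> ?P" if lm: "(l, m) \<in> x" for l m
    proof -
      have "pure L M l m \<subseteq> \<Squnion>\<^bsub>tensor L M\<^esub> ?P"
        using T.sup_upper[OF P, of "pure L M l m"] lm by (force simp: tensor_def)
      then show ?thesis using bi_ideal_pure(2)[OF L M] xs[OF lm] by blast
    qed
    then show ?thesis by (auto simp: tensor_def)
  qed
  ultimately have xP: "\<Squnion>\<^bsub>tensor L M\<^esub> ?P = x"
    using T.le_antisym x T.sup_closed[OF P] by blast
  have "f (\<Squnion>\<^bsub>tensor L M\<^esub> ?P) = \<Squnion>\<^bsub>K\<^esub> (f ` ?P)"
    using f P unfolding sup_mor_def by blast
  then have "f x = \<Squnion>\<^bsub>K\<^esub> (f ` ?P)"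
    by (simp only: xP)
  also have "f ` ?P = (\<lambda>(l, m). \<beta> l m) ` x"
    unfolding image_image by (rule image_cong[OF refl]) (use xs eq in auto)
  finally show ?thesis unfolding ext_def .
qed

end


section \<open>Hopf algebras\<close>

record 'a hopf = "'a gorder" +
  hmult :: "('a \<times> 'a) set \<Rightarrow> 'a"
  hunit :: 'a
  hcomult :: "'a \<Rightarrow> ('a \<times> 'a) set"  (\<open>\<Delta>\<index>\<close>)
  hcounit :: "'a \<Rightarrow> bool"  (\<open>\<epsilon>\<index>\<close>)
  hantipode :: "'a \<Rightarrow> 'a"

definition hpair :: "('a, 'm) gorder_scheme \<Rightarrow> 'a \<Rightarrow> 'a \<Rightarrow> ('a \<times> 'a) set"  (infixl \<open>\<odot>\<index>\<close> 65)
  where "a \<odot>\<^bsub>H\<^esub> b = pure H H a b"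

definition hprod :: "('a, 'm) hopf_scheme \<Rightarrow> 'a \<Rightarrow> 'a \<Rightarrow> 'a"  (infixl \<open>\<cdot>\<index>\<close> 70)
  where "a \<cdot>\<^bsub>H\<^esub> b = hmult H (a \<odot>\<^bsub>H\<^esub> b)"

definition tensor_prod ::
  "('a, 'm) hopf_scheme \<Rightarrow> ('a \<times> 'a) set \<Rightarrow> ('a \<times> 'a) set \<Rightarrow> ('a \<times> 'a) set"
  where "tensor_prod H x y =
    ext (tensor H H) (\<lambda>a b.
      ext (tensor H H) (\<lambda>a' b'. (a \<cdot>\<^bsub>H\<^esub> a') \<odot>\<^bsub>H\<^esub> (b \<cdot>\<^bsub>H\<^esub> b')) y) x"

locale hopf_algebra = complete_lattice H for H :: "('a, 'm) hopf_scheme" (structure) +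
  assumes mult_mor: "hmult H \<in> sup_mor (tensor H H) H"
    and comult_mor: "\<Delta> \<in> sup_mor H (tensor H H)"
    and counit_mor: "\<epsilon> \<in> sup_mor H unit_lat"
    and unit_closed: "hunit H \<in> carrier H"
    and antipode_mor: "hantipode H \<in> sup_mor H H"
    and antipode_invertible:
      "\<exists>T \<in> sup_mor H H. \<forall>h \<in> carrier H. T (hantipode H h) = h \<and> hantipode H (T h) = h"
    and mult_assoc:
      "\<lbrakk>a \<in> carrier H; b \<in> carrier H; c \<in> carrier H\<rbrakk> \<Longrightarrow> (a \<cdot> b) \<cdot> c = a \<cdot> (b \<cdot> c)"
    and mult_unit: "a \<in> carrier H \<Longrightarrow> hunit H \<cdot> a = a" "a \<in> carrier H \<Longrightarrow> a \<cdot> hunit H = a"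
    and comult_coassoc:
      "a \<in> carrier H \<Longrightarrow>
        tensor_assoc H H H (tensor_map (tensor H H) H \<Delta> id (\<Delta> a)) =
        tensor_map H (tensor H H) id \<Delta> (\<Delta> a)"
    and comult_counit:
      "a \<in> carrier H \<Longrightarrow> left_unitor H (tensor_map unit_lat H \<epsilon> id (\<Delta> a)) = a"
      "a \<in> carrier H \<Longrightarrow> right_unitor H (tensor_map H unit_lat id \<epsilon> (\<Delta> a)) = a"
    and comult_unit: "\<Delta> (hunit H) = hunit H \<odot> hunit H"
    and counit_unit: "\<epsilon> (hunit H)"
    and counit_mult:
      "\<lbrakk>a \<in> carrier H; b \<in> carrier H\<rbrakk> \<Longrightarrow> \<epsilon> (a \<cdot> b) \<longleftrightarrow> \<epsilon> a \<and> \<epsilon> b"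
    and comult_mult:
      "\<lbrakk>a \<in> carrier H; b \<in> carrier H\<rbrakk> \<Longrightarrow> \<Delta> (a \<cdot> b) = tensor_prod H (\<Delta> a) (\<Delta> b)"
    and antipode_right:
      "a \<in> carrier H \<Longrightarrow>
        hmult H (tensor_map H H id (hantipode H) (\<Delta> a)) = scale H (\<epsilon> a) (hunit H)"
    and antipode_left:
      "a \<in> carrier H \<Longrightarrow>
        hmult H (tensor_map H H (hantipode H) id (\<Delta> a)) = scale H (\<epsilon> a) (hunit H)"


section \<open>Co-quasitriangular structures and the induced braiding\<close>

locale co_quasitriangular = hopf_algebra H
  for H :: "('a, 'm) hopf_scheme" (structure)
    and R :: "('a \<times> 'a) set \<Rightarrow> bool" and Rinv :: "('a \<times> 'a) set \<Rightarrow> bool" +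
  assumes R_mor: "R \<in> sup_mor (tensor H H) unit_lat"
    and Rinv_mor: "Rinv \<in> sup_mor (tensor H H) unit_lat"
    and Rinv_R:
      "\<lbrakk>a \<in> carrier H; b \<in> carrier H\<rbrakk> \<Longrightarrow>
        ext unit_lat (\<lambda>a1 a2. ext unit_lat (\<lambda>b1 b2.
          Rinv (a1 \<odot> b1) \<and> R (a2 \<odot> b2)) (\<Delta> b)) (\<Delta> a) = (\<epsilon> a \<and> \<epsilon> b)"
    and R_Rinv:
      "\<lbrakk>a \<in> carrier H; b \<in> carrier H\<rbrakk> \<Longrightarrow>
        ext unit_lat (\<lambda>a1 a2. ext unit_lat (\<lambda>b1 b2.
          R (a1 \<odot> b1) \<and> Rinv (a2 \<odot> b2)) (\<Delta> b)) (\<Delta> a) = (\<epsilon> a \<and> \<epsilon> b)"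
    and R_mult_left:
      "\<lbrakk>a \<in> carrier H; b \<in> carrier H; c \<in> carrier H\<rbrakk> \<Longrightarrow>
        R (a \<cdot> b \<odot> c) = ext unit_lat (\<lambda>c1 c2. R (b \<odot> c1) \<and> R (a \<odot> c2)) (\<Delta> c)"
    and R_mult_right:
      "\<lbrakk>a \<in> carrier H; b \<in> carrier H; c \<in> carrier H\<rbrakk> \<Longrightarrow>
        R (a \<odot> b \<cdot> c) = ext unit_lat (\<lambda>a1 a2. R (a1 \<odot> b) \<and> R (a2 \<odot> c)) (\<Delta> a)"
    and R_comm:
      "\<lbrakk>a \<in> carrier H; b \<in> carrier H\<rbrakk> \<Longrightarrow>
        ext H (\<lambda>a1 a2. ext H (\<lambda>b1 b2. scale H (R (b1 \<odot> a1)) (a2 \<cdot> b2)) (\<Delta> b)) (\<Delta> a) =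
        ext H (\<lambda>a1 a2. ext H (\<lambda>b1 b2. scale H (R (b2 \<odot> a2)) (b1 \<cdot> a1)) (\<Delta> b)) (\<Delta> a)"

text \<open>The Sweedler-style join of \<open>\<phi> a\<^sub>(\<^sub>1\<^sub>) a\<^sub>(\<^sub>2\<^sub>) a\<^sub>(\<^sub>3\<^sub>)\<close>, from \<open>(id \<otimes> \<Delta>) \<Delta>\<close>.\<close>

definition sweedler3 ::
  "('a, 'm) hopf_scheme \<Rightarrow> ('c, 'k) gorder_scheme \<Rightarrow> ('a \<Rightarrow> 'a \<Rightarrow> 'a \<Rightarrow> 'c) \<Rightarrow> 'a \<Rightarrow> 'c"
  where "sweedler3 H K \<phi> a =
    ext K (\<lambda>a1 t. ext K (\<lambda>a2 a3. \<phi> a1 a2 a3) (\<Delta>\<^bsub>H\<^esub> t)) (\<Delta>\<^bsub>H\<^esub> a)"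

definition braiding ::
  "('a, 'm) hopf_scheme \<Rightarrow> (('a \<times> 'a) set \<Rightarrow> bool) \<Rightarrow> (('a \<times> 'a) set \<Rightarrow> bool)
    \<Rightarrow> ('a \<times> 'a) set \<Rightarrow> ('a \<times> 'a) set"
  where "braiding H R Rinv =
    ext (tensor H H) (\<lambda>a b.
      sweedler3 H (tensor H H) (\<lambda>a1 a2 a3.
        sweedler3 H (tensor H H) (\<lambda>b1 b2 b3.
          scale (tensor H H) (R (a1 \<odot>\<^bsub>H\<^esub> b1) \<and> Rinv (a3 \<odot>\<^bsub>H\<^esub> b3)) (b2 \<odot>\<^bsub>H\<^esub> a2)) b) a)"


section \<open>The remnant\<close>

definition counit_kernel_top :: "('a, 'm) hopf_scheme \<Rightarrow> 'a"
  where "counit_kernel_top H = \<Squnion>\<^bsub>H\<^esub> {h \<in> carrier H. \<not> \<epsilon>\<^bsub>H\<^esub> h}"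

definition remnant_rel :: "('a, 'm) hopf_scheme \<Rightarrow> ('a \<times> 'a) set"
  where "remnant_rel H =
    {(a, b) \<in> carrier H \<times> carrier H.
      a \<squnion>\<^bsub>H\<^esub> counit_kernel_top H = b \<squnion>\<^bsub>H\<^esub> counit_kernel_top H}"

definition remnant_proj :: "('a, 'm) hopf_scheme \<Rightarrow> 'a \<Rightarrow> 'a set"
  where "remnant_proj H h = remnant_rel H `` {h}"

definition remnant_incl :: "('a, 'm) hopf_scheme \<Rightarrow> 'a set \<Rightarrow> 'a"
  where "remnant_incl H q = (THE x. \<exists>h \<in> q. x = h \<squnion>\<^bsub>H\<^esub> counit_kernel_top H)"

definition remnant_lattice :: "('a, 'm) hopf_scheme \<Rightarrow> 'a set gorder"
  where "remnant_lattice H =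
    \<lparr>carrier = carrier H // remnant_rel H, eq = (=),
     le = (\<lambda>p q. remnant_incl H p \<sqsubseteq>\<^bsub>H\<^esub> remnant_incl H q)\<rparr>"

text \<open>
  The operations on the quotient are the only ones for which the projection, a surjection with
  section \<^const>\<open>remnant_incl\<close>, can be a morphism of Hopf algebras.
\<close>

definition remnant_hopf :: "('a, 'm) hopf_scheme \<Rightarrow> 'a set hopf"
  where "remnant_hopf H = (let Q = remnant_lattice H; \<pi> = remnant_proj H; \<iota> = remnant_incl H in
    \<lparr>carrier = carrier Q, eq = eq Q, le = le Q,
     hmult = ext Q (\<lambda>p q. \<pi> (\<iota> p \<cdot>\<^bsub>H\<^esub> \<iota> q)),
     hunit = \<pi> (hunit H),
     hcomult = (\<lambda>q. tensor_map Q Q \<pi> \<pi> (\<Delta>\<^bsub>H\<^esub> (\<iota> q))),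
     hcounit = (\<lambda>q. \<epsilon>\<^bsub>H\<^esub> (\<iota> q)),
     hantipode = (\<lambda>q. \<pi> (hantipode H (\<iota> q)))\<rparr>)"

text \<open>
  Under the isomorphism of the quotient with a group algebra, the elements of the carrier below
  are the singletons.
\<close>

definition remnant :: "('a, 'm) hopf_scheme \<Rightarrow> 'a set monoid"
  where "remnant H = (let Q = remnant_hopf H in
    \<lparr>carrier = {q \<in> carrier Q. q \<noteq> \<bottom>\<^bsub>Q\<^esub> \<and> \<Delta>\<^bsub>Q\<^esub> q = q \<odot>\<^bsub>Q\<^esub> q},
     mult = (\<lambda>p q. p \<cdot>\<^bsub>Q\<^esub> q),
     one = hunit Q\<rparr>)"

text \<open>
  The section \<^const>\<open>remnant_incl\<close> preserves only nonempty joins, so \<open>\<iota> \<otimes> \<iota>\<close> is not an instance of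
  \<^const>\<open>tensor_map\<close>; the composite \<open>\<xi> = (\<pi> \<otimes> \<pi>) \<Gamma> (\<iota> \<otimes> \<iota>)\<close> is the join-preserving map whose value
  on an elementary tensor \<open>(p, q)\<close> is \<open>(\<pi> \<otimes> \<pi>) (\<Gamma> (\<iota> p, \<iota> q))\<close>.
\<close>

definition restricts_to ::
  "('a, 'm) hopf_scheme \<Rightarrow> (('a \<times> 'a) set \<Rightarrow> ('a \<times> 'a) set)
    \<Rightarrow> ('a set \<times> 'a set \<Rightarrow> 'a set \<times> 'a set) \<Rightarrow> bool"
  where "restricts_to H \<Gamma> r \<longleftrightarrow>
    (let Q = remnant_hopf H; G = carrier (remnant H); \<pi> = remnant_proj H; \<iota> = remnant_incl H in
     r \<in> G \<times> G \<rightarrow> G \<times> G \<and>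
     (\<exists>\<xi> \<in> sup_mor (tensor Q Q) (tensor Q Q).
       (\<forall>p \<in> carrier Q. \<forall>q \<in> carrier Q.
         \<xi> (p \<odot>\<^bsub>Q\<^esub> q) = tensor_map Q Q \<pi> \<pi> (\<Gamma> (\<iota> p \<odot>\<^bsub>H\<^esub> \<iota> q))) \<and>
       (\<forall>g \<in> G. \<forall>h \<in> G. \<xi> (g \<odot>\<^bsub>Q\<^esub> h) = fst (r (g, h)) \<odot>\<^bsub>Q\<^esub> snd (r (g, h)))))"


section \<open>Braiding operators\<close>

locale braiding_operator = group G
  for G :: "('g, 'm) monoid_scheme" (structure) and r :: "'g \<times> 'g \<Rightarrow> 'g \<times> 'g" +
  assumes closed: "r \<in> carrier G \<times> carrier G \<rightarrow> carrier G \<times> carrier G"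
    and mult_r:
      "\<lbrakk>g \<in> carrier G; h \<in> carrier G\<rbrakk> \<Longrightarrow> (case r (g, h) of (x, y) \<Rightarrow> x \<otimes> y) = g \<otimes> h"
    and r_one_left: "g \<in> carrier G \<Longrightarrow> r (\<one>, g) = (g, \<one>)"
    and r_one_right: "g \<in> carrier G \<Longrightarrow> r (g, \<one>) = (\<one>, g)"
    and r_mult_left:
      "\<lbrakk>f \<in> carrier G; g \<in> carrier G; h \<in> carrier G\<rbrakk> \<Longrightarrow>
        r (g \<otimes> h, f) = (case r (h, f) of (x, y) \<Rightarrow> case r (g, x) of (u, v) \<Rightarrow> (u, v \<otimes> y))"
    and r_mult_right:
      "\<lbrakk>f \<in> carrier G; g \<in> carrier G; h \<in> carrier G\<rbrakk> \<Longrightarrow>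
        r (g, h \<otimes> f) = (case r (g, h) of (x, y) \<Rightarrow> case r (y, f) of (u, v) \<Rightarrow> (x \<otimes> u, v))"

end

theory Submission
  imports Defs
begin

text \<open>
  Write \<open>D\<close> for the largest element of \<open>H\<close> with counit \<open>False\<close>, \<open>Q\<close> for the quotient by \<open>D\<close> with
  projection \<open>\<pi>\<close>, and \<open>G\<close> for the nonzero grouplike elements of \<open>Q\<close>. The proof has two halves.

  First, \<open>Q\<close> is the power set of the group \<open>G\<close>. In \<open>Q\<close> an element has counit \<open>True\<close> iff it is
  nonzero. By the antipode axiom the unit of \<open>Q\<close> is an atom: if \<open>0 \<noteq> x \<le> 1\<close>, then
  \<open>1 = x\<^sub>1 S(x\<^sub>2) \<le> x S(1) \<le> x\<close>. Hence \<open>p S(q) = 1 = S(p) q\<close> for every term \<open>(p, q)\<close> of a coproduct in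
  which both entries are nonzero. If \<open>(u, v)\<close> is such a term of \<open>\<Delta>(q)\<close>, then \<open>(p, u)\<close> is again a term, and
  \<open>p = p S(u) v = v\<close>; since \<open>q\<close> is the join of these \<open>v\<close>, it follows that \<open>p = q\<close>. So coproducts
  in \<open>Q\<close> are diagonal (\<open>comult_diagonal\<close>), and therefore the grouplike elements are atoms, are
  join-prime (\<open>grouplike_prime\<close>), generate \<open>Q\<close> under joins (\<open>le_iff_grouplike\<close>), and form a group.

  Second, the braiding is studied through join-preserving maps to the truth values. Those on
  \<open>H \<otimes> H\<close> form a quantale under convolution, in which \<open>\<R>\<close> is invertible with inverse \<open>\<R>\<^sup>-\<^sup>1\<close>. For
  \<open>g\<close> in \<open>G\<close> the character \<open>\<chi>\<^sub>g(a)\<close>, which says that \<open>g \<le> \<pi>(a)\<close>, is a functional; the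
  products \<open>\<chi>\<^sub>x \<otimes> \<chi>\<^sub>y\<close> are orthogonal idempotents with join the unit. The pair \<open>(y, x)\<close> occurs in the
  image of \<open>\<Gamma>(a, b)\<close> in \<open>Q \<otimes> Q\<close> iff the conjugate \<open>\<R> (\<chi>\<^sub>x \<otimes> \<chi>\<^sub>y) \<R>\<^sup>-\<^sup>1\<close> holds at \<open>(a, b)\<close>. Conjugates
  of orthogonal idempotents with join the unit are again such, and this says that every
  pair \<open>(g, h)\<close> is sent to exactly one pair \<open>(y, x)\<close> (\<open>braids_exists\<close>, \<open>braids_unique\<close>). The
  conjugates also lie below the unit \<open>\<epsilon> \<otimes> \<epsilon>\<close>, so the braiding descends to \<open>Q \<otimes> Q\<close>.

  The axioms of a braiding operator come from identities in these quantales: \<open>m r = m\<close> from the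
  commutation axiom, which conjugates \<open>\<chi>\<^sub>z(b.a)\<close> into \<open>\<chi>\<^sub>z(a.b)\<close>; the unit laws from
  \<open>\<R>(1, a) = \<epsilon>(a) = \<R>(a, 1)\<close>, an invertible idempotent being the unit; and the laws for products
  from \<open>\<R>(a.b, c)\<close> and \<open>\<R>(a, b.c)\<close> being products of two legs of \<open>\<R>\<close> in the quantale of
  functionals in three variables (\<open>hexagon\<close>). For the latter an inequality suffices, because
  the image pair is unique.
\<close>



section \<open>Join-preserving maps tested on upper bounds\<close>

lemma Sup_unit_lat: "\<Squnion>\<^bsub>unit_lat\<^esub> X \<longleftrightarrow> True \<in> X"
proof -
  interpret U: complete_lattice unit_lat by (rule unit_lat_complete_lattice)
  have "\<Squnion>\<^bsub>unit_lat\<^esub> X \<sqsubseteq>\<^bsub>unit_lat\<^esub> k \<longleftrightarrow> (\<forall>x\<in>X. x \<longrightarrow> k)" for k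
    using complete_lattice_sup_le_iff[OF unit_lat_complete_lattice, of X k]
    by (simp add: unit_lat_def)
  from this[of False] show ?thesis by (auto simp: unit_lat_def)
qed

lemma ext_unit_lat: "ext unit_lat \<beta> x \<longleftrightarrow> (\<exists>(a, b)\<in>x. \<beta> a b)"
  unfolding ext_def Sup_unit_lat by auto

lemma sup_mor_unit_lat_iff:
  "f \<in> sup_mor L unit_lat \<longleftrightarrow> (\<forall>A \<subseteq> carrier L. f (\<Squnion>\<^bsub>L\<^esub> A) \<longleftrightarrow> (\<exists>a\<in>A. f a))"
proof -
  have "f \<in> carrier L \<rightarrow> carrier unit_lat" by (simp add: unit_lat_def)
  then show ?thesis by (auto simp: sup_mor_def Sup_unit_lat image_iff)
qed

lemma complete_lattice_eqI:
  assumes "complete_lattice K" "u \<in> carrier K" "v \<in> carrier K"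
    and "\<And>k. k \<in> carrier K \<Longrightarrow> u \<sqsubseteq>\<^bsub>K\<^esub> k \<longleftrightarrow> v \<sqsubseteq>\<^bsub>K\<^esub> k"
  shows "u = v"
proof -
  interpret K: complete_lattice K by fact
  show ?thesis using assms(2,3) assms(4)[of u] assms(4)[of v] K.le_antisym K.le_refl by simp
qed

lemma sup_pair_absorb:
  assumes "complete_lattice K" "a \<in> carrier K" "b \<in> carrier K" "a \<sqsubseteq>\<^bsub>K\<^esub> b"
  shows "\<Squnion>\<^bsub>K\<^esub> {a, b} = b"
proof -
  interpret K: complete_lattice K by fact
  have "\<Squnion>\<^bsub>K\<^esub> {a, b} \<sqsubseteq>\<^bsub>K\<^esub> b"
    using complete_lattice_sup_le_iff[OF assms(1), of "{a, b}" b] assms by simp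
  moreover have "b \<sqsubseteq>\<^bsub>K\<^esub> \<Squnion>\<^bsub>K\<^esub> {a, b}" using K.sup_upper[of "{a, b}" b] assms by simp
  ultimately show ?thesis using K.le_antisym[of "\<Squnion>\<^bsub>K\<^esub> {a, b}" b] K.sup_closed[of "{a, b}"] assms
    by simp
qed

lemma bottom_eq_sup_empty:
  assumes "complete_lattice K"
  shows "\<bottom>\<^bsub>K\<^esub> = \<Squnion>\<^bsub>K\<^esub> {}"
proof -
  interpret K: complete_lattice K by fact
  have "\<Squnion>\<^bsub>K\<^esub> {} \<sqsubseteq>\<^bsub>K\<^esub> \<bottom>\<^bsub>K\<^esub>"
    using complete_lattice_sup_le_iff[OF assms, of "{}" "\<bottom>\<^bsub>K\<^esub>"] by simp
  then show ?thesis using K.le_antisym[of "\<bottom>\<^bsub>K\<^esub>" "\<Squnion>\<^bsub>K\<^esub> {}"] K.bottom_lower[of "\<Squnion>\<^bsub>K\<^esub> {}"]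
    by simp
qed

lemma sup_mor_closed: "f \<in> sup_mor L K \<Longrightarrow> a \<in> carrier L \<Longrightarrow> f a \<in> carrier K"
  by (auto simp: sup_mor_def)

lemma sup_mor_le_iff:
  assumes "complete_lattice K" "f \<in> sup_mor L K" "A \<subseteq> carrier L" "k \<in> carrier K"
  shows "f (\<Squnion>\<^bsub>L\<^esub> A) \<sqsubseteq>\<^bsub>K\<^esub> k \<longleftrightarrow> (\<forall>a\<in>A. f a \<sqsubseteq>\<^bsub>K\<^esub> k)"
proof -
  have "f ` A \<subseteq> carrier K" using assms(2,3) by (auto simp: sup_mor_def)
  moreover have "f (\<Squnion>\<^bsub>L\<^esub> A) = \<Squnion>\<^bsub>K\<^esub> (f ` A)" using assms(2,3) by (simp add: sup_mor_def)
  ultimately show ?thesis using complete_lattice_sup_le_iff[OF assms(1) _ assms(4)] by simp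
qed

text \<open>
  Two elements with the same upper bounds are equal, so preservation of joins can be tested against
  an upper bound, where it becomes a statement of predicate logic.
\<close>

lemma sup_morI:
  assumes K: "complete_lattice K" and L: "complete_lattice L"
    and closed: "\<And>a. a \<in> carrier L \<Longrightarrow> f a \<in> carrier K"
    and le: "\<And>A k. A \<subseteq> carrier L \<Longrightarrow> k \<in> carrier K \<Longrightarrow>
      f (\<Squnion>\<^bsub>L\<^esub> A) \<sqsubseteq>\<^bsub>K\<^esub> k \<longleftrightarrow> (\<forall>a\<in>A. f a \<sqsubseteq>\<^bsub>K\<^esub> k)"
  shows "f \<in> sup_mor L K"
proof -
  interpret K: complete_lattice K by fact
  interpret L: complete_lattice L by fact
  have "f (\<Squnion>\<^bsub>L\<^esub> A) = \<Squnion>\<^bsub>K\<^esub> (f ` A)" if A: "A \<subseteq> carrier L" for A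
  proof (rule complete_lattice_eqI[OF K])
    have sub: "f ` A \<subseteq> carrier K" using A closed by blast
    show "f (\<Squnion>\<^bsub>L\<^esub> A) \<in> carrier K" using A closed by simp
    show "\<Squnion>\<^bsub>K\<^esub> (f ` A) \<in> carrier K" using sub by simp
    fix k assume "k \<in> carrier K"
    then show "f (\<Squnion>\<^bsub>L\<^esub> A) \<sqsubseteq>\<^bsub>K\<^esub> k \<longleftrightarrow> \<Squnion>\<^bsub>K\<^esub> (f ` A) \<sqsubseteq>\<^bsub>K\<^esub> k"
      using le[OF A] complete_lattice_sup_le_iff[OF K sub] by simp
  qed
  then show ?thesis using closed by (auto simp: sup_mor_def)
qed

lemma sup_mor_comp:
  assumes "f \<in> sup_mor L M" "g \<in> sup_mor M K"
  shows "(\<lambda>x. g (f x)) \<in> sup_mor L K"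
proof -
  have "g (f (\<Squnion>\<^bsub>L\<^esub> A)) = \<Squnion>\<^bsub>K\<^esub> ((\<lambda>x. g (f x)) ` A)" if A: "A \<subseteq> carrier L" for A
  proof -
    have "f ` A \<subseteq> carrier M" using A assms(1) by (auto simp: sup_mor_def)
    then show ?thesis using A assms by (simp add: sup_mor_def image_image)
  qed
  then show ?thesis using assms by (auto simp: sup_mor_def)
qed

lemma sup_mor_mono:
  assumes L: "complete_lattice L" and K: "complete_lattice K" and f: "f \<in> sup_mor L K"
    and ab: "a \<in> carrier L" "b \<in> carrier L" "a \<sqsubseteq>\<^bsub>L\<^esub> b"
  shows "f a \<sqsubseteq>\<^bsub>K\<^esub> f b"
proof -
  interpret L: complete_lattice L by fact
  interpret K: complete_lattice K by fact
  have "\<Squnion>\<^bsub>L\<^esub> {a, b} = b" by (rule sup_pair_absorb[OF L ab])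
  moreover have "f b \<in> carrier K" using f ab by (simp add: sup_mor_closed)
  ultimately show ?thesis
    using sup_mor_le_iff[OF K f, of "{a, b}" "f b"] ab by simp
qed

lemma ext_le_iff':
  assumes "complete_lattice K" "k \<in> carrier K"
    and "\<And>l m. (l, m) \<in> x \<Longrightarrow> \<beta> l m \<in> carrier K"
  shows "ext K \<beta> x \<sqsubseteq>\<^bsub>K\<^esub> k \<longleftrightarrow> (\<forall>(l, m)\<in>x. \<beta> l m \<sqsubseteq>\<^bsub>K\<^esub> k)"
proof -
  have "(\<lambda>(l, m). \<beta> l m) ` x \<subseteq> carrier K" using assms(3) by auto
  then show ?thesis
    unfolding ext_def using complete_lattice_sup_le_iff[OF assms(1) _ assms(2)] by auto
qed

lemma ball_pairs:
  assumes "\<And>a b. (a, b) \<in> x \<Longrightarrow> P a b \<longleftrightarrow> Q a b"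
  shows "(\<forall>(a, b)\<in>x. P a b) \<longleftrightarrow> (\<forall>(a, b)\<in>x. Q a b)"
  using assms by auto

lemma ext_closed':
  assumes "complete_lattice K" "\<And>l m. (l, m) \<in> x \<Longrightarrow> \<beta> l m \<in> carrier K"
  shows "ext K \<beta> x \<in> carrier K"
proof -
  interpret K: complete_lattice K by fact
  show ?thesis unfolding ext_def by (rule K.sup_closed) (use assms(2) in auto)
qed

text \<open>
  Iterated Sweedler sums are nested values of \<^const>\<open>ext\<close>. Closure and the test against an upper
  bound are needed together for the induction through the layers; repeated use of this rule removes
  all the layers of a sum at once.
\<close>

lemma ext_nested:
  assumes K: "complete_lattice K" and k: "k \<in> carrier K"
    and \<beta>: "\<And>l m. (l, m) \<in> x \<Longrightarrow> \<beta> l m \<in> carrier K \<and> (\<beta> l m \<sqsubseteq>\<^bsub>K\<^esub> k \<longleftrightarrow> P l m)"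
  shows "ext K \<beta> x \<in> carrier K \<and> (ext K \<beta> x \<sqsubseteq>\<^bsub>K\<^esub> k \<longleftrightarrow> (\<forall>(l, m)\<in>x. P l m))"
proof
  show "ext K \<beta> x \<in> carrier K" by (rule ext_closed'[OF K]) (use \<beta> in blast)
  have "ext K \<beta> x \<sqsubseteq>\<^bsub>K\<^esub> k \<longleftrightarrow> (\<forall>(l, m)\<in>x. \<beta> l m \<sqsubseteq>\<^bsub>K\<^esub> k)"
    by (rule ext_le_iff'[OF K k]) (use \<beta> in blast)
  also have "\<dots> \<longleftrightarrow> (\<forall>(l, m)\<in>x. P l m)" by (rule ball_pairs) (use \<beta> in blast)
  finally show "ext K \<beta> x \<sqsubseteq>\<^bsub>K\<^esub> k \<longleftrightarrow> (\<forall>(l, m)\<in>x. P l m)" .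
qed


section \<open>Elements of a tensor product as sets of terms\<close>

lemma tensor_simps:
  "carrier (tensor L M) = {I. bi_ideal L M I}" "x \<sqsubseteq>\<^bsub>tensor L M\<^esub> y \<longleftrightarrow> x \<subseteq> y"
  by (simp_all add: tensor_def)

lemma bi_ideal_carrier: "bi_ideal L M I \<Longrightarrow> (l, m) \<in> I \<Longrightarrow> l \<in> carrier L \<and> m \<in> carrier M"
  using conjunct1[of "I \<subseteq> carrier L \<times> carrier M"] by (auto simp only: bi_ideal_def)

lemma bi_idealI:
  assumes "complete_lattice L" "complete_lattice M"
    and "\<And>A m. A \<subseteq> carrier L \<Longrightarrow> m \<in> carrier M \<Longrightarrow> P (\<Squnion>\<^bsub>L\<^esub> A) m \<longleftrightarrow> (\<forall>a\<in>A. P a m)"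
    and "\<And>l B. l \<in> carrier L \<Longrightarrow> B \<subseteq> carrier M \<Longrightarrow> P l (\<Squnion>\<^bsub>M\<^esub> B) \<longleftrightarrow> (\<forall>b\<in>B. P l b)"
  shows "bi_ideal L M {(l, m) \<in> carrier L \<times> carrier M. P l m}"
proof -
  interpret L: complete_lattice L by fact
  interpret M: complete_lattice M by fact
  show ?thesis unfolding bi_ideal_def using assms(3,4) by (auto simp: subset_iff)
qed

lemma bi_ideal_le:
  assumes L: "complete_lattice L" and M: "complete_lattice M" and K: "complete_lattice K"
    and \<beta>: "sup_bimor L M K \<beta>" and k: "k \<in> carrier K"
  shows "bi_ideal L M {(l, m) \<in> carrier L \<times> carrier M. \<beta> l m \<sqsubseteq>\<^bsub>K\<^esub> k}"
proof (rule bi_idealI[OF L M])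
  show "\<beta> (\<Squnion>\<^bsub>L\<^esub> A) m \<sqsubseteq>\<^bsub>K\<^esub> k \<longleftrightarrow> (\<forall>a\<in>A. \<beta> a m \<sqsubseteq>\<^bsub>K\<^esub> k)"
    if "A \<subseteq> carrier L" "m \<in> carrier M" for A m
    using sup_mor_le_iff[OF K _ that(1) k, of "\<lambda>l. \<beta> l m"] \<beta> that by (simp add: sup_bimor_def)
  show "\<beta> l (\<Squnion>\<^bsub>M\<^esub> B) \<sqsubseteq>\<^bsub>K\<^esub> k \<longleftrightarrow> (\<forall>b\<in>B. \<beta> l b \<sqsubseteq>\<^bsub>K\<^esub> k)"
    if "l \<in> carrier L" "B \<subseteq> carrier M" for l B
    using sup_mor_le_iff[OF K _ that(2) k, of "\<beta> l"] \<beta> that by (simp add: sup_bimor_def)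
qed

text \<open>
  Smaller elements are covered by the closure under joins in both directions: \<open>l' \<le> l\<close> means that
  the join of \<open>l'\<close> and \<open>l\<close> is \<open>l\<close>.
\<close>

lemma bi_ideal_mono:
  assumes L: "complete_lattice L" and M: "complete_lattice M" and I: "bi_ideal L M I"
    and lm: "(l, m) \<in> I" "l' \<in> carrier L" "m' \<in> carrier M" "l' \<sqsubseteq>\<^bsub>L\<^esub> l" "m' \<sqsubseteq>\<^bsub>M\<^esub> m"
  shows "(l', m') \<in> I"
proof -
  interpret L: complete_lattice L by fact
  interpret M: complete_lattice M by fact
  have c: "l \<in> carrier L" "m \<in> carrier M" using bi_ideal_carrier[OF I lm(1)] by auto
  have "\<Squnion>\<^bsub>L\<^esub> {l', l} = l" by (rule sup_pair_absorb[OF L lm(2) c(1) lm(4)])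
  moreover have "\<Squnion>\<^bsub>M\<^esub> {m', m} = m" by (rule sup_pair_absorb[OF M lm(3) c(2) lm(5)])
  moreover have "(\<Squnion>\<^bsub>L\<^esub> {l', l}, m) \<in> I \<longleftrightarrow> (\<forall>a\<in>{l', l}. (a, m) \<in> I)"
    using I c lm unfolding bi_ideal_def by simp
  moreover have "(l', \<Squnion>\<^bsub>M\<^esub> {m', m}) \<in> I \<longleftrightarrow> (\<forall>b\<in>{m', m}. (l', b) \<in> I)"
    using I c lm unfolding bi_ideal_def by simp
  ultimately show ?thesis using lm(1) by simp
qed

lemma bi_ideal_bot:
  assumes L: "complete_lattice L" and M: "complete_lattice M" and I: "bi_ideal L M I"
  shows "m \<in> carrier M \<Longrightarrow> (\<bottom>\<^bsub>L\<^esub>, m) \<in> I" "l \<in> carrier L \<Longrightarrow> (l, \<bottom>\<^bsub>M\<^esub>) \<in> I"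
proof -
  interpret L: complete_lattice L by fact
  interpret M: complete_lattice M by fact
  have "\<bottom>\<^bsub>L\<^esub> = \<Squnion>\<^bsub>L\<^esub> {}" "\<bottom>\<^bsub>M\<^esub> = \<Squnion>\<^bsub>M\<^esub> {}"
    using bottom_eq_sup_empty L M by blast+
  then show "m \<in> carrier M \<Longrightarrow> (\<bottom>\<^bsub>L\<^esub>, m) \<in> I" "l \<in> carrier L \<Longrightarrow> (l, \<bottom>\<^bsub>M\<^esub>) \<in> I"
    using I unfolding bi_ideal_def by (metis empty_iff empty_subsetI)+
qed

lemma tensor_eq_bottomI:
  assumes L: "complete_lattice L" and M: "complete_lattice M"
    and x: "x \<in> carrier (tensor L M)" "\<And>J. bi_ideal L M J \<Longrightarrow> x \<subseteq> J"
  shows "x = \<bottom>\<^bsub>tensor L M\<^esub>"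
proof -
  interpret T: complete_lattice "tensor L M" by (rule tensor_complete_lattice[OF L M])
  have "x \<subseteq> \<bottom>\<^bsub>tensor L M\<^esub>" using x(2) T.bottom_closed by (simp add: tensor_simps)
  moreover have "\<bottom>\<^bsub>tensor L M\<^esub> \<subseteq> x" using T.bottom_lower[OF x(1)] by (simp add: tensor_simps)
  ultimately show ?thesis by simp
qed

text \<open>
  This is how values of \<^const>\<open>tensor_map\<close> are computed below: an inclusion into a bi-ideal is
  tested on terms.
\<close>

lemma tensor_map_subset_iff:
  assumes L': "complete_lattice L'" and M': "complete_lattice M'"
    and f: "f \<in> carrier L \<rightarrow> carrier L'" and g: "g \<in> carrier M \<rightarrow> carrier M'"
    and x: "bi_ideal L M x" and J: "bi_ideal L' M' J"
  shows "tensor_map L' M' f g x \<subseteq> J \<longleftrightarrow> (\<forall>(a, b)\<in>x. (f a, g b) \<in> J)"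
proof -
  have c: "f a \<in> carrier L'" "g b \<in> carrier M'" if "(a, b) \<in> x" for a b
    using bi_ideal_carrier[OF x that] f g by auto
  have "tensor_map L' M' f g x \<subseteq> J \<longleftrightarrow> (\<forall>(a, b)\<in>x. pure L' M' (f a) (g b) \<subseteq> J)"
    using ext_le_iff'[OF tensor_complete_lattice[OF L' M'], of J x "\<lambda>a b. pure L' M' (f a) (g b)"]
      bi_ideal_pure(1)[OF L' M' c] J
    by (simp add: tensor_map_def tensor_simps)
  also have "\<dots> \<longleftrightarrow> (\<forall>(a, b)\<in>x. (f a, g b) \<in> J)"
    using pure_subset_iff[OF L' M' J] c by blast
  finally show ?thesis .
qed

lemma tensor_map_closed:
  assumes L': "complete_lattice L'" and M': "complete_lattice M'"
    and f: "f \<in> carrier L \<rightarrow> carrier L'" and g: "g \<in> carrier M \<rightarrow> carrier M'"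
    and x: "bi_ideal L M x"
  shows "bi_ideal L' M' (tensor_map L' M' f g x)"
proof -
  have c: "f a \<in> carrier L'" "g b \<in> carrier M'" if "(a, b) \<in> x" for a b
    using bi_ideal_carrier[OF x that] f g by auto
  show ?thesis
    using ext_closed'[OF tensor_complete_lattice[OF L' M'], of x "\<lambda>a b. pure L' M' (f a) (g b)"]
      bi_ideal_pure(1)[OF L' M' c] by (simp add: tensor_map_def tensor_simps)
qed

text \<open>
  The corresponding notions for maps into a type of class \<open>complete_lattice\<close>, used for the
  convolution algebras below.
\<close>

definition sup_bilinear ::
  "('a, 'm) gorder_scheme \<Rightarrow> ('b, 'n) gorder_scheme \<Rightarrow> ('a \<Rightarrow> 'b \<Rightarrow> 'c::complete_lattice) \<Rightarrow> bool"
  where "sup_bilinear L M \<beta> \<longleftrightarrow>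
    (\<forall>A \<subseteq> carrier L. \<forall>m \<in> carrier M. \<beta> (\<Squnion>\<^bsub>L\<^esub> A) m = Sup ((\<lambda>l. \<beta> l m) ` A)) \<and>
    (\<forall>l \<in> carrier L. \<forall>B \<subseteq> carrier M. \<beta> l (\<Squnion>\<^bsub>M\<^esub> B) = Sup (\<beta> l ` B))"

definition terms_Sup :: "('a \<Rightarrow> 'b \<Rightarrow> 'c::complete_lattice) \<Rightarrow> ('a \<times> 'b) set \<Rightarrow> 'c"
  where "terms_Sup \<beta> x = Sup ((\<lambda>(l, m). \<beta> l m) ` x)"

lemma terms_Sup_le_iff: "terms_Sup \<beta> x \<le> k \<longleftrightarrow> (\<forall>(l, m)\<in>x. \<beta> l m \<le> k)"
  by (auto simp: terms_Sup_def Sup_le_iff)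

lemma terms_Sup_cong:
  "(\<And>l m. (l, m) \<in> x \<Longrightarrow> \<beta> l m = \<gamma> l m) \<Longrightarrow> terms_Sup \<beta> x = terms_Sup \<gamma> x"
  unfolding terms_Sup_def by (intro arg_cong[where f = Sup] image_cong) auto

lemma terms_Sup_bool: "terms_Sup P x \<longleftrightarrow> (\<exists>(a, b)\<in>x. P a b)" for P :: "'b \<Rightarrow> 'c \<Rightarrow> bool"
  by (auto simp: terms_Sup_def)

lemma bi_ideal_sup_bilinear:
  assumes "complete_lattice L" "complete_lattice M" "sup_bilinear L M \<beta>"
  shows "bi_ideal L M {(l, m) \<in> carrier L \<times> carrier M. \<beta> l m \<le> k}"
  by (rule bi_idealI[OF assms(1,2)]) (use assms(3) in \<open>auto simp: sup_bilinear_def Sup_le_iff\<close>)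

lemma terms_Sup_le_iff_subset:
  assumes "bi_ideal L M x"
  shows "terms_Sup \<beta> x \<le> k \<longleftrightarrow> x \<subseteq> {(l, m) \<in> carrier L \<times> carrier M. \<beta> l m \<le> k}"
  unfolding terms_Sup_le_iff using bi_ideal_carrier[OF assms] by auto

lemma terms_Sup_pure:
  assumes L: "complete_lattice L" and M: "complete_lattice M" and \<beta>: "sup_bilinear L M \<beta>"
    and lm: "l \<in> carrier L" "m \<in> carrier M"
  shows "terms_Sup \<beta> (pure L M l m) = \<beta> l m"
proof (rule order_eq_iff[THEN iffD2], intro conjI)
  have "terms_Sup \<beta> (pure L M l m) \<le> k \<longleftrightarrow> \<beta> l m \<le> k" for k
    unfolding terms_Sup_le_iff_subset[OF bi_ideal_pure(1)[OF L M lm]]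
      pure_subset_iff[OF L M bi_ideal_sup_bilinear[OF L M \<beta>] lm] using lm by simp
  then show "terms_Sup \<beta> (pure L M l m) \<le> \<beta> l m" "\<beta> l m \<le> terms_Sup \<beta> (pure L M l m)"
    by blast+
qed

lemma terms_Sup_Sup:
  assumes L: "complete_lattice L" and M: "complete_lattice M" and \<beta>: "sup_bilinear L M \<beta>"
    and X: "X \<subseteq> carrier (tensor L M)"
  shows "terms_Sup \<beta> (\<Squnion>\<^bsub>tensor L M\<^esub> X) = Sup (terms_Sup \<beta> ` X)"
proof -
  interpret T: complete_lattice "tensor L M" by (rule tensor_complete_lattice[OF L M])
  have "terms_Sup \<beta> (\<Squnion>\<^bsub>tensor L M\<^esub> X) \<le> k \<longleftrightarrow> Sup (terms_Sup \<beta> ` X) \<le> k" for k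
  proof -
    let ?J = "{(l, m) \<in> carrier L \<times> carrier M. \<beta> l m \<le> k}"
    have J: "?J \<in> carrier (tensor L M)"
      using bi_ideal_sup_bilinear[OF L M \<beta>] by (simp add: tensor_simps)
    have S: "bi_ideal L M (\<Squnion>\<^bsub>tensor L M\<^esub> X)"
      using T.sup_closed[OF X] by (simp add: tensor_simps)
    have "terms_Sup \<beta> (\<Squnion>\<^bsub>tensor L M\<^esub> X) \<le> k \<longleftrightarrow> (\<forall>x\<in>X. x \<subseteq> ?J)"
      using complete_lattice_sup_le_iff[OF T.complete_lattice_axioms X J]
      unfolding terms_Sup_le_iff_subset[OF S] by (simp add: tensor_simps)
    also have "\<dots> \<longleftrightarrow> (\<forall>x\<in>X. terms_Sup \<beta> x \<le> k)"
      using X by (intro ball_cong refl terms_Sup_le_iff_subset[symmetric]) (auto simp: tensor_simps)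
    finally show ?thesis by (simp add: Sup_le_iff)
  qed
  then show ?thesis by (blast intro: order_antisym)
qed


section \<open>Quantales and their homomorphisms\<close>

text \<open>
  The elements form a subset of a complete lattice type, because the
  join-preserving maps out of \<open>H\<close>, which are to be its elements, depend on the carrier of \<open>H\<close>.
\<close>

locale quantale =
  fixes A :: "'b::complete_lattice set" and mult :: "'b \<Rightarrow> 'b \<Rightarrow> 'b"  (infixl \<open>\<bullet>\<close> 70)
    and one :: 'b
  assumes Sup_closed: "X \<subseteq> A \<Longrightarrow> Sup X \<in> A"
    and mult_closed: "a \<in> A \<Longrightarrow> b \<in> A \<Longrightarrow> a \<bullet> b \<in> A"
    and one_closed: "one \<in> A"
    and assoc: "a \<in> A \<Longrightarrow> b \<in> A \<Longrightarrow> c \<in> A \<Longrightarrow> a \<bullet> b \<bullet> c = a \<bullet> (b \<bullet> c)"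
    and one_left: "a \<in> A \<Longrightarrow> one \<bullet> a = a"
    and one_right: "a \<in> A \<Longrightarrow> a \<bullet> one = a"
    and Sup_mult: "X \<subseteq> A \<Longrightarrow> b \<in> A \<Longrightarrow> Sup X \<bullet> b = Sup ((\<lambda>a. a \<bullet> b) ` X)"
    and mult_Sup: "X \<subseteq> A \<Longrightarrow> b \<in> A \<Longrightarrow> b \<bullet> Sup X = Sup ((\<bullet>) b ` X)"
begin

lemma bot_closed: "bot \<in> A"
  using Sup_closed[of "{}"] by simp

lemma bot_mult: "b \<in> A \<Longrightarrow> bot \<bullet> b = bot"
  using Sup_mult[of "{}" b] by simp

lemma mult_bot: "b \<in> A \<Longrightarrow> b \<bullet> bot = bot"
  using mult_Sup[of "{}" b] by simp

lemma mult_mono: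
  assumes "a \<in> A" "a' \<in> A" "b \<in> A" "b' \<in> A" "a \<le> a'" "b \<le> b'"
  shows "a \<bullet> b \<le> a' \<bullet> b'"
proof -
  have "a' = Sup {a, a'}" "b' = Sup {b, b'}" using assms by (simp_all add: sup_absorb2)
  then have "a' \<bullet> b = Sup {a \<bullet> b, a' \<bullet> b}" "a' \<bullet> b' = Sup {a' \<bullet> b, a' \<bullet> b'}"
    using Sup_mult[of "{a, a'}" b] mult_Sup[of "{b, b'}" a'] assms by simp_all
  then have "a \<bullet> b \<le> a' \<bullet> b" "a' \<bullet> b \<le> a' \<bullet> b'"
    by (metis Sup_upper insertI1)+
  then show ?thesis by (rule order_trans)
qed

lemma inverse_unique:
  assumes "u \<in> A" "v \<in> A" "w \<in> A" "v \<bullet> u = one" "u \<bullet> w = one"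
  shows "v = w"
  using assoc[of v u w] one_left[of w] one_right[of v] assms by simp

lemma idempotent_unit:
  assumes "u \<in> A" "v \<in> A" "u \<bullet> u = u" "v \<bullet> u = one"
  shows "u = one"
  using assoc[of v u u] one_left[of u] assms by simp

end

lemma quantale_bool: "quantale (UNIV :: bool set) (\<and>) True"
  by unfold_locales auto

locale quantale_hom = Q: quantale A mult one + Q': quantale A' mult' one'
  for A :: "'b::complete_lattice set" and mult one
    and A' :: "'c::complete_lattice set" and mult' one' +
  fixes f :: "'b \<Rightarrow> 'c"
  assumes closed: "a \<in> A \<Longrightarrow> f a \<in> A'"
    and Sup: "X \<subseteq> A \<Longrightarrow> f (Sup X) = Sup (f ` X)"
    and mult: "a \<in> A \<Longrightarrow> b \<in> A \<Longrightarrow> f (mult a b) = mult' (f a) (f b)"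
    and one: "f one = one'"
begin

lemma bot: "f bot = bot"
  using Sup[of "{}"] by simp

lemma mono:
  assumes "a \<in> A" "b \<in> A" "a \<le> b"
  shows "f a \<le> f b"
proof -
  have "Sup {a, b} = b" using assms by (simp add: sup_absorb2)
  then have "f b = Sup {f a, f b}" using Sup[of "{a, b}"] assms by simp
  then show ?thesis by (metis Sup_upper insertI1)
qed

lemma terms_Sup:
  assumes "\<And>x y. (x, y) \<in> X \<Longrightarrow> \<beta> x y \<in> A"
  shows "f (terms_Sup \<beta> X) = terms_Sup (\<lambda>x y. f (\<beta> x y)) X"
proof -
  have "(\<lambda>(x, y). \<beta> x y) ` X \<subseteq> A" using assms by auto
  then show ?thesis
    unfolding terms_Sup_def by (simp add: Sup image_image case_prod_unfold)
qed

end

lemma quantale_terms_Sup: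
  assumes "quantale B m e" "\<And>x y. (x, y) \<in> X \<Longrightarrow> \<beta> x y \<in> B"
  shows "terms_Sup \<beta> X \<in> B"
    and "b \<in> B \<Longrightarrow> m (terms_Sup \<beta> X) b = terms_Sup (\<lambda>x y. m (\<beta> x y) b) X"
    and "b \<in> B \<Longrightarrow> m b (terms_Sup \<beta> X) = terms_Sup (\<lambda>x y. m b (\<beta> x y)) X"
proof -
  interpret quantale B m e by fact
  have *: "(\<lambda>(x, y). \<beta> x y) ` X \<subseteq> B" using assms(2) by auto
  show "terms_Sup \<beta> X \<in> B" unfolding terms_Sup_def by (rule Sup_closed[OF *])
  show "m (terms_Sup \<beta> X) b = terms_Sup (\<lambda>x y. m (\<beta> x y) b) X" if "b \<in> B"
    unfolding terms_Sup_def Sup_mult[OF * that] by (simp add: image_image case_prod_unfold)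
  show "m b (terms_Sup \<beta> X) = terms_Sup (\<lambda>x y. m b (\<beta> x y)) X" if "b \<in> B"
    unfolding terms_Sup_def mult_Sup[OF * that] by (simp add: image_image case_prod_unfold)
qed

lemma quantale_hom_scalars:
  assumes "quantale B m e"
  shows "quantale_hom UNIV (\<and>) True B m e (\<lambda>t. if t then e else bot)"
proof -
  interpret B: quantale B m e by fact
  interpret quantale "UNIV :: bool set" "(\<and>)" True by (rule quantale_bool)
  show ?thesis
  proof
    fix X :: "bool set"
    have "(if Sup X then e else bot) \<le> k \<longleftrightarrow> Sup ((\<lambda>t. if t then e else bot) ` X) \<le> k" for k
      by (auto simp: Sup_le_iff)
    then show "(if Sup X then e else bot) = Sup ((\<lambda>t. if t then e else bot) ` X)"
      by (blast intro: order_antisym)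
  qed (auto simp: B.one_closed B.bot_closed B.one_left B.bot_mult B.mult_bot)
qed


section \<open>Functionals\<close>

text \<open>
  The value outside the carrier is fixed so that equality of functionals is equality of functions,
  and a functional with values in functionals is again a function into a complete lattice. In this
  way \<open>functionals H (functionals H B)\<close> consists of the maps from \<open>H \<otimes> H\<close> to \<open>B\<close> in curried form.
\<close>

definition functionals :: "('a, 'm) gorder_scheme \<Rightarrow> 'b::complete_lattice set \<Rightarrow> ('a \<Rightarrow> 'b) set"
  where "functionals L B = {\<phi>. (\<forall>a\<in>carrier L. \<phi> a \<in> B) \<and> (\<forall>a. a \<notin> carrier L \<longrightarrow> \<phi> a = bot) \<and>
    (\<forall>X\<subseteq>carrier L. \<phi> (\<Squnion>\<^bsub>L\<^esub> X) = Sup (\<phi> ` X))}"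

lemma functionalsI:
  assumes "\<And>a. a \<in> carrier L \<Longrightarrow> \<phi> a \<in> B" "\<And>a. a \<notin> carrier L \<Longrightarrow> \<phi> a = bot"
    and "\<And>X. X \<subseteq> carrier L \<Longrightarrow> \<phi> (\<Squnion>\<^bsub>L\<^esub> X) = Sup (\<phi> ` X)"
  shows "\<phi> \<in> functionals L B"
  using assms by (simp add: functionals_def)

lemma functionals_closed: "\<phi> \<in> functionals L B \<Longrightarrow> a \<in> carrier L \<Longrightarrow> \<phi> a \<in> B"
  and functionals_outside: "\<phi> \<in> functionals L B \<Longrightarrow> a \<notin> carrier L \<Longrightarrow> \<phi> a = bot"
  and functionals_Sup:
    "\<phi> \<in> functionals L B \<Longrightarrow> X \<subseteq> carrier L \<Longrightarrow> \<phi> (\<Squnion>\<^bsub>L\<^esub> X) = Sup (\<phi> ` X)"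
  by (simp_all add: functionals_def)

lemma functionals_bool_iff:
  "\<phi> \<in> functionals L UNIV \<longleftrightarrow> \<phi> \<in> sup_mor L unit_lat \<and> (\<forall>a. a \<notin> carrier L \<longrightarrow> \<not> \<phi> a)"
  unfolding sup_mor_unit_lat_iff functionals_def by (auto simp: image_iff)

lemma functionals_Sup_closed:
  assumes "quantale B m e" and F: "F \<subseteq> functionals L B"
  shows "Sup F \<in> functionals L B"
proof (rule functionalsI)
  interpret quantale B m e by fact
  show "Sup F a \<in> B" if "a \<in> carrier L" for a
    using F that by (auto simp: functionals_closed intro!: Sup_closed)
  show "Sup F a = bot" if "a \<notin> carrier L" for a
    using F that functionals_outside[of _ L B a] by (auto simp: subset_iff intro!: SUP_bot_conv(2)[THEN iffD2])
  show "Sup F (\<Squnion>\<^bsub>L\<^esub> X) = Sup (Sup F ` X)" if X: "X \<subseteq> carrier L" for X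
  proof -
    have "Sup F (\<Squnion>\<^bsub>L\<^esub> X) = (SUP \<phi>\<in>F. SUP a\<in>X. \<phi> a)"
      unfolding Sup_apply by (rule SUP_cong) (use F X functionals_Sup in blast)+
    also have "\<dots> = Sup (Sup F ` X)" by (simp add: SUP_commute[of _ F])
    finally show ?thesis .
  qed
qed

lemma terms_Sup_apply: "terms_Sup \<beta> x b = terms_Sup (\<lambda>l m. \<beta> l m b) x"
  unfolding terms_Sup_def by (simp add: case_prod_unfold image_image)

lemma sup_bilinear_mult:
  assumes "quantale B m e" "\<phi> \<in> functionals L B" "\<psi> \<in> functionals M B"
  shows "sup_bilinear L M (\<lambda>x y. m (\<phi> x) (\<psi> y))"
proof -
  interpret quantale B m e by fact
  have "m (\<phi> (\<Squnion>\<^bsub>L\<^esub> X)) (\<psi> y) = (SUP x\<in>X. m (\<phi> x) (\<psi> y))"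
    if "X \<subseteq> carrier L" "y \<in> carrier M" for X y
    using Sup_mult[of "\<phi> ` X" "\<psi> y"] that functionals_closed[OF assms(2)] functionals_closed[OF assms(3)]
    by (simp add: functionals_Sup[OF assms(2)] image_image image_subset_iff in_mono)
  moreover have "m (\<phi> x) (\<psi> (\<Squnion>\<^bsub>M\<^esub> X)) = (SUP y\<in>X. m (\<phi> x) (\<psi> y))"
    if "X \<subseteq> carrier M" "x \<in> carrier L" for X x
    using mult_Sup[of "\<psi> ` X" "\<phi> x"] that functionals_closed[OF assms(2)] functionals_closed[OF assms(3)]
    by (simp add: functionals_Sup[OF assms(3)] image_image image_subset_iff in_mono)
  ultimately show ?thesis by (simp add: sup_bilinear_def)
qed


section \<open>Sweedler sums\<close>

context hopf_algebra
begin

lemma lattice: "complete_lattice H"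
  by (rule complete_lattice_axioms)

lemma tensor_lattice: "complete_lattice (tensor H H)"
  by (rule tensor_complete_lattice[OF lattice lattice])

lemma comult_closed: "a \<in> carrier H \<Longrightarrow> bi_ideal H H (\<Delta> a)"
  using sup_mor_closed[OF comult_mor, of a] by (simp add: tensor_simps)

lemma comult_terms: "(x, y) \<in> \<Delta> a \<Longrightarrow> a \<in> carrier H \<Longrightarrow> x \<in> carrier H \<and> y \<in> carrier H"
  using bi_ideal_carrier[OF comult_closed] .

lemma hprod_bimor: "sup_bimor H H H (\<lambda>a b. a \<cdot> b)"
proof -
  have p: "sup_bimor H H (tensor H H) (pure H H)" by (rule pure_bimor[OF lattice lattice])
  show ?thesis
    unfolding sup_bimor_def hprod_def hpair_def
  proof (intro conjI ballI)
    show "(\<lambda>b. hmult H (pure H H a b)) \<in> sup_mor H H" if "a \<in> carrier H" for a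
      by (rule sup_mor_comp[OF _ mult_mor]) (use p that in \<open>simp add: sup_bimor_def\<close>)
    show "(\<lambda>a. hmult H (pure H H a b)) \<in> sup_mor H H" if "b \<in> carrier H" for b
      by (rule sup_mor_comp[OF _ mult_mor]) (use p that in \<open>simp add: sup_bimor_def\<close>)
  qed
qed

lemma hprod_closed: "a \<in> carrier H \<Longrightarrow> b \<in> carrier H \<Longrightarrow> a \<cdot> b \<in> carrier H"
  using hprod_bimor sup_mor_closed unfolding sup_bimor_def by fast

lemma hprod_Sup:
  "A \<subseteq> carrier H \<Longrightarrow> b \<in> carrier H \<Longrightarrow> (\<Squnion> A) \<cdot> b = \<Squnion> ((\<lambda>a. a \<cdot> b) ` A)"
  "A \<subseteq> carrier H \<Longrightarrow> b \<in> carrier H \<Longrightarrow> b \<cdot> (\<Squnion> A) = \<Squnion> ((\<lambda>a. b \<cdot> a) ` A)"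
  using hprod_bimor unfolding sup_bimor_def sup_mor_def by auto

lemma counit_Sup: "A \<subseteq> carrier H \<Longrightarrow> \<epsilon> (\<Squnion> A) \<longleftrightarrow> (\<exists>a\<in>A. \<epsilon> a)"
  using counit_mor unfolding sup_mor_unit_lat_iff by blast

lemma comult_Sup_terms:
  assumes "sup_bilinear H H \<beta>" "X \<subseteq> carrier H"
  shows "terms_Sup \<beta> (\<Delta> (\<Squnion> X)) = (SUP a\<in>X. terms_Sup \<beta> (\<Delta> a))"
proof -
  have "\<Delta> (\<Squnion> X) = \<Squnion>\<^bsub>tensor H H\<^esub> (\<Delta> ` X)" using comult_mor assms(2) by (simp add: sup_mor_def)
  moreover have "\<Delta> ` X \<subseteq> carrier (tensor H H)" using comult_mor assms(2) by (auto simp: sup_mor_def)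
  ultimately show ?thesis using terms_Sup_Sup[OF lattice lattice assms(1)] by (simp add: image_image)
qed

lemma tensor_prod_terms:
  assumes \<beta>: "sup_bilinear H H \<beta>" and x: "bi_ideal H H x" and y: "bi_ideal H H y"
  shows "terms_Sup \<beta> (tensor_prod H x y) =
    terms_Sup (\<lambda>a b. terms_Sup (\<lambda>a' b'. \<beta> (a \<cdot> a') (b \<cdot> b')) y) x"
proof -
  let ?T = "tensor H H"
  have "terms_Sup \<beta> (tensor_prod H x y) \<le> k \<longleftrightarrow>
    terms_Sup (\<lambda>a b. terms_Sup (\<lambda>a' b'. \<beta> (a \<cdot> a') (b \<cdot> b')) y) x \<le> k" for k
  proof -
    let ?J = "{(l, m) \<in> carrier H \<times> carrier H. \<beta> l m \<le> k}"
    have J: "bi_ideal H H ?J" by (rule bi_ideal_sup_bilinear[OF lattice lattice \<beta>])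
    then have J': "?J \<in> carrier ?T" by (simp add: tensor_simps)
    have "tensor_prod H x y \<in> carrier ?T \<and> (tensor_prod H x y \<sqsubseteq>\<^bsub>?T\<^esub> ?J \<longleftrightarrow>
      (\<forall>(a, b)\<in>x. \<forall>(a', b')\<in>y. \<beta> (a \<cdot> a') (b \<cdot> b') \<le> k))"
      unfolding tensor_prod_def hpair_def
    proof (intro ext_nested[OF tensor_lattice J'])
      fix a b a' b' assume "(a, b) \<in> x" "(a', b') \<in> y"
      then have c: "a \<cdot> a' \<in> carrier H" "b \<cdot> b' \<in> carrier H"
        using bi_ideal_carrier[OF x] bi_ideal_carrier[OF y] by (auto simp: hprod_closed)
      show "pure H H (a \<cdot> a') (b \<cdot> b') \<in> carrier ?T \<and>
        (pure H H (a \<cdot> a') (b \<cdot> b') \<sqsubseteq>\<^bsub>?T\<^esub> ?J \<longleftrightarrow> \<beta> (a \<cdot> a') (b \<cdot> b') \<le> k)"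
        using bi_ideal_pure(1)[OF lattice lattice c] pure_subset_iff[OF lattice lattice J c] c
        by (simp add: tensor_simps)
    qed
    then show ?thesis
      using terms_Sup_le_iff_subset[of H H "tensor_prod H x y" \<beta> k]
      by (simp add: tensor_simps terms_Sup_le_iff)
  qed
  then show ?thesis by (blast intro: order_antisym)
qed

lemma counit_terms:
  assumes \<phi>: "\<phi> \<in> functionals H B" and a: "a \<in> carrier H"
  shows "terms_Sup (\<lambda>x y. if \<epsilon> x then \<phi> y else bot) (\<Delta> a) = \<phi> a"
    and "terms_Sup (\<lambda>x y. if \<epsilon> y then \<phi> x else bot) (\<Delta> a) = \<phi> a"
proof -
  have eps: "\<epsilon> \<in> carrier H \<rightarrow> carrier unit_lat" by (simp add: unit_lat_def)
  have id: "id \<in> carrier H \<rightarrow> carrier H" by simp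
  have bot: "\<phi> \<bottom> = bot" using functionals_Sup[OF \<phi>, of "{}"] bottom_eq_sup_empty[OF lattice] by simp
  have below: "\<phi> (\<Squnion> X) \<le> k \<longleftrightarrow> (\<forall>x\<in>X. \<phi> x \<le> k)" if "X \<subseteq> carrier H" for X k
    using functionals_Sup[OF \<phi> that] by (simp add: Sup_le_iff)
  have scale_le: "\<phi> (scale H t l) \<le> k \<longleftrightarrow> (t \<longrightarrow> \<phi> l \<le> k)" for t l k
    by (simp add: scale_def bot)
  have Sup_le: "(\<Squnion>\<^bsub>unit_lat\<^esub> X \<longrightarrow> P) \<longleftrightarrow> (\<forall>t\<in>X. t \<longrightarrow> P)" for X P
    unfolding Sup_unit_lat by (metis (full_types))
  have "terms_Sup (\<lambda>x y. if \<epsilon> x then \<phi> y else bot) (\<Delta> a) \<le> k \<longleftrightarrow> \<phi> a \<le> k" for k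
  proof -
    let ?J = "{(t, l) \<in> carrier unit_lat \<times> carrier H. \<phi> (scale H t l) \<le> k}"
    let ?y = "tensor_map unit_lat H \<epsilon> id (\<Delta> a)"
    have J: "bi_ideal unit_lat H ?J"
    proof (rule bi_idealI[OF unit_lat_complete_lattice lattice])
      show "\<phi> (scale H t (\<Squnion> X)) \<le> k \<longleftrightarrow> (\<forall>l\<in>X. \<phi> (scale H t l) \<le> k)" if "X \<subseteq> carrier H" for t X
        using below[OF that] by (auto simp: scale_le)
    qed (simp_all only: scale_le Sup_le)
    have y: "bi_ideal unit_lat H ?y"
      by (rule tensor_map_closed[OF unit_lat_complete_lattice lattice eps id comult_closed[OF a]])
    have sc: "scale H t l \<in> carrier H" if "(t, l) \<in> ?y" for t l
      using bi_ideal_carrier[OF y that] by (simp add: scale_def)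
    have "\<phi> a \<le> k \<longleftrightarrow> \<phi> (\<Squnion> ((\<lambda>(t, l). scale H t l) ` ?y)) \<le> k"
      using comult_counit(1)[OF a] by (simp add: left_unitor_def ext_def)
    also have "\<dots> \<longleftrightarrow> ?y \<subseteq> ?J"
      using sc bi_ideal_carrier[OF y] by (subst below) auto
    also have "\<dots> \<longleftrightarrow> (\<forall>(x, y)\<in>\<Delta> a. (\<epsilon> x, y) \<in> ?J)"
      using tensor_map_subset_iff[OF unit_lat_complete_lattice lattice eps id comult_closed[OF a] J] by simp
    also have "\<dots> \<longleftrightarrow> (\<forall>(x, y)\<in>\<Delta> a. (if \<epsilon> x then \<phi> y else bot) \<le> k)"
      using comult_terms[OF _ a] by (auto simp: scale_def bot unit_lat_def)
    finally show ?thesis by (simp add: terms_Sup_le_iff)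
  qed
  then show "terms_Sup (\<lambda>x y. if \<epsilon> x then \<phi> y else bot) (\<Delta> a) = \<phi> a"
    by (blast intro: order_antisym)
  have "terms_Sup (\<lambda>x y. if \<epsilon> y then \<phi> x else bot) (\<Delta> a) \<le> k \<longleftrightarrow> \<phi> a \<le> k" for k
  proof -
    let ?J = "{(l, t) \<in> carrier H \<times> carrier unit_lat. \<phi> (scale H t l) \<le> k}"
    let ?y = "tensor_map H unit_lat id \<epsilon> (\<Delta> a)"
    have J: "bi_ideal H unit_lat ?J"
    proof (rule bi_idealI[OF lattice unit_lat_complete_lattice])
      show "\<phi> (scale H t (\<Squnion> X)) \<le> k \<longleftrightarrow> (\<forall>l\<in>X. \<phi> (scale H t l) \<le> k)" if "X \<subseteq> carrier H" for t X
        using below[OF that] by (auto simp: scale_le)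
    qed (simp_all only: scale_le Sup_le)
    have y: "bi_ideal H unit_lat ?y"
      by (rule tensor_map_closed[OF lattice unit_lat_complete_lattice id eps comult_closed[OF a]])
    have sc: "scale H t l \<in> carrier H" if "(l, t) \<in> ?y" for t l
      using bi_ideal_carrier[OF y that] by (simp add: scale_def)
    have "\<phi> a \<le> k \<longleftrightarrow> \<phi> (\<Squnion> ((\<lambda>(l, t). scale H t l) ` ?y)) \<le> k"
      using comult_counit(2)[OF a] by (simp add: right_unitor_def ext_def)
    also have "\<dots> \<longleftrightarrow> ?y \<subseteq> ?J"
      using sc bi_ideal_carrier[OF y] by (subst below) auto
    also have "\<dots> \<longleftrightarrow> (\<forall>(x, y)\<in>\<Delta> a. (x, \<epsilon> y) \<in> ?J)"
      using tensor_map_subset_iff[OF lattice unit_lat_complete_lattice id eps comult_closed[OF a] J] by simp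
    also have "\<dots> \<longleftrightarrow> (\<forall>(x, y)\<in>\<Delta> a. (if \<epsilon> y then \<phi> x else bot) \<le> k)"
      using comult_terms[OF _ a] by (auto simp: scale_def bot unit_lat_def)
    finally show ?thesis by (simp add: terms_Sup_le_iff)
  qed
  then show "terms_Sup (\<lambda>x y. if \<epsilon> y then \<phi> x else bot) (\<Delta> a) = \<phi> a"
    by (blast intro: order_antisym)
qed

text \<open>
  Both sides are tested against an upper bound \<open>k\<close>. The pairs \<open>(x, t)\<close> for which \<open>\<tau> x\<close> stays below
  \<open>k\<close> on all terms of \<open>t\<close> form a bi-ideal \<open>I\<close>, and the pairs \<open>(t, z)\<close> with the other bracketing form
  a bi-ideal \<open>J\<close>; an element of \<open>(H \<otimes> H) \<otimes> H\<close> lies in \<open>J\<close> iff its reassociation lies in \<open>I\<close>.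
  So the two tests agree by coassociativity.
\<close>

lemma coassoc_terms:
  fixes \<tau> :: "'a \<Rightarrow> 'a \<Rightarrow> 'a \<Rightarrow> 'c::complete_lattice"
  assumes \<tau>1: "\<And>z. z \<in> carrier H \<Longrightarrow> sup_bilinear H H (\<lambda>x y. \<tau> x y z)"
    and \<tau>2: "\<And>x. x \<in> carrier H \<Longrightarrow> sup_bilinear H H (\<tau> x)"
    and a: "a \<in> carrier H"
  shows "terms_Sup (\<lambda>t z. terms_Sup (\<lambda>x y. \<tau> x y z) (\<Delta> t)) (\<Delta> a) =
    terms_Sup (\<lambda>x t. terms_Sup (\<tau> x) (\<Delta> t)) (\<Delta> a)"
proof -
  let ?T = "tensor H H"
  have id: "id \<in> carrier H \<rightarrow> carrier H" and D: "\<Delta> \<in> carrier H \<rightarrow> carrier ?T"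
    using comult_mor by (simp_all add: sup_mor_def)
  have TSup: "terms_Sup \<beta> (\<Squnion>\<^bsub>?T\<^esub> X) \<le> k \<longleftrightarrow> (\<forall>t\<in>X. terms_Sup \<beta> t \<le> k)"
    if "sup_bilinear H H \<beta>" "X \<subseteq> carrier ?T" for \<beta> :: "'a \<Rightarrow> 'a \<Rightarrow> 'c" and X k
    using terms_Sup_Sup[OF lattice lattice that] by (simp add: Sup_le_iff)
  have "terms_Sup (\<lambda>t z. terms_Sup (\<lambda>x y. \<tau> x y z) (\<Delta> t)) (\<Delta> a) \<le> k \<longleftrightarrow>
    terms_Sup (\<lambda>x t. terms_Sup (\<tau> x) (\<Delta> t)) (\<Delta> a) \<le> k" for k
  proof -
    let ?I = "{(x, t) \<in> carrier H \<times> carrier ?T. terms_Sup (\<tau> x) t \<le> k}"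
    let ?J = "{(t, z) \<in> carrier ?T \<times> carrier H. terms_Sup (\<lambda>x y. \<tau> x y z) t \<le> k}"
    let ?y = "tensor_map ?T H \<Delta> id (\<Delta> a)"
    have I: "bi_ideal H ?T ?I"
    proof (rule bi_idealI[OF lattice tensor_lattice])
      fix A t assume A: "A \<subseteq> carrier H" and t: "t \<in> carrier ?T"
      have "\<tau> (\<Squnion> A) y z \<le> k \<longleftrightarrow> (\<forall>x\<in>A. \<tau> x y z \<le> k)" if "(y, z) \<in> t" for y z
        using \<tau>1[of z] A bi_ideal_carrier[of H H t y z] t that
        by (auto simp: sup_bilinear_def tensor_simps Sup_le_iff)
      then show "terms_Sup (\<tau> (\<Squnion> A)) t \<le> k \<longleftrightarrow> (\<forall>x\<in>A. terms_Sup (\<tau> x) t \<le> k)"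
        unfolding terms_Sup_le_iff by fastforce
    qed (use \<tau>2 TSup in blast)
    have J: "bi_ideal ?T H ?J"
    proof (rule bi_idealI[OF tensor_lattice lattice])
      fix A t assume A: "A \<subseteq> carrier H" and t: "t \<in> carrier ?T"
      have "\<tau> x y (\<Squnion> A) \<le> k \<longleftrightarrow> (\<forall>z\<in>A. \<tau> x y z \<le> k)" if "(x, y) \<in> t" for x y
        using \<tau>2[of x] A bi_ideal_carrier[of H H t x y] t that
        by (auto simp: sup_bilinear_def tensor_simps Sup_le_iff)
      then show "terms_Sup (\<lambda>x y. \<tau> x y (\<Squnion> A)) t \<le> k \<longleftrightarrow> (\<forall>z\<in>A. terms_Sup (\<lambda>x y. \<tau> x y z) t \<le> k)"
        unfolding terms_Sup_le_iff by fastforce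
    qed (use \<tau>1 TSup in blast)
    have y: "bi_ideal ?T H ?y"
      by (rule tensor_map_closed[OF tensor_lattice lattice D id comult_closed[OF a]])
    have L: "complete_lattice (tensor H ?T)"
      by (rule tensor_complete_lattice[OF lattice tensor_lattice])
    have I': "?I \<in> carrier (tensor H ?T)" using I by (simp add: tensor_simps)
    have "tensor_assoc H H H ?y \<in> carrier (tensor H ?T) \<and> (tensor_assoc H H H ?y \<sqsubseteq>\<^bsub>tensor H ?T\<^esub> ?I \<longleftrightarrow>
      (\<forall>(t, z)\<in>?y. \<forall>(x, y)\<in>t. \<tau> x y z \<le> k))"
      unfolding tensor_assoc_def
    proof (intro ext_nested[OF L I'])
      fix t z x y assume tz: "(t, z) \<in> ?y" and xy: "(x, y) \<in> t"
      have c: "x \<in> carrier H" "y \<in> carrier H" "z \<in> carrier H"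
        using bi_ideal_carrier[OF y tz] bi_ideal_carrier[of H H t, OF _ xy] by (auto simp: tensor_simps)
      have p: "pure H H y z \<in> carrier ?T"
        using bi_ideal_pure(1)[OF lattice lattice, of y z] c by (simp add: tensor_simps)
      show "pure H ?T x (pure H H y z) \<in> carrier (tensor H ?T) \<and>
        (pure H ?T x (pure H H y z) \<sqsubseteq>\<^bsub>tensor H ?T\<^esub> ?I \<longleftrightarrow> \<tau> x y z \<le> k)"
        using bi_ideal_pure(1)[OF lattice tensor_lattice c(1) p]
          pure_subset_iff[OF lattice tensor_lattice I c(1) p] p c terms_Sup_pure[OF lattice lattice \<tau>2, of x y z]
        by (simp add: tensor_simps(2)) (simp add: tensor_simps(1))
    qed
    then have "tensor_assoc H H H ?y \<subseteq> ?I \<longleftrightarrow> (\<forall>(t, z)\<in>?y. \<forall>(x, y)\<in>t. \<tau> x y z \<le> k)"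
      by (simp add: tensor_simps)
    also have "\<dots> \<longleftrightarrow> ?y \<subseteq> ?J"
      using bi_ideal_carrier[OF y] by (auto simp: terms_Sup_le_iff)
    also have "\<dots> \<longleftrightarrow> (\<forall>(t, z)\<in>\<Delta> a. (\<Delta> t, z) \<in> ?J)"
      using tensor_map_subset_iff[OF tensor_lattice lattice D id comult_closed[OF a] J] by simp
    also have "\<dots> \<longleftrightarrow> (\<forall>(t, z)\<in>\<Delta> a. terms_Sup (\<lambda>x y. \<tau> x y z) (\<Delta> t) \<le> k)"
      using comult_terms[OF _ a] D by auto
    finally have 1: "tensor_assoc H H H ?y \<subseteq> ?I \<longleftrightarrow>
      (\<forall>(t, z)\<in>\<Delta> a. terms_Sup (\<lambda>x y. \<tau> x y z) (\<Delta> t) \<le> k)" .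
    have "tensor_map H ?T id \<Delta> (\<Delta> a) \<subseteq> ?I \<longleftrightarrow> (\<forall>(x, t)\<in>\<Delta> a. (x, \<Delta> t) \<in> ?I)"
      using tensor_map_subset_iff[OF lattice tensor_lattice id D comult_closed[OF a] I] by simp
    also have "\<dots> \<longleftrightarrow> (\<forall>(x, t)\<in>\<Delta> a. terms_Sup (\<tau> x) (\<Delta> t) \<le> k)"
      using comult_terms[OF _ a] D by auto
    finally have 2: "tensor_map H ?T id \<Delta> (\<Delta> a) \<subseteq> ?I \<longleftrightarrow>
      (\<forall>(x, t)\<in>\<Delta> a. terms_Sup (\<tau> x) (\<Delta> t) \<le> k)" .
    show ?thesis using 1 2 comult_coassoc[OF a] by (simp add: terms_Sup_le_iff)
  qed
  then show ?thesis by (blast intro: order_antisym)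
qed


section \<open>Convolution\<close>

text \<open>
  As \<open>m\<close> may itself be a convolution, \<open>conv (conv m)\<close> is
  the convolution of functionals on \<open>H \<otimes> H\<close> in curried form, and so on for more variables.
\<close>

definition conv :: "('b::complete_lattice \<Rightarrow> 'b \<Rightarrow> 'b) \<Rightarrow> ('a \<Rightarrow> 'b) \<Rightarrow> ('a \<Rightarrow> 'b) \<Rightarrow> 'a \<Rightarrow> 'b"
  where "conv m \<phi> \<psi> a = (if a \<in> carrier H then terms_Sup (\<lambda>x y. m (\<phi> x) (\<psi> y)) (\<Delta> a) else bot)"

text \<open>
  For the unit \<open>b\<close> of the quantale of values this is the unit of convolution;
  for functionals \<open>b\<close> it adds a variable in front.
\<close>

definition const_functional :: "'b::complete_lattice \<Rightarrow> 'a \<Rightarrow> 'b"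
  where "const_functional b a = (if a \<in> carrier H \<and> \<epsilon> a then b else bot)"

lemma conv_eq: "a \<in> carrier H \<Longrightarrow> conv m \<phi> \<psi> a = terms_Sup (\<lambda>x y. m (\<phi> x) (\<psi> y)) (\<Delta> a)"
  by (simp add: conv_def)

lemma conv_closed:
  assumes B: "quantale B m e" and \<phi>: "\<phi> \<in> functionals H B" and \<psi>: "\<psi> \<in> functionals H B"
  shows "conv m \<phi> \<psi> \<in> functionals H B"
proof (rule functionalsI)
  interpret quantale B m e by fact
  show "conv m \<phi> \<psi> a \<in> B" if a: "a \<in> carrier H" for a
    unfolding conv_eq[OF a]
    by (rule quantale_terms_Sup(1)[OF B])
      (use comult_terms[OF _ a] functionals_closed[OF \<phi>] functionals_closed[OF \<psi>] mult_closed in blast)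
  show "conv m \<phi> \<psi> a = bot" if "a \<notin> carrier H" for a using that by (simp add: conv_def)
  show "conv m \<phi> \<psi> (\<Squnion> X) = Sup (conv m \<phi> \<psi> ` X)" if X: "X \<subseteq> carrier H" for X
  proof -
    have "conv m \<phi> \<psi> (\<Squnion> X) = (SUP a\<in>X. terms_Sup (\<lambda>x y. m (\<phi> x) (\<psi> y)) (\<Delta> a))"
      using comult_Sup_terms[OF sup_bilinear_mult[OF B \<phi> \<psi>] X] X by (simp add: conv_def)
    also have "\<dots> = Sup (conv m \<phi> \<psi> ` X)" using X by (intro SUP_cong) (auto simp: conv_eq)
    finally show ?thesis .
  qed
qed

lemma const_functional_closed:
  assumes B: "quantale B m e" and b: "b \<in> B"
  shows "const_functional b \<in> functionals H B"
proof (rule functionalsI)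
  interpret quantale B m e by fact
  show "const_functional b a \<in> B" for a using b bot_closed by (simp add: const_functional_def)
  show "const_functional b a = bot" if "a \<notin> carrier H" for a
    using that by (simp add: const_functional_def)
  show "const_functional b (\<Squnion> X) = Sup (const_functional b ` X)" if X: "X \<subseteq> carrier H" for X
  proof -
    have "const_functional b (\<Squnion> X) \<le> k \<longleftrightarrow> Sup (const_functional b ` X) \<le> k" for k
      using X counit_Sup[OF X] by (auto simp: const_functional_def Sup_le_iff)
    then show ?thesis by (blast intro: order_antisym)
  qed
qed

lemma conv_const_left:
  assumes B: "quantale B m e" and b: "b \<in> B" and \<phi>: "\<phi> \<in> functionals H B"
  shows "conv m (const_functional b) \<phi> = (\<lambda>a. m b (\<phi> a))"
proof
  fix a
  interpret quantale B m e by fact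
  show "conv m (const_functional b) \<phi> a = m b (\<phi> a)"
  proof (cases "a \<in> carrier H")
    case True
    have \<phi>c: "\<phi> y \<in> B" if "(x, y) \<in> \<Delta> a" for x y
      using comult_terms[OF that True] functionals_closed[OF \<phi>] by simp
    have "conv m (const_functional b) \<phi> a =
      terms_Sup (\<lambda>x y. m b (if \<epsilon> x then \<phi> y else bot)) (\<Delta> a)"
      unfolding conv_eq[OF True] const_functional_def
      by (rule terms_Sup_cong) (use comult_terms[OF _ True] \<phi>c b in \<open>auto simp: bot_mult mult_bot\<close>)
    also have "\<dots> = m b (terms_Sup (\<lambda>x y. if \<epsilon> x then \<phi> y else bot) (\<Delta> a))"
      by (rule quantale_terms_Sup(3)[OF B _ b, symmetric]) (simp add: \<phi>c bot_closed)
    finally show ?thesis using counit_terms(1)[OF \<phi> True] by simp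
  qed (use b functionals_outside[OF \<phi>] in \<open>simp add: conv_def mult_bot\<close>)
qed

lemma conv_const_right:
  assumes B: "quantale B m e" and b: "b \<in> B" and \<phi>: "\<phi> \<in> functionals H B"
  shows "conv m \<phi> (const_functional b) = (\<lambda>a. m (\<phi> a) b)"
proof
  fix a
  interpret quantale B m e by fact
  show "conv m \<phi> (const_functional b) a = m (\<phi> a) b"
  proof (cases "a \<in> carrier H")
    case True
    have \<phi>c: "\<phi> x \<in> B" if "(x, y) \<in> \<Delta> a" for x y
      using comult_terms[OF that True] functionals_closed[OF \<phi>] by simp
    have "conv m \<phi> (const_functional b) a =
      terms_Sup (\<lambda>x y. m (if \<epsilon> y then \<phi> x else bot) b) (\<Delta> a)"
      unfolding conv_eq[OF True] const_functional_def
      by (rule terms_Sup_cong) (use comult_terms[OF _ True] \<phi>c b in \<open>auto simp: bot_mult mult_bot\<close>)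
    also have "\<dots> = m (terms_Sup (\<lambda>x y. if \<epsilon> y then \<phi> x else bot) (\<Delta> a)) b"
      by (rule quantale_terms_Sup(2)[OF B _ b, symmetric]) (simp add: \<phi>c bot_closed)
    finally show ?thesis using counit_terms(2)[OF \<phi> True] by simp
  qed (use b functionals_outside[OF \<phi>] in \<open>simp add: conv_def bot_mult\<close>)
qed

lemma conv_assoc:
  assumes B: "quantale B m e"
    and \<phi>: "\<phi> \<in> functionals H B" and \<psi>: "\<psi> \<in> functionals H B" and \<chi>: "\<chi> \<in> functionals H B"
  shows "conv m (conv m \<phi> \<psi>) \<chi> = conv m \<phi> (conv m \<psi> \<chi>)"
proof
  fix a
  interpret quantale B m e by fact
  show "conv m (conv m \<phi> \<psi>) \<chi> a = conv m \<phi> (conv m \<psi> \<chi>) a"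
  proof (cases "a \<in> carrier H")
    case True
    let ?\<tau> = "\<lambda>x y z. m (m (\<phi> x) (\<psi> y)) (\<chi> z)"
    have c: "\<phi> x \<in> B" "\<psi> x \<in> B" "\<chi> x \<in> B" if "x \<in> carrier H" for x
      using functionals_closed[OF \<phi> that] functionals_closed[OF \<psi> that] functionals_closed[OF \<chi> that]
      by simp_all
    have dc: "\<phi> x \<in> B" "\<psi> x \<in> B" "\<chi> x \<in> B" "\<phi> y \<in> B" "\<psi> y \<in> B" "\<chi> y \<in> B"
      if "(x, y) \<in> \<Delta> t" "t \<in> carrier H" for x y t
      using comult_terms[OF that] c by auto
    have fl: "(\<lambda>x. m (\<theta> x) b) \<in> functionals H B"
      and fr: "(\<lambda>x. m b (\<theta> x)) \<in> functionals H B"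
      if \<theta>: "\<theta> \<in> functionals H B" and b: "b \<in> B" for \<theta> b
      using conv_closed[OF B \<theta> const_functional_closed[OF B b]]
        conv_closed[OF B const_functional_closed[OF B b] \<theta>]
        conv_const_left[OF B b \<theta>] conv_const_right[OF B b \<theta>] by simp_all
    have "conv m (conv m \<phi> \<psi>) \<chi> a = terms_Sup (\<lambda>t z. terms_Sup (\<lambda>x y. ?\<tau> x y z) (\<Delta> t)) (\<Delta> a)"
      unfolding conv_eq[OF True]
      by (rule terms_Sup_cong) (use comult_terms[OF _ True] dc in
          \<open>auto simp: conv_eq mult_closed c intro!: quantale_terms_Sup(2)[OF B]\<close>)
    also have "\<dots> = terms_Sup (\<lambda>x t. terms_Sup (\<lambda>y z. ?\<tau> x y z) (\<Delta> t)) (\<Delta> a)"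
    proof (rule coassoc_terms[OF _ _ True])
      show "sup_bilinear H H (\<lambda>x y. ?\<tau> x y z)" if "z \<in> carrier H" for z
      proof -
        have "sup_bilinear H H (\<lambda>x y. m (\<phi> x) (m (\<psi> y) (\<chi> z)))"
          by (rule sup_bilinear_mult[OF B \<phi> fl[OF \<psi> c(3)[OF that]]])
        then show ?thesis
          using that unfolding sup_bilinear_def by (simp add: assoc c subset_iff)
      qed
      show "sup_bilinear H H (?\<tau> x)" if "x \<in> carrier H" for x
        by (rule sup_bilinear_mult[OF B fr[OF \<psi> c(1)[OF that]] \<chi>])
    qed
    also have "\<dots> = conv m \<phi> (conv m \<psi> \<chi>) a"
      unfolding conv_eq[OF True]
      by (rule terms_Sup_cong) (use comult_terms[OF _ True] dc in
          \<open>auto simp: conv_eq mult_closed c assoc quantale_terms_Sup(3)[OF B] intro!: terms_Sup_cong\<close>)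
    finally show ?thesis .
  qed (simp add: conv_def)
qed

theorem quantale_functionals:
  assumes B: "quantale B m e"
  shows "quantale (functionals H B) (conv m) (const_functional e)"
proof
  interpret B: quantale B m e by fact
  show "Sup F \<in> functionals H B" if "F \<subseteq> functionals H B" for F
    by (rule functionals_Sup_closed[OF B that])
  show "conv m \<phi> \<psi> \<in> functionals H B" if "\<phi> \<in> functionals H B" "\<psi> \<in> functionals H B" for \<phi> \<psi>
    by (rule conv_closed[OF B that])
  show "const_functional e \<in> functionals H B" by (rule const_functional_closed[OF B B.one_closed])
  show "conv m (conv m \<phi> \<psi>) \<chi> = conv m \<phi> (conv m \<psi> \<chi>)"
    if "\<phi> \<in> functionals H B" "\<psi> \<in> functionals H B" "\<chi> \<in> functionals H B" for \<phi> \<psi> \<chi>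
    by (rule conv_assoc[OF B that])
  have unit: "m e (\<phi> a) = \<phi> a" "m (\<phi> a) e = \<phi> a" if "\<phi> \<in> functionals H B" for \<phi> a
    using functionals_closed[OF that, of a] functionals_outside[OF that, of a] B.bot_closed
    by (cases "a \<in> carrier H"; simp add: B.one_left B.one_right)+
  show "conv m (const_functional e) \<phi> = \<phi>" "conv m \<phi> (const_functional e) = \<phi>"
    if "\<phi> \<in> functionals H B" for \<phi>
    using conv_const_left[OF B B.one_closed that] conv_const_right[OF B B.one_closed that] unit[OF that]
    by simp_all
  show "conv m (Sup F) \<psi> = (SUP \<phi>\<in>F. conv m \<phi> \<psi>)"
    if F: "F \<subseteq> functionals H B" and \<psi>: "\<psi> \<in> functionals H B" for F \<psi>
  proof
    fix a
    show "conv m (Sup F) \<psi> a = (SUP \<phi>\<in>F. conv m \<phi> \<psi>) a"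
    proof (cases "a \<in> carrier H")
      case True
      have "m (Sup F x) (\<psi> y) = (SUP \<phi>\<in>F. m (\<phi> x) (\<psi> y))" if "(x, y) \<in> \<Delta> a" for x y
        using comult_terms[OF that True] F functionals_closed[OF \<psi>] B.Sup_mult[of "(\<lambda>\<phi>. \<phi> x) ` F" "\<psi> y"]
          functionals_closed[of _ H B x]
        by (simp add: image_image image_subset_iff in_mono)
      then have "conv m (Sup F) \<psi> a = terms_Sup (\<lambda>x y. SUP \<phi>\<in>F. m (\<phi> x) (\<psi> y)) (\<Delta> a)"
        unfolding conv_eq[OF True] by (rule terms_Sup_cong)
      also have "\<dots> = (SUP \<phi>\<in>F. terms_Sup (\<lambda>x y. m (\<phi> x) (\<psi> y)) (\<Delta> a))"
        unfolding terms_Sup_def by (simp add: case_prod_unfold SUP_commute[of _ F])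
      finally show ?thesis using True by (simp add: conv_eq image_image)
    qed (simp add: conv_def)
  qed
  show "conv m \<psi> (Sup F) = (SUP \<phi>\<in>F. conv m \<psi> \<phi>)"
    if F: "F \<subseteq> functionals H B" and \<psi>: "\<psi> \<in> functionals H B" for F \<psi>
  proof
    fix a
    show "conv m \<psi> (Sup F) a = (SUP \<phi>\<in>F. conv m \<psi> \<phi>) a"
    proof (cases "a \<in> carrier H")
      case True
      have "m (\<psi> x) (Sup F y) = (SUP \<phi>\<in>F. m (\<psi> x) (\<phi> y))" if "(x, y) \<in> \<Delta> a" for x y
        using comult_terms[OF that True] F functionals_closed[OF \<psi>] B.mult_Sup[of "(\<lambda>\<phi>. \<phi> y) ` F" "\<psi> x"]
          functionals_closed[of _ H B y]
        by (simp add: image_image image_subset_iff in_mono)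
      then have "conv m \<psi> (Sup F) a = terms_Sup (\<lambda>x y. SUP \<phi>\<in>F. m (\<psi> x) (\<phi> y)) (\<Delta> a)"
        unfolding conv_eq[OF True] by (rule terms_Sup_cong)
      also have "\<dots> = (SUP \<phi>\<in>F. terms_Sup (\<lambda>x y. m (\<psi> x) (\<phi> y)) (\<Delta> a))"
        unfolding terms_Sup_def by (simp add: case_prod_unfold SUP_commute[of _ F])
      finally show ?thesis using True by (simp add: conv_eq image_image)
    qed (simp add: conv_def)
  qed
qed

lemma quantale_hom_const:
  assumes B: "quantale B m e"
  shows "quantale_hom B m e (functionals H B) (conv m) (const_functional e) const_functional"
proof -
  interpret B: quantale B m e by fact
  interpret C: quantale "functionals H B" "conv m" "const_functional e"
    by (rule quantale_functionals[OF B])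
  show ?thesis
  proof
    show "const_functional b \<in> functionals H B" if "b \<in> B" for b
      by (rule const_functional_closed[OF B that])
    show "const_functional (Sup X) = Sup (const_functional ` X)" for X :: "'b set"
      by (rule ext) (auto simp: const_functional_def image_image)
    show "const_functional (m b c) = conv m (const_functional b) (const_functional c)"
      if "b \<in> B" "c \<in> B" for b c
      unfolding conv_const_left[OF B that(1) const_functional_closed[OF B that(2)]]
      using that by (auto simp: const_functional_def B.mult_bot)
  qed simp
qed

lemma quantale_hom_postcomp:
  assumes "quantale_hom B m e B' m' e' f"
  shows "quantale_hom (functionals H B) (conv m) (const_functional e)
    (functionals H B') (conv m') (const_functional e') (\<lambda>\<phi> a. f (\<phi> a))"
proof -
  interpret f: quantale_hom B m e B' m' e' f by fact
  interpret C: quantale "functionals H B" "conv m" "const_functional e"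
    by (rule quantale_functionals[OF f.Q.quantale_axioms])
  interpret C': quantale "functionals H B'" "conv m'" "const_functional e'"
    by (rule quantale_functionals[OF f.Q'.quantale_axioms])
  show ?thesis
  proof
    show "(\<lambda>a. f (\<phi> a)) \<in> functionals H B'" if \<phi>: "\<phi> \<in> functionals H B" for \<phi>
    proof (rule functionalsI)
      show "f (\<phi> (\<Squnion> X)) = Sup ((\<lambda>a. f (\<phi> a)) ` X)" if "X \<subseteq> carrier H" for X
        using f.Sup[of "\<phi> ` X"] functionals_Sup[OF \<phi> that] functionals_closed[OF \<phi>] that
        by (simp add: image_image image_subset_iff in_mono)
    qed (simp_all add: functionals_closed[OF \<phi>] functionals_outside[OF \<phi>] f.closed f.bot)
    show "(\<lambda>a. f (Sup F a)) = (SUP \<phi>\<in>F. (\<lambda>a. f (\<phi> a)))" if F: "F \<subseteq> functionals H B" for F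
    proof
      fix a
      have "\<phi> a \<in> B" if "\<phi> \<in> F" for \<phi>
        using subsetD[OF F that] functionals_closed[of \<phi> H B a] functionals_outside[of \<phi> H B a]
          f.Q.bot_closed by (cases "a \<in> carrier H") simp_all
      then have "(\<lambda>\<phi>. \<phi> a) ` F \<subseteq> B" by auto
      then show "f (Sup F a) = (SUP \<phi>\<in>F. (\<lambda>a. f (\<phi> a))) a"
        using f.Sup[of "(\<lambda>\<phi>. \<phi> a) ` F"] by (simp add: image_image)
    qed
    show "(\<lambda>a. f (conv m \<phi> \<psi> a)) = conv m' (\<lambda>a. f (\<phi> a)) (\<lambda>a. f (\<psi> a))"
      if \<phi>: "\<phi> \<in> functionals H B" and \<psi>: "\<psi> \<in> functionals H B" for \<phi> \<psi>
    proof
      fix a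
      show "f (conv m \<phi> \<psi> a) = conv m' (\<lambda>a. f (\<phi> a)) (\<lambda>a. f (\<psi> a)) a"
      proof (cases "a \<in> carrier H")
        case True
        have c: "\<phi> x \<in> B \<and> \<psi> y \<in> B" if "(x, y) \<in> \<Delta> a" for x y
          using comult_terms[OF that True] functionals_closed[OF \<phi>] functionals_closed[OF \<psi>] by simp
        show ?thesis
          unfolding conv_eq[OF True]
          by (subst f.terms_Sup) (auto simp: c f.mult f.Q.mult_closed intro!: terms_Sup_cong)
      qed (simp add: conv_def f.bot)
    qed
    show "(\<lambda>a. f (const_functional e a)) = const_functional e'"
      by (auto simp: const_functional_def f.one f.bot)
  qed
qed

definition mult_pullback :: "('a \<Rightarrow> 'b::complete_lattice) \<Rightarrow> 'a \<Rightarrow> 'a \<Rightarrow> 'b"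
  where "mult_pullback \<phi> a b = (if a \<in> carrier H \<and> b \<in> carrier H then \<phi> (a \<cdot> b) else bot)"

text \<open>
  Dual to the comultiplication being multiplicative.
\<close>

lemma quantale_hom_mult_pullback:
  assumes B: "quantale B m e"
  shows "quantale_hom (functionals H B) (conv m) (const_functional e)
    (functionals H (functionals H B)) (conv (conv m)) (const_functional (const_functional e))
    mult_pullback"
proof -
  interpret C: quantale "functionals H B" "conv m" "const_functional e"
    by (rule quantale_functionals[OF B])
  interpret C': quantale "functionals H (functionals H B)" "conv (conv m)"
    "const_functional (const_functional e)"
    by (rule quantale_functionals[OF C.quantale_axioms])
  interpret B: quantale B m e by (rule B)
  have Sup_image: "\<phi> (\<Squnion> (h ` X)) = (SUP x\<in>X. \<phi> (h x))"
    if "\<phi> \<in> functionals H B" "\<And>x. x \<in> X \<Longrightarrow> h x \<in> carrier H" for \<phi> h and X :: "'a set"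
    using functionals_Sup[OF that(1), of "h ` X"] that(2) by (simp add: image_image image_subset_iff)
  show ?thesis
  proof
    show "mult_pullback \<phi> \<in> functionals H (functionals H B)" if \<phi>: "\<phi> \<in> functionals H B" for \<phi>
    proof (rule functionalsI)
      show "mult_pullback \<phi> a \<in> functionals H B" if a: "a \<in> carrier H" for a
      proof (rule functionalsI)
        show "mult_pullback \<phi> a (\<Squnion> X) = Sup (mult_pullback \<phi> a ` X)" if X: "X \<subseteq> carrier H" for X
        proof -
          have "mult_pullback \<phi> a (\<Squnion> X) = (SUP b\<in>X. \<phi> (a \<cdot> b))"
            using X a Sup_image[OF \<phi>, of X "\<lambda>b. a \<cdot> b"]
            by (simp add: mult_pullback_def hprod_Sup in_mono hprod_closed)
          also have "\<dots> = Sup (mult_pullback \<phi> a ` X)"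
            using X a by (intro SUP_cong) (auto simp: mult_pullback_def)
          finally show ?thesis .
        qed
      qed (use a in \<open>auto simp: mult_pullback_def intro!: functionals_closed[OF \<phi>] hprod_closed\<close>)
      show "mult_pullback \<phi> a = bot" if "a \<notin> carrier H" for a
        using that by (auto simp: mult_pullback_def)
      show "mult_pullback \<phi> (\<Squnion> X) = Sup (mult_pullback \<phi> ` X)" if X: "X \<subseteq> carrier H" for X
      proof
        fix b
        show "mult_pullback \<phi> (\<Squnion> X) b = Sup (mult_pullback \<phi> ` X) b"
        proof (cases "b \<in> carrier H")
          case True
          have "mult_pullback \<phi> (\<Squnion> X) b = (SUP a\<in>X. \<phi> (a \<cdot> b))"
            using X True Sup_image[OF \<phi>, of X "\<lambda>a. a \<cdot> b"]
            by (simp add: mult_pullback_def hprod_Sup in_mono hprod_closed)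
          also have "\<dots> = (SUP a\<in>X. mult_pullback \<phi> a b)"
            using X True by (intro SUP_cong) (auto simp: mult_pullback_def)
          finally show ?thesis by (simp add: image_image)
        qed (simp add: mult_pullback_def)
      qed
    qed
    show "mult_pullback (Sup F) = (SUP \<phi>\<in>F. mult_pullback \<phi>)" for F :: "('a \<Rightarrow> 'b) set"
      by (intro ext) (auto simp: mult_pullback_def image_image)
    show "mult_pullback (conv m \<phi> \<psi>) = conv (conv m) (mult_pullback \<phi>) (mult_pullback \<psi>)"
      if \<phi>: "\<phi> \<in> functionals H B" and \<psi>: "\<psi> \<in> functionals H B" for \<phi> \<psi>
    proof (intro ext)
      fix a b
      show "mult_pullback (conv m \<phi> \<psi>) a b = conv (conv m) (mult_pullback \<phi>) (mult_pullback \<psi>) a b"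
      proof (cases "a \<in> carrier H \<and> b \<in> carrier H")
        case True
        then have a: "a \<in> carrier H" and b: "b \<in> carrier H" by auto
        have "mult_pullback (conv m \<phi> \<psi>) a b =
          terms_Sup (\<lambda>x y. m (\<phi> x) (\<psi> y)) (tensor_prod H (\<Delta> a) (\<Delta> b))"
          using a b by (simp add: mult_pullback_def conv_def hprod_closed comult_mult)
        also have "\<dots> = terms_Sup (\<lambda>x y. terms_Sup (\<lambda>x' y'. m (\<phi> (x \<cdot> x')) (\<psi> (y \<cdot> y'))) (\<Delta> b)) (\<Delta> a)"
          by (rule tensor_prod_terms[OF sup_bilinear_mult[OF B \<phi> \<psi>] comult_closed[OF a] comult_closed[OF b]])
        also have "\<dots> = terms_Sup (\<lambda>x y. conv m (mult_pullback \<phi> x) (mult_pullback \<psi> y) b) (\<Delta> a)"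
          unfolding conv_eq[OF b] using comult_terms[OF _ a] comult_terms[OF _ b]
          by (intro terms_Sup_cong) (auto simp: mult_pullback_def)
        finally show ?thesis by (simp add: conv_eq[OF a] terms_Sup_apply)
      next
        case False
        then show ?thesis
          by (cases "a \<in> carrier H")
            (auto simp: mult_pullback_def conv_def terms_Sup_apply terms_Sup_def bot_unique Sup_bot_conv)
      qed
    qed
    show "mult_pullback (const_functional e) = const_functional (const_functional e)"
      by (intro ext) (auto simp: mult_pullback_def const_functional_def hprod_closed counit_mult)
  qed
qed

text \<open>
  Dual to the unit of \<open>H\<close> being grouplike.
\<close>

lemma quantale_hom_eval_unit:
  assumes B: "quantale B m e"
  shows "quantale_hom (functionals H B) (conv m) (const_functional e) B m e (\<lambda>\<phi>. \<phi> (hunit H))"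
proof -
  interpret B: quantale B m e by (rule B)
  interpret C: quantale "functionals H B" "conv m" "const_functional e"
    by (rule quantale_functionals[OF B])
  show ?thesis
  proof
    show "conv m \<phi> \<psi> (hunit H) = m (\<phi> (hunit H)) (\<psi> (hunit H))"
      if \<phi>: "\<phi> \<in> functionals H B" and \<psi>: "\<psi> \<in> functionals H B" for \<phi> \<psi>
      using terms_Sup_pure[OF lattice lattice sup_bilinear_mult[OF B \<phi> \<psi>] unit_closed unit_closed]
      by (simp add: conv_eq unit_closed comult_unit hpair_def)
  qed (auto simp: unit_closed functionals_closed const_functional_def counit_unit image_image)
qed


section \<open>The quotient by the counit kernel\<close>

text \<open>
  These functionals turn the counit axiom into a test for \<open>a \<le> k\<close> on the terms of \<open>\<Delta>(a)\<close>.
\<close>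

lemma not_le_functional:
  assumes "k \<in> carrier H"
  shows "(\<lambda>a. a \<in> carrier H \<and> \<not> a \<sqsubseteq> k) \<in> functionals H UNIV"
  unfolding functionals_bool_iff sup_mor_unit_lat_iff
  using complete_lattice_sup_le_iff[OF lattice _ assms] by auto

lemma counit_functional: "(\<lambda>a. a \<in> carrier H \<and> \<epsilon> a) \<in> functionals H UNIV"
  using counit_Sup unfolding functionals_bool_iff sup_mor_unit_lat_iff by auto

lemma counit_right_le_iff:
  assumes "a \<in> carrier H" "k \<in> carrier H"
  shows "a \<sqsubseteq> k \<longleftrightarrow> (\<forall>(x, y)\<in>\<Delta> a. \<epsilon> y \<longrightarrow> x \<sqsubseteq> k)"
  using counit_terms(2)[OF not_le_functional[OF assms(2)] assms(1)] assms comult_terms[OF _ assms(1)]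
  unfolding terms_Sup_bool by (fastforce split: if_splits)

lemma counit_left_le_iff:
  assumes "a \<in> carrier H" "k \<in> carrier H"
  shows "a \<sqsubseteq> k \<longleftrightarrow> (\<forall>(x, y)\<in>\<Delta> a. \<epsilon> x \<longrightarrow> y \<sqsubseteq> k)"
  using counit_terms(1)[OF not_le_functional[OF assms(2)] assms(1)] assms comult_terms[OF _ assms(1)]
  unfolding terms_Sup_bool by (fastforce split: if_splits)

lemma counit_terms_iff:
  assumes "a \<in> carrier H"
  shows "\<epsilon> a \<longleftrightarrow> (\<exists>(x, y)\<in>\<Delta> a. \<epsilon> x \<and> \<epsilon> y)"
  using counit_terms(1)[OF counit_functional assms] assms comult_terms[OF _ assms]
  unfolding terms_Sup_bool by (auto split: if_splits)

lemma hmult_le_iff: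
  assumes t: "bi_ideal H H t" and k: "k \<in> carrier H"
  shows "hmult H t \<sqsubseteq> k \<longleftrightarrow> (\<forall>(x, y)\<in>t. x \<cdot> y \<sqsubseteq> k)"
proof -
  have "hmult H t = ext H (\<lambda>x y. x \<cdot> y) t"
    by (rule ext_unique[OF lattice lattice lattice hprod_bimor mult_mor])
      (use t in \<open>simp_all add: hprod_def hpair_def tensor_simps\<close>)
  then show ?thesis
    using ext_le_iff'[OF lattice k, of t "\<lambda>x y. x \<cdot> y"] bi_ideal_carrier[OF t] by (simp add: hprod_closed)
qed

lemma antipode_closed: "a \<in> carrier H \<Longrightarrow> hantipode H a \<in> carrier H"
  using sup_mor_closed[OF antipode_mor] .

lemma antipode_le_iff:
  assumes a: "a \<in> carrier H" and k: "k \<in> carrier H"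
  shows "scale H (\<epsilon> a) (hunit H) \<sqsubseteq> k \<longleftrightarrow> (\<forall>(x, y)\<in>\<Delta> a. x \<cdot> hantipode H y \<sqsubseteq> k)"
    and "scale H (\<epsilon> a) (hunit H) \<sqsubseteq> k \<longleftrightarrow> (\<forall>(x, y)\<in>\<Delta> a. hantipode H x \<cdot> y \<sqsubseteq> k)"
proof -
  let ?J = "{(x, y) \<in> carrier H \<times> carrier H. x \<cdot> y \<sqsubseteq> k}"
  have J: "bi_ideal H H ?J" by (rule bi_ideal_le[OF lattice lattice lattice hprod_bimor k])
  have S: "hantipode H \<in> carrier H \<rightarrow> carrier H" and id: "id \<in> carrier H \<rightarrow> carrier H"
    using antipode_closed by auto
  have sub: "hmult H t \<sqsubseteq> k \<longleftrightarrow> t \<subseteq> ?J" if "bi_ideal H H t" for t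
    using hmult_le_iff[OF that k] bi_ideal_carrier[OF that] by auto
  show "scale H (\<epsilon> a) (hunit H) \<sqsubseteq> k \<longleftrightarrow> (\<forall>(x, y)\<in>\<Delta> a. x \<cdot> hantipode H y \<sqsubseteq> k)"
    unfolding antipode_right[OF a, symmetric]
      sub[OF tensor_map_closed[OF lattice lattice id S comult_closed[OF a]]]
      tensor_map_subset_iff[OF lattice lattice id S comult_closed[OF a] J]
    using comult_terms[OF _ a] by (intro ball_pairs) (simp add: antipode_closed)
  show "scale H (\<epsilon> a) (hunit H) \<sqsubseteq> k \<longleftrightarrow> (\<forall>(x, y)\<in>\<Delta> a. hantipode H x \<cdot> y \<sqsubseteq> k)"
    unfolding antipode_left[OF a, symmetric]
      sub[OF tensor_map_closed[OF lattice lattice S id comult_closed[OF a]]]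
      tensor_map_subset_iff[OF lattice lattice S id comult_closed[OF a] J]
    using comult_terms[OF _ a] by (intro ball_pairs) (simp add: antipode_closed)
qed

lemma mult_terms:
  assumes a: "a \<in> carrier H" and b: "b \<in> carrier H"
    and x: "(x, y) \<in> \<Delta> a" and x': "(x', y') \<in> \<Delta> b"
  shows "(x \<cdot> x', y \<cdot> y') \<in> \<Delta> (a \<cdot> b)"
proof -
  let ?P = "\<lambda>u v. (u, v) \<notin> \<Delta> (a \<cdot> b)"
  have D: "bi_ideal H H (\<Delta> (a \<cdot> b))" by (rule comult_closed[OF hprod_closed[OF a b]])
  then have P: "sup_bilinear H H ?P" unfolding bi_ideal_def sup_bilinear_def by auto
  have "\<not> terms_Sup ?P (\<Delta> (a \<cdot> b))"
    unfolding terms_Sup_bool by auto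
  then have "\<not> terms_Sup (\<lambda>u v. terms_Sup (\<lambda>u' v'. ?P (u \<cdot> u') (v \<cdot> v')) (\<Delta> b)) (\<Delta> a)"
    using tensor_prod_terms[OF P comult_closed[OF a] comult_closed[OF b]] comult_mult[OF a b] by simp
  then show ?thesis unfolding terms_Sup_bool using x x' by blast
qed

abbreviation ker :: 'a  (\<open>\<D>\<close>) where "ker \<equiv> counit_kernel_top H"

abbreviation quotient :: "'a set hopf"  (\<open>\<Q>\<close>) where "quotient \<equiv> remnant_hopf H"

abbreviation quotient_le (infix \<open>\<sqsubseteq>\<^sub>Q\<close> 50) where "quotient_le \<equiv> gorder.le \<Q>"
abbreviation quotient_bottom (\<open>\<bottom>\<^sub>Q\<close>) where "quotient_bottom \<equiv> bottom \<Q>"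
abbreviation quotient_Sup (\<open>\<Squnion>\<^sub>Q_\<close> [90] 90) where "quotient_Sup \<equiv> Lattice.sup \<Q>"
abbreviation quotient_mult (infixl \<open>\<cdot>\<^sub>Q\<close> 70) where "quotient_mult \<equiv> hprod \<Q>"
abbreviation quotient_coproduct (\<open>\<Delta>\<^sub>Q\<close>) where "quotient_coproduct \<equiv> hcomult \<Q>"

abbreviation proj :: "'a \<Rightarrow> 'a set"  (\<open>\<pi>\<close>) where "proj \<equiv> remnant_proj H"

abbreviation incl :: "'a set \<Rightarrow> 'a"  (\<open>\<iota>\<close>) where "incl \<equiv> remnant_incl H"

lemma kernel_closed: "\<D> \<in> carrier H"
  unfolding counit_kernel_top_def by (rule sup_closed) auto

lemma counit_kernel: "\<not> \<epsilon> \<D>"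
  unfolding counit_kernel_top_def by (subst counit_Sup) auto

lemma counit_mono: "a \<sqsubseteq> b \<Longrightarrow> a \<in> carrier H \<Longrightarrow> b \<in> carrier H \<Longrightarrow> \<epsilon> a \<Longrightarrow> \<epsilon> b"
  using sup_mor_mono[OF lattice unit_lat_complete_lattice counit_mor, of a b]
  by (simp add: unit_lat_def)

lemma counit_iff: "a \<in> carrier H \<Longrightarrow> \<epsilon> a \<longleftrightarrow> \<not> a \<sqsubseteq> \<D>"
  using counit_mono[of a \<D>] counit_kernel kernel_closed sup_upper[of "{h \<in> carrier H. \<not> \<epsilon> h}" a]
  unfolding counit_kernel_top_def by auto

lemma join_kernel_closed: "a \<in> carrier H \<Longrightarrow> a \<squnion> \<D> \<in> carrier H"
  unfolding join_def by (rule sup_closed) (use kernel_closed in auto)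

lemma join_kernel_le_iff:
  "a \<in> carrier H \<Longrightarrow> k \<in> carrier H \<Longrightarrow> a \<squnion> \<D> \<sqsubseteq> k \<longleftrightarrow> a \<sqsubseteq> k \<and> \<D> \<sqsubseteq> k"
  unfolding join_def using complete_lattice_sup_le_iff[OF lattice, of "{a, \<D>}" k] kernel_closed by simp

lemma kernel_le_join: "a \<in> carrier H \<Longrightarrow> \<D> \<sqsubseteq> a \<squnion> \<D>" "a \<in> carrier H \<Longrightarrow> a \<sqsubseteq> a \<squnion> \<D>"
  using join_kernel_le_iff[of a "a \<squnion> \<D>"] join_kernel_closed[of a] le_refl by auto

lemma join_kernel_absorb: "a \<in> carrier H \<Longrightarrow> \<D> \<sqsubseteq> a \<Longrightarrow> a \<squnion> \<D> = a"
  using join_kernel_le_iff[of a a] kernel_le_join[of a] join_kernel_closed[of a] le_antisym le_refl by auto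

lemma proj_def': "a \<in> carrier H \<Longrightarrow> \<pi> a = {b \<in> carrier H. a \<squnion> \<D> = b \<squnion> \<D>}"
  by (auto simp: remnant_proj_def remnant_rel_def)

lemma incl_proj: "a \<in> carrier H \<Longrightarrow> \<iota> (\<pi> a) = a \<squnion> \<D>"
  unfolding remnant_incl_def by (rule the_equality) (auto simp: proj_def')

lemma quotient_simps: "carrier \<Q> = \<pi> ` carrier H" "eq \<Q> = (=)" "p \<sqsubseteq>\<^sub>Q q \<longleftrightarrow> \<iota> p \<sqsubseteq> \<iota> q"
  by (auto simp: remnant_hopf_def remnant_lattice_def Let_def quotient_def remnant_proj_def)

lemma proj_closed: "a \<in> carrier H \<Longrightarrow> \<pi> a \<in> carrier \<Q>"
  by (simp add: quotient_simps)

lemma incl_closed: "q \<in> carrier \<Q> \<Longrightarrow> \<iota> q \<in> carrier H"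
  by (auto simp: quotient_simps incl_proj join_kernel_closed)

lemma kernel_le_incl: "q \<in> carrier \<Q> \<Longrightarrow> \<D> \<sqsubseteq> \<iota> q"
  by (auto simp: quotient_simps incl_proj kernel_le_join)

lemma proj_incl: "q \<in> carrier \<Q> \<Longrightarrow> \<pi> (\<iota> q) = q"
proof -
  assume "q \<in> carrier \<Q>"
  then obtain a where a: "a \<in> carrier H" "q = \<pi> a" by (auto simp: quotient_simps)
  then have "(a \<squnion> \<D>) \<squnion> \<D> = a \<squnion> \<D>"
    by (intro join_kernel_absorb join_kernel_closed kernel_le_join)
  then have "\<pi> (a \<squnion> \<D>) = \<pi> a" using a by (simp add: join_kernel_closed proj_def')
  then show ?thesis using a by (simp add: incl_proj)
qed

lemma proj_le_iff: "a \<in> carrier H \<Longrightarrow> q \<in> carrier \<Q> \<Longrightarrow> \<pi> a \<sqsubseteq>\<^sub>Q q \<longleftrightarrow> a \<sqsubseteq> \<iota> q"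
  by (simp add: quotient_simps(3) incl_proj join_kernel_le_iff incl_closed kernel_le_incl)

lemma quotient_partial_order: "partial_order \<Q>"
proof
  have anti: "p = q" if "p \<sqsubseteq>\<^sub>Q q" "q \<sqsubseteq>\<^sub>Q p" "p \<in> carrier \<Q>" "q \<in> carrier \<Q>" for p q
    using that proj_incl le_antisym[of "\<iota> p" "\<iota> q"] incl_closed
    unfolding quotient_simps(3) by metis
  show "p .=\<^bsub>\<Q>\<^esub> q" if "p \<sqsubseteq>\<^sub>Q q" "q \<sqsubseteq>\<^sub>Q p" "p \<in> carrier \<Q>" "q \<in> carrier \<Q>" for p q
    using anti[OF that] by (simp add: quotient_simps)
  show "p \<sqsubseteq>\<^sub>Q s" if "p \<sqsubseteq>\<^sub>Q q" "q \<sqsubseteq>\<^sub>Q s" "p \<in> carrier \<Q>" "q \<in> carrier \<Q>" "s \<in> carrier \<Q>" for p q s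
    using that le_trans[of "\<iota> p" "\<iota> q" "\<iota> s"] incl_closed unfolding quotient_simps(3) by blast
qed (auto simp: quotient_simps(2,3) incl_closed le_refl)

lemma quotient_lattice: "complete_lattice \<Q>"
proof -
  interpret P: partial_order \<Q> by (rule quotient_partial_order)
  show ?thesis
  proof
    fix A assume A: "A \<subseteq> carrier \<Q>"
    then have iA: "\<iota> ` A \<subseteq> carrier H" by (auto simp: incl_closed)
    show "\<exists>s. least \<Q> s (Upper \<Q> A)"
    proof (intro exI)
      have c: "\<Squnion> (\<iota> ` A) \<in> carrier H" using iA by simp
      have le: "\<pi> (\<Squnion> (\<iota> ` A)) \<sqsubseteq>\<^sub>Q k \<longleftrightarrow> (\<forall>a\<in>A. a \<sqsubseteq>\<^sub>Q k)" if "k \<in> carrier \<Q>" for k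
        unfolding proj_le_iff[OF c that] complete_lattice_sup_le_iff[OF lattice iA incl_closed[OF that]]
        by (simp add: quotient_simps(3))
      show "least \<Q> (\<pi> (\<Squnion> (\<iota> ` A))) (Upper \<Q> A)"
        using A proj_closed[OF c] P.le_refl[OF proj_closed[OF c]] le le[OF proj_closed[OF c]] by (auto simp: least_def Upper_def)
    qed
    show "\<exists>i. greatest \<Q> i (Lower \<Q> A)"
    proof (intro exI)
      have c: "\<Sqinter> (\<iota> ` A) \<in> carrier H" using iA by simp
      have D: "\<D> \<sqsubseteq> \<Sqinter> (\<iota> ` A)"
        by (rule inf_greatest[OF iA kernel_closed]) (use A kernel_le_incl in auto)
      have lower: "\<pi> (\<Sqinter> (\<iota> ` A)) \<sqsubseteq>\<^sub>Q a" if "a \<in> A" for a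
        unfolding quotient_simps(3) incl_proj[OF c] join_kernel_absorb[OF c D]
        by (rule inf_lower[OF iA]) (use that in simp)
      have greatest: "k \<sqsubseteq>\<^sub>Q \<pi> (\<Sqinter> (\<iota> ` A))" if "k \<in> carrier \<Q>" "\<forall>a\<in>A. k \<sqsubseteq>\<^sub>Q a" for k
        unfolding quotient_simps(3) incl_proj[OF c] join_kernel_absorb[OF c D]
        by (rule inf_greatest[OF iA incl_closed[OF that(1)]]) (use that(2) in \<open>auto simp: quotient_simps(3)\<close>)
      show "greatest \<Q> (\<pi> (\<Sqinter> (\<iota> ` A))) (Lower \<Q> A)"
        using A proj_closed[OF c] lower by (auto simp: greatest_def Lower_def intro!: greatest)
    qed
  qed
qed

sublocale quotient: complete_lattice "\<Q>"
  by (rule quotient_lattice)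

lemma proj_mor: "\<pi> \<in> sup_mor H \<Q>"
proof (rule sup_morI[OF quotient_lattice lattice])
  show "\<pi> (\<Squnion> A) \<sqsubseteq>\<^sub>Q k \<longleftrightarrow> (\<forall>a\<in>A. \<pi> a \<sqsubseteq>\<^sub>Q k)" if "A \<subseteq> carrier H" "k \<in> carrier \<Q>" for A k
    using that complete_lattice_sup_le_iff[OF lattice that(1) incl_closed[OF that(2)]]
    by (auto simp: proj_le_iff subset_iff)
qed (rule proj_closed)

lemma proj_mono: "a \<sqsubseteq> b \<Longrightarrow> a \<in> carrier H \<Longrightarrow> b \<in> carrier H \<Longrightarrow> \<pi> a \<sqsubseteq>\<^sub>Q \<pi> b"
  using sup_mor_mono[OF lattice quotient_lattice proj_mor] by blast

lemma quotient_le_bottom_iff: "p \<in> carrier \<Q> \<Longrightarrow> p \<sqsubseteq>\<^sub>Q \<bottom>\<^sub>Q \<longleftrightarrow> p = \<bottom>\<^sub>Q"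
  using quotient.le_antisym quotient.bottom_lower quotient.bottom_closed quotient.le_refl by metis

lemma incl_bottom: "\<iota> \<bottom>\<^sub>Q = \<D>"
proof -
  have "\<iota> (\<pi> \<D>) = \<D>" using kernel_closed le_refl by (simp add: incl_proj join_kernel_absorb)
  moreover have "\<pi> \<D> = \<bottom>\<^sub>Q"
    using proj_le_iff[OF kernel_closed quotient.bottom_closed] kernel_le_incl[OF quotient.bottom_closed]
      quotient_le_bottom_iff[OF proj_closed[OF kernel_closed]] by simp
  ultimately show ?thesis by simp
qed

lemma proj_eq_bottom_iff: "a \<in> carrier H \<Longrightarrow> \<pi> a = \<bottom>\<^sub>Q \<longleftrightarrow> \<not> \<epsilon> a"
  using proj_le_iff[of a "\<bottom>\<^sub>Q"] quotient_le_bottom_iff[of "\<pi> a"] proj_closed[of a]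
  by (simp add: incl_bottom counit_iff)

text \<open>
  The quotient is universal among join-preserving maps that annihilate the kernel; the maps induced
  on the quotient are obtained by composing with the section \<open>\<iota>\<close>.
\<close>

lemma descend:
  assumes K: "complete_lattice K" and f: "f \<in> sup_mor H K" and D: "f \<D> = \<bottom>\<^bsub>K\<^esub>"
  shows "a \<in> carrier H \<Longrightarrow> f (\<iota> (\<pi> a)) = f a" "(\<lambda>q. f (\<iota> q)) \<in> sup_mor \<Q> K"
proof -
  interpret K: complete_lattice K by (rule K)
  have *: "f (\<iota> (\<pi> a)) = f a" if a: "a \<in> carrier H" for a
  proof (rule complete_lattice_eqI[OF K])
    show "f (\<iota> (\<pi> a)) \<sqsubseteq>\<^bsub>K\<^esub> k \<longleftrightarrow> f a \<sqsubseteq>\<^bsub>K\<^esub> k" if k: "k \<in> carrier K" for k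
      using sup_mor_le_iff[OF K f, of "{a, \<D>}" k] a k kernel_closed K.bottom_lower[OF k]
      by (simp add: incl_proj join_def D)
  qed (use a in \<open>auto intro!: sup_mor_closed[OF f] incl_closed proj_closed\<close>)
  show "f (\<iota> (\<pi> a)) = f a" if "a \<in> carrier H" using *[OF that] .
  show "(\<lambda>q. f (\<iota> q)) \<in> sup_mor \<Q> K"
  proof (rule sup_morI[OF K quotient_lattice])
    show "f (\<iota> (\<Squnion>\<^sub>Q A)) \<sqsubseteq>\<^bsub>K\<^esub> k \<longleftrightarrow> (\<forall>a\<in>A. f (\<iota> a) \<sqsubseteq>\<^bsub>K\<^esub> k)"
      if A: "A \<subseteq> carrier \<Q>" and k: "k \<in> carrier K" for A k
    proof -
      have iA: "\<iota> ` A \<subseteq> carrier H" using A incl_closed by auto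
      have "\<pi> ` \<iota> ` A = A" using A by (force simp: image_image proj_incl in_mono)
      then have "\<Squnion>\<^sub>Q A = \<pi> (\<Squnion> (\<iota> ` A))" using proj_mor iA unfolding sup_mor_def by force
      then have "f (\<iota> (\<Squnion>\<^sub>Q A)) = f (\<Squnion> (\<iota> ` A))" using *[of "\<Squnion> (\<iota> ` A)"] iA by simp
      then show ?thesis using sup_mor_le_iff[OF K f iA k] by simp
    qed
  qed (use sup_mor_closed[OF f] incl_closed in blast)
qed


section \<open>The operations of the quotient\<close>

text \<open>
  Joins and tensor products depend only on the carrier and the order, which the two records share.
\<close>

lemma remnant_lattice_eqs:
  "Lattice.sup (remnant_lattice H) = Lattice.sup \<Q>" "carrier (remnant_lattice H) = carrier \<Q>"
  "bi_ideal (remnant_lattice H) (remnant_lattice H) = bi_ideal \<Q> \<Q>"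
  "pure (remnant_lattice H) (remnant_lattice H) = pure \<Q> \<Q>"
  "tensor (remnant_lattice H) (remnant_lattice H) = tensor \<Q> \<Q>"
  "ext (remnant_lattice H) = ext \<Q>"
proof -
  show 1: "Lattice.sup (remnant_lattice H) = Lattice.sup \<Q>"
    by (intro ext) (simp add: Lattice.sup_def least_def Upper_def remnant_hopf_def Let_def)
  show 2: "carrier (remnant_lattice H) = carrier \<Q>"
    by (simp add: remnant_hopf_def Let_def)
  show 3: "bi_ideal (remnant_lattice H) (remnant_lattice H) = bi_ideal \<Q> \<Q>"
    by (intro ext) (simp add: bi_ideal_def 1 2)
  show "pure (remnant_lattice H) (remnant_lattice H) = pure \<Q> \<Q>"
    by (intro ext) (simp add: pure_def 3)
  show "tensor (remnant_lattice H) (remnant_lattice H) = tensor \<Q> \<Q>"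
    by (simp add: tensor_def 3)
  show "ext (remnant_lattice H) = ext \<Q>"
    by (intro HOL.ext) (simp add: ext_def 1)
qed

lemma quotient_comult: "\<Delta>\<^sub>Q q = tensor_map \<Q> \<Q> \<pi> \<pi> (\<Delta> (\<iota> q))"
proof -
  have "\<Delta>\<^sub>Q q = tensor_map (remnant_lattice H) (remnant_lattice H) \<pi> \<pi> (\<Delta> (\<iota> q))"
    by (simp add: remnant_hopf_def Let_def)
  then show ?thesis by (simp only: tensor_map_def remnant_lattice_eqs)
qed

lemma quotient_unit: "hunit \<Q> = \<pi> (hunit H)"
  and quotient_antipode: "hantipode \<Q> q = \<pi> (hantipode H (\<iota> q))"
  and quotient_hmult: "hmult \<Q> = ext \<Q> (\<lambda>p q. \<pi> (\<iota> p \<cdot> \<iota> q))"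
proof -
  have "hmult \<Q> = ext (remnant_lattice H) (\<lambda>p q. \<pi> (\<iota> p \<cdot> \<iota> q))"
    by (simp add: remnant_hopf_def Let_def)
  then show "hmult \<Q> = ext \<Q> (\<lambda>p q. \<pi> (\<iota> p \<cdot> \<iota> q))" by (simp only: remnant_lattice_eqs)
qed (simp_all add: remnant_hopf_def Let_def)

lemma quotient_prod_bimor: "sup_bimor \<Q> \<Q> \<Q> (\<lambda>p q. \<pi> (\<iota> p \<cdot> \<iota> q))"
  unfolding sup_bimor_def
proof (intro conjI ballI)
  fix p assume p: "p \<in> carrier \<Q>"
  note ip = incl_closed[OF p]
  show "(\<lambda>q. \<pi> (\<iota> p \<cdot> \<iota> q)) \<in> sup_mor \<Q> \<Q>"
  proof (rule descend(2)[OF quotient_lattice, where f = "\<lambda>b. \<pi> (\<iota> p \<cdot> b)"])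
    show "(\<lambda>b. \<pi> (\<iota> p \<cdot> b)) \<in> sup_mor H \<Q>"
      by (rule sup_mor_comp[OF _ proj_mor]) (use hprod_bimor ip in \<open>simp add: sup_bimor_def\<close>)
  qed (simp add: proj_eq_bottom_iff hprod_closed kernel_closed ip counit_mult counit_kernel)
  show "(\<lambda>q. \<pi> (\<iota> q \<cdot> \<iota> p)) \<in> sup_mor \<Q> \<Q>"
  proof (rule descend(2)[OF quotient_lattice, where f = "\<lambda>b. \<pi> (b \<cdot> \<iota> p)"])
    show "(\<lambda>b. \<pi> (b \<cdot> \<iota> p)) \<in> sup_mor H \<Q>"
      by (rule sup_mor_comp[OF _ proj_mor]) (use hprod_bimor ip in \<open>simp add: sup_bimor_def\<close>)
  qed (simp add: proj_eq_bottom_iff hprod_closed kernel_closed ip counit_mult counit_kernel)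
qed

lemma quotient_prod:
  "p \<in> carrier \<Q> \<Longrightarrow> q \<in> carrier \<Q> \<Longrightarrow> p \<cdot>\<^sub>Q q = \<pi> (\<iota> p \<cdot> \<iota> q)"
  unfolding hprod_def hpair_def quotient_hmult
  using ext_pure[OF quotient_lattice quotient_lattice quotient_lattice quotient_prod_bimor]
  by (simp add: hprod_def hpair_def)

lemma quotient_prod_bimor': "sup_bimor \<Q> \<Q> \<Q> (\<lambda>p q. p \<cdot>\<^sub>Q q)"
proof -
  have cong: "f \<in> sup_mor \<Q> \<Q>" if g: "g \<in> sup_mor \<Q> \<Q>" and fg: "\<And>q. q \<in> carrier \<Q> \<Longrightarrow> f q = g q" for f g
  proof (rule sup_morI[OF quotient_lattice quotient_lattice])
    show "f (\<Squnion>\<^sub>Q A) \<sqsubseteq>\<^sub>Q k \<longleftrightarrow> (\<forall>a\<in>A. f a \<sqsubseteq>\<^sub>Q k)" if "A \<subseteq> carrier \<Q>" "k \<in> carrier \<Q>" for A k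
      using sup_mor_le_iff[OF quotient_lattice g that] fg that(1) by (simp add: in_mono)
  qed (simp add: fg sup_mor_closed[OF g])
  show ?thesis
    unfolding sup_bimor_def
  proof (intro conjI ballI)
    show "(\<lambda>q. p \<cdot>\<^sub>Q q) \<in> sup_mor \<Q> \<Q>" if "p \<in> carrier \<Q>" for p
      by (rule cong[of "\<lambda>q. \<pi> (\<iota> p \<cdot> \<iota> q)"])
        (use quotient_prod_bimor that in \<open>simp_all add: sup_bimor_def quotient_prod\<close>)
    show "(\<lambda>p. p \<cdot>\<^sub>Q q) \<in> sup_mor \<Q> \<Q>" if "q \<in> carrier \<Q>" for q
      by (rule cong[of "\<lambda>p. \<pi> (\<iota> p \<cdot> \<iota> q)"])
        (use quotient_prod_bimor that in \<open>simp_all add: sup_bimor_def quotient_prod\<close>)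
  qed
qed

lemma quotient_prod_closed: "p \<in> carrier \<Q> \<Longrightarrow> q \<in> carrier \<Q> \<Longrightarrow> p \<cdot>\<^sub>Q q \<in> carrier \<Q>"
  by (simp add: quotient_prod proj_closed hprod_closed incl_closed)

lemma proj_mult:
  assumes a: "a \<in> carrier H" and b: "b \<in> carrier H"
  shows "\<pi> (a \<cdot> b) = \<pi> a \<cdot>\<^sub>Q \<pi> b"
proof -
  have ib: "\<iota> (\<pi> b) \<in> carrier H" by (simp add: incl_closed proj_closed b)
  have "\<pi> (\<iota> (\<pi> a) \<cdot> \<iota> (\<pi> b)) = \<pi> (a \<cdot> \<iota> (\<pi> b))"
  proof (rule descend(1)[OF quotient_lattice _ _ a, where f = "\<lambda>x. \<pi> (x \<cdot> \<iota> (\<pi> b))"])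
    show "(\<lambda>x. \<pi> (x \<cdot> \<iota> (\<pi> b))) \<in> sup_mor H \<Q>"
      by (rule sup_mor_comp[OF _ proj_mor]) (use hprod_bimor ib in \<open>simp add: sup_bimor_def\<close>)
  qed (simp add: proj_eq_bottom_iff hprod_closed kernel_closed ib counit_mult counit_kernel)
  also have "\<dots> = \<pi> (a \<cdot> b)"
  proof (rule descend(1)[OF quotient_lattice _ _ b, where f = "\<lambda>x. \<pi> (a \<cdot> x)"])
    show "(\<lambda>x. \<pi> (a \<cdot> x)) \<in> sup_mor H \<Q>"
      by (rule sup_mor_comp[OF _ proj_mor]) (use hprod_bimor a in \<open>simp add: sup_bimor_def\<close>)
  qed (simp add: proj_eq_bottom_iff hprod_closed kernel_closed a counit_mult counit_kernel)
  finally show ?thesis using a b by (simp add: quotient_prod proj_closed)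
qed

text \<open>
  Apply the counit to \<open>S(a\<^sub>1) a\<^sub>2 = \<epsilon>(a) 1\<close>: as it is multiplicative, the left side becomes
  \<open>\<epsilon>(S(a\<^sub>1 \<epsilon>(a\<^sub>2))) = \<epsilon>(S(a))\<close>.
\<close>

lemma counit_antipode:
  assumes a: "a \<in> carrier H"
  shows "\<epsilon> (hantipode H a) \<longleftrightarrow> \<epsilon> a"
proof -
  have "\<epsilon> a \<longleftrightarrow> \<not> scale H (\<epsilon> a) (hunit H) \<sqsubseteq> \<D>"
    using counit_iff[OF unit_closed] counit_unit bottom_lower[OF kernel_closed] by (simp add: scale_def)
  also have "scale H (\<epsilon> a) (hunit H) \<sqsubseteq> \<D> \<longleftrightarrow> (\<forall>(x, y)\<in>\<Delta> a. \<not> (\<epsilon> y \<and> \<epsilon> (hantipode H x)))"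
    unfolding antipode_le_iff(2)[OF a kernel_closed]
    using comult_terms[OF _ a] counit_iff[OF hprod_closed[OF antipode_closed]] counit_mult[OF antipode_closed]
    by (intro ball_pairs) blast
  also have "\<not> \<dots> \<longleftrightarrow> (\<exists>(x, y)\<in>\<Delta> a. \<epsilon> y \<and> \<epsilon> (hantipode H x))" by auto
  also have "\<dots> \<longleftrightarrow> \<epsilon> (hantipode H a)"
  proof -
    have "(\<lambda>a. a \<in> carrier H \<and> \<epsilon> (hantipode H a)) \<in> functionals H UNIV"
      using sup_mor_comp[OF antipode_mor counit_mor]
      unfolding functionals_bool_iff sup_mor_unit_lat_iff by auto
    from counit_terms(2)[OF this a] show ?thesis
      unfolding terms_Sup_bool using a comult_terms[OF _ a] by (fastforce split: if_splits)
  qed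
  finally show ?thesis by simp
qed

lemma proj_antipode_mor: "(\<lambda>a. \<pi> (hantipode H a)) \<in> sup_mor H \<Q>"
  by (rule sup_mor_comp[OF antipode_mor proj_mor])

lemma proj_antipode_kernel: "\<pi> (hantipode H \<D>) = \<bottom>\<^sub>Q"
  using counit_antipode[OF kernel_closed] counit_kernel
  by (simp add: proj_eq_bottom_iff antipode_closed kernel_closed)

lemma proj_antipode: "a \<in> carrier H \<Longrightarrow> \<pi> (hantipode H a) = hantipode \<Q> (\<pi> a)"
  using descend(1)[OF quotient_lattice proj_antipode_mor proj_antipode_kernel]
  by (simp add: quotient_antipode)

lemma quotient_antipode_mor: "hantipode \<Q> \<in> sup_mor \<Q> \<Q>"
  using descend(2)[OF quotient_lattice proj_antipode_mor proj_antipode_kernel]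
  by (simp add: quotient_antipode[abs_def])

text \<open>
  With \<open>proj_tensor_subset_iff\<close> this reduces inclusions in \<open>Q \<otimes> Q\<close> to inclusions in \<open>H \<otimes> H\<close>.
\<close>

lemma pullback_bi_ideal:
  assumes "bi_ideal \<Q> \<Q> J"
  shows "bi_ideal H H {(a, b) \<in> carrier H \<times> carrier H. (\<pi> a, \<pi> b) \<in> J}"
proof (rule bi_idealI[OF lattice lattice])
  have Sup: "\<pi> (\<Squnion> A) = \<Squnion>\<^sub>Q (\<pi> ` A)" "\<pi> ` A \<subseteq> carrier \<Q>" if "A \<subseteq> carrier H" for A
    using that proj_mor by (auto simp: sup_mor_def)
  show "(\<pi> (\<Squnion> A), \<pi> m) \<in> J \<longleftrightarrow> (\<forall>a\<in>A. (\<pi> a, \<pi> m) \<in> J)" if "A \<subseteq> carrier H" "m \<in> carrier H" for A m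
    using assms Sup[OF that(1)] proj_closed[OF that(2)] unfolding bi_ideal_def by simp
  show "(\<pi> l, \<pi> (\<Squnion> B)) \<in> J \<longleftrightarrow> (\<forall>b\<in>B. (\<pi> l, \<pi> b) \<in> J)" if "l \<in> carrier H" "B \<subseteq> carrier H" for l B
    using assms Sup[OF that(2)] proj_closed[OF that(1)] unfolding bi_ideal_def by simp
qed

lemma proj_tensor_subset_iff:
  assumes "bi_ideal H H x" "bi_ideal \<Q> \<Q> J"
  shows "tensor_map \<Q> \<Q> \<pi> \<pi> x \<subseteq> J \<longleftrightarrow> (\<forall>(a, b)\<in>x. (\<pi> a, \<pi> b) \<in> J)"
  by (rule tensor_map_subset_iff[OF quotient_lattice quotient_lattice _ _ assms]) (auto intro: proj_closed)

lemma proj_tensor_closed: "bi_ideal H H x \<Longrightarrow> bi_ideal \<Q> \<Q> (tensor_map \<Q> \<Q> \<pi> \<pi> x)"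
  by (rule tensor_map_closed[OF quotient_lattice quotient_lattice]) (auto intro: proj_closed)

lemma quotient_tensor_lattice: "complete_lattice (tensor \<Q> \<Q>)"
  by (rule tensor_complete_lattice[OF quotient_lattice quotient_lattice])

lemma proj_tensor_mor: "tensor_map \<Q> \<Q> \<pi> \<pi> \<in> sup_mor (tensor H H) (tensor \<Q> \<Q>)"
proof (rule sup_morI[OF quotient_tensor_lattice tensor_lattice])
  fix A J assume A: "A \<subseteq> carrier (tensor H H)" and J: "J \<in> carrier (tensor \<Q> \<Q>)"
  interpret T: complete_lattice "tensor H H" by (rule tensor_lattice)
  let ?I = "{(a, b) \<in> carrier H \<times> carrier H. (\<pi> a, \<pi> b) \<in> J}"
  have bJ: "bi_ideal \<Q> \<Q> J" using J by (simp add: tensor_simps)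
  have *: "tensor_map \<Q> \<Q> \<pi> \<pi> x \<subseteq> J \<longleftrightarrow> x \<subseteq> ?I" if "bi_ideal H H x" for x
    unfolding proj_tensor_subset_iff[OF that bJ] using bi_ideal_carrier[OF that] by auto
  have I: "?I \<in> carrier (tensor H H)" using pullback_bi_ideal[OF bJ] by (simp add: tensor_simps)
  have "bi_ideal H H (\<Squnion>\<^bsub>tensor H H\<^esub> A)" using T.sup_closed[OF A] by (simp add: tensor_simps)
  then show "tensor_map \<Q> \<Q> \<pi> \<pi> (\<Squnion>\<^bsub>tensor H H\<^esub> A) \<sqsubseteq>\<^bsub>tensor \<Q> \<Q>\<^esub> J \<longleftrightarrow>
    (\<forall>x\<in>A. tensor_map \<Q> \<Q> \<pi> \<pi> x \<sqsubseteq>\<^bsub>tensor \<Q> \<Q>\<^esub> J)"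
    using complete_lattice_sup_le_iff[OF tensor_lattice A I] A
    by (auto simp: tensor_simps * subset_iff[of A])
qed (use proj_tensor_closed in \<open>simp add: tensor_simps\<close>)

lemma bi_ideal_kills_kernel:
  assumes J: "bi_ideal \<Q> \<Q> J" and ab: "a \<in> carrier H" "b \<in> carrier H" "\<not> (\<epsilon> a \<and> \<epsilon> b)"
  shows "(\<pi> a, \<pi> b) \<in> J"
  using bi_ideal_bot[OF quotient_lattice quotient_lattice J] ab
  by (metis proj_closed proj_eq_bottom_iff)

text \<open>
  The coproduct descends because each term of \<open>\<Delta>(D)\<close> has an entry with counit \<open>False\<close>: the counit of
  \<open>a\<close> is the join of the \<open>\<epsilon>(x) \<epsilon>(y)\<close> over the terms \<open>(x, y)\<close> of \<open>\<Delta>(a)\<close>.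
\<close>

lemma quotient_comult_mor: "\<Delta>\<^sub>Q \<in> sup_mor \<Q> (tensor \<Q> \<Q>)"
  and comult_proj: "a \<in> carrier H \<Longrightarrow> \<Delta>\<^sub>Q (\<pi> a) = tensor_map \<Q> \<Q> \<pi> \<pi> (\<Delta> a)"
proof -
  let ?f = "\<lambda>a. tensor_map \<Q> \<Q> \<pi> \<pi> (\<Delta> a)"
  have f: "?f \<in> sup_mor H (tensor \<Q> \<Q>)" by (rule sup_mor_comp[OF comult_mor proj_tensor_mor])
  have D: "?f \<D> = \<bottom>\<^bsub>tensor \<Q> \<Q>\<^esub>"
  proof (rule tensor_eq_bottomI[OF quotient_lattice quotient_lattice])
    show "?f \<D> \<in> carrier (tensor \<Q> \<Q>)" by (rule sup_mor_closed[OF f kernel_closed])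
    show "?f \<D> \<subseteq> J" if J: "bi_ideal \<Q> \<Q> J" for J
      unfolding proj_tensor_subset_iff[OF comult_closed[OF kernel_closed] J]
      using counit_terms_iff[OF kernel_closed] counit_kernel comult_terms[OF _ kernel_closed]
        bi_ideal_kills_kernel[OF J] by fast
  qed
  show "\<Delta>\<^sub>Q \<in> sup_mor \<Q> (tensor \<Q> \<Q>)"
    using descend(2)[OF quotient_tensor_lattice f D] by (simp add: quotient_comult[abs_def])
  show "\<Delta>\<^sub>Q (\<pi> a) = ?f a" if "a \<in> carrier H"
    using descend(1)[OF quotient_tensor_lattice f D that] by (simp add: quotient_comult)
qed

lemma quotient_cases:
  assumes "q \<in> carrier \<Q>"
  obtains a where "a \<in> carrier H" "q = \<pi> a"
  using assms by (auto simp: quotient_simps)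

lemma quotient_comult_closed: "q \<in> carrier \<Q> \<Longrightarrow> bi_ideal \<Q> \<Q> (\<Delta>\<^sub>Q q)"
  using sup_mor_closed[OF quotient_comult_mor, of q] by (simp add: tensor_simps)

lemma quotient_comult_terms: "(p, q) \<in> \<Delta>\<^sub>Q s \<Longrightarrow> s \<in> carrier \<Q> \<Longrightarrow> p \<in> carrier \<Q> \<and> q \<in> carrier \<Q>"
  using bi_ideal_carrier[OF quotient_comult_closed] .

lemma quotient_comult_subset_iff:
  assumes "a \<in> carrier H" "bi_ideal \<Q> \<Q> J"
  shows "\<Delta>\<^sub>Q (\<pi> a) \<subseteq> J \<longleftrightarrow> (\<forall>(x, y)\<in>\<Delta> a. (\<pi> x, \<pi> y) \<in> J)"
  using assms by (simp add: comult_proj proj_tensor_subset_iff comult_closed)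

lemma proj_terms: "a \<in> carrier H \<Longrightarrow> (x, y) \<in> \<Delta> a \<Longrightarrow> (\<pi> x, \<pi> y) \<in> \<Delta>\<^sub>Q (\<pi> a)"
  using quotient_comult_subset_iff[of a "\<Delta>\<^sub>Q (\<pi> a)"] quotient_comult_closed[OF proj_closed] by blast


section \<open>Grouplike elements of the quotient\<close>

lemma quotient_prod_mono:
  assumes "p \<in> carrier \<Q>" "p' \<in> carrier \<Q>" "q \<in> carrier \<Q>" "q' \<in> carrier \<Q>"
    and "p \<sqsubseteq>\<^sub>Q p'" "q \<sqsubseteq>\<^sub>Q q'"
  shows "p \<cdot>\<^sub>Q q \<sqsubseteq>\<^sub>Q p' \<cdot>\<^sub>Q q'"
proof -
  have "p \<cdot>\<^sub>Q q \<sqsubseteq>\<^sub>Q p' \<cdot>\<^sub>Q q"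
    using quotient_prod_bimor' assms
    by (intro sup_mor_mono[OF quotient_lattice quotient_lattice, of "\<lambda>p. p \<cdot>\<^sub>Q q"])
      (simp_all add: sup_bimor_def)
  moreover have "p' \<cdot>\<^sub>Q q \<sqsubseteq>\<^sub>Q p' \<cdot>\<^sub>Q q'"
    using quotient_prod_bimor' assms
    by (intro sup_mor_mono[OF quotient_lattice quotient_lattice, of "\<lambda>q. p' \<cdot>\<^sub>Q q"])
      (simp_all add: sup_bimor_def)
  ultimately show ?thesis
    by (rule quotient.le_trans) (use assms in \<open>simp_all add: quotient_prod_closed\<close>)
qed

lemma quotient_prod_eq_bottom_iff:
  assumes "p \<in> carrier \<Q>" "q \<in> carrier \<Q>"
  shows "p \<cdot>\<^sub>Q q = \<bottom>\<^sub>Q \<longleftrightarrow> p = \<bottom>\<^sub>Q \<or> q = \<bottom>\<^sub>Q"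
  using assms
  by (elim quotient_cases) (simp add: proj_eq_bottom_iff hprod_closed counit_mult flip: proj_mult)

lemma quotient_prod_assoc:
  assumes "p \<in> carrier \<Q>" "q \<in> carrier \<Q>" "s \<in> carrier \<Q>"
  shows "p \<cdot>\<^sub>Q q \<cdot>\<^sub>Q s = p \<cdot>\<^sub>Q (q \<cdot>\<^sub>Q s)"
  using assms
  by (elim quotient_cases) (simp add: hprod_closed mult_assoc flip: proj_mult)

lemma quotient_prod_unit:
  assumes "p \<in> carrier \<Q>"
  shows "hunit \<Q> \<cdot>\<^sub>Q p = p" "p \<cdot>\<^sub>Q hunit \<Q> = p"
  using assms
  by (elim quotient_cases; simp add: quotient_unit unit_closed mult_unit flip: proj_mult)+

lemma quotient_unit_closed: "hunit \<Q> \<in> carrier \<Q>"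
  by (simp add: quotient_unit proj_closed unit_closed)

lemma quotient_unit_nonzero: "hunit \<Q> \<noteq> \<bottom>\<^sub>Q"
  by (simp add: quotient_unit proj_eq_bottom_iff unit_closed counit_unit)

lemma quotient_antipode_closed: "p \<in> carrier \<Q> \<Longrightarrow> hantipode \<Q> p \<in> carrier \<Q>"
  using sup_mor_closed[OF quotient_antipode_mor] .

lemma quotient_antipode_eq_bottom_iff:
  "p \<in> carrier \<Q> \<Longrightarrow> hantipode \<Q> p = \<bottom>\<^sub>Q \<longleftrightarrow> p = \<bottom>\<^sub>Q"
  by (elim quotient_cases)
    (simp add: proj_eq_bottom_iff antipode_closed counit_antipode flip: proj_antipode)

lemma quotient_antipode_bimor:
  "sup_bimor \<Q> \<Q> \<Q> (\<lambda>p q. p \<cdot>\<^sub>Q hantipode \<Q> q)"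
  "sup_bimor \<Q> \<Q> \<Q> (\<lambda>p q. hantipode \<Q> p \<cdot>\<^sub>Q q)"
proof -
  have l: "(\<lambda>q. p \<cdot>\<^sub>Q q) \<in> sup_mor \<Q> \<Q>" and r: "(\<lambda>q. q \<cdot>\<^sub>Q p) \<in> sup_mor \<Q> \<Q>"
    if "p \<in> carrier \<Q>" for p
    using quotient_prod_bimor' that by (simp_all add: sup_bimor_def)
  show "sup_bimor \<Q> \<Q> \<Q> (\<lambda>p q. p \<cdot>\<^sub>Q hantipode \<Q> q)"
    unfolding sup_bimor_def
    using sup_mor_comp[OF quotient_antipode_mor l] r[OF quotient_antipode_closed] by blast
  show "sup_bimor \<Q> \<Q> \<Q> (\<lambda>p q. hantipode \<Q> p \<cdot>\<^sub>Q q)"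
    unfolding sup_bimor_def
    using sup_mor_comp[OF quotient_antipode_mor r] l[OF quotient_antipode_closed] by blast
qed

text \<open>
  The antipode axioms of \<open>Q\<close> at a nonzero element, tested against an upper bound \<open>k\<close>. With
  \<open>k = 1\<close> they bound every single term \<open>p S(q)\<close> by \<open>1\<close>.
\<close>

lemma quotient_antipode_le_iff:
  assumes s: "s \<in> carrier \<Q>" "s \<noteq> \<bottom>\<^sub>Q" and k: "k \<in> carrier \<Q>"
  shows "hunit \<Q> \<sqsubseteq>\<^sub>Q k \<longleftrightarrow> (\<forall>(p, q)\<in>\<Delta>\<^sub>Q s. p \<cdot>\<^sub>Q hantipode \<Q> q \<sqsubseteq>\<^sub>Q k)"
    and "hunit \<Q> \<sqsubseteq>\<^sub>Q k \<longleftrightarrow> (\<forall>(p, q)\<in>\<Delta>\<^sub>Q s. hantipode \<Q> p \<cdot>\<^sub>Q q \<sqsubseteq>\<^sub>Q k)"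
proof -
  obtain a where a: "a \<in> carrier H" "s = \<pi> a" using s(1) by (rule quotient_cases)
  then have e: "\<epsilon> a" using s(2) by (simp add: proj_eq_bottom_iff)
  have unit: "hunit \<Q> \<sqsubseteq>\<^sub>Q k \<longleftrightarrow> scale H (\<epsilon> a) (hunit H) \<sqsubseteq> \<iota> k"
    using e k by (simp add: quotient_unit proj_le_iff unit_closed scale_def)
  let ?J = "\<lambda>\<beta>. {(p, q) \<in> carrier \<Q> \<times> carrier \<Q>. \<beta> p q \<sqsubseteq>\<^sub>Q k}"
  have *: "(\<forall>(p, q)\<in>\<Delta>\<^sub>Q s. \<beta> p q \<sqsubseteq>\<^sub>Q k) \<longleftrightarrow> (\<forall>(x, y)\<in>\<Delta> a. \<beta> (\<pi> x) (\<pi> y) \<sqsubseteq>\<^sub>Q k)"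
    if \<beta>: "sup_bimor \<Q> \<Q> \<Q> \<beta>" for \<beta>
  proof -
    have "bi_ideal \<Q> \<Q> (?J \<beta>)" by (rule bi_ideal_le[OF quotient_lattice quotient_lattice quotient_lattice \<beta> k])
    then have "\<Delta>\<^sub>Q s \<subseteq> ?J \<beta> \<longleftrightarrow> (\<forall>(x, y)\<in>\<Delta> a. (\<pi> x, \<pi> y) \<in> ?J \<beta>)"
      unfolding a(2) by (rule quotient_comult_subset_iff[OF a(1)])
    moreover have "\<Delta>\<^sub>Q s \<subseteq> ?J \<beta> \<longleftrightarrow> (\<forall>(p, q)\<in>\<Delta>\<^sub>Q s. \<beta> p q \<sqsubseteq>\<^sub>Q k)"
      using quotient_comult_terms[OF _ s(1)] by auto
    moreover have "(\<forall>(x, y)\<in>\<Delta> a. (\<pi> x, \<pi> y) \<in> ?J \<beta>) \<longleftrightarrow> (\<forall>(x, y)\<in>\<Delta> a. \<beta> (\<pi> x) (\<pi> y) \<sqsubseteq>\<^sub>Q k)"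
      using comult_terms[OF _ a(1)] by (intro ball_pairs) (simp add: proj_closed)
    ultimately show ?thesis by simp
  qed
  show "hunit \<Q> \<sqsubseteq>\<^sub>Q k \<longleftrightarrow> (\<forall>(p, q)\<in>\<Delta>\<^sub>Q s. p \<cdot>\<^sub>Q hantipode \<Q> q \<sqsubseteq>\<^sub>Q k)"
    unfolding unit *[OF quotient_antipode_bimor(1)] antipode_le_iff(1)[OF a(1) incl_closed[OF k]]
    using comult_terms[OF _ a(1)] k
    by (intro ball_pairs)
      (simp add: proj_le_iff hprod_closed antipode_closed flip: proj_mult proj_antipode)
  show "hunit \<Q> \<sqsubseteq>\<^sub>Q k \<longleftrightarrow> (\<forall>(p, q)\<in>\<Delta>\<^sub>Q s. hantipode \<Q> p \<cdot>\<^sub>Q q \<sqsubseteq>\<^sub>Q k)"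
    unfolding unit *[OF quotient_antipode_bimor(2)] antipode_le_iff(2)[OF a(1) incl_closed[OF k]]
    using comult_terms[OF _ a(1)] k
    by (intro ball_pairs)
      (simp add: proj_le_iff hprod_closed antipode_closed flip: proj_mult proj_antipode)
qed

lemma quotient_counit_terms:
  assumes s: "s \<in> carrier \<Q>" and pq: "(p, q) \<in> \<Delta>\<^sub>Q s"
  shows "q \<noteq> \<bottom>\<^sub>Q \<Longrightarrow> p \<sqsubseteq>\<^sub>Q s" "p \<noteq> \<bottom>\<^sub>Q \<Longrightarrow> q \<sqsubseteq>\<^sub>Q s"
proof -
  obtain a where a: "a \<in> carrier H" "s = \<pi> a" using s by (rule quotient_cases)
  have Sup_bot: "\<Squnion>\<^sub>Q A = \<bottom>\<^sub>Q \<longleftrightarrow> (\<forall>p\<in>A. p = \<bottom>\<^sub>Q)" if "A \<subseteq> carrier \<Q>" for A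
    using complete_lattice_sup_le_iff[OF quotient_lattice that quotient.bottom_closed] that
      quotient_le_bottom_iff by (auto simp: subset_iff)
  note Sup_le = complete_lattice_sup_le_iff[OF quotient_lattice _ s]
  have 1: "bi_ideal \<Q> \<Q> {(p, q) \<in> carrier \<Q> \<times> carrier \<Q>. q = \<bottom>\<^sub>Q \<or> p \<sqsubseteq>\<^sub>Q s}"
    by (rule bi_idealI[OF quotient_lattice quotient_lattice]) (simp_all add: Sup_bot Sup_le)
  have 2: "bi_ideal \<Q> \<Q> {(p, q) \<in> carrier \<Q> \<times> carrier \<Q>. p = \<bottom>\<^sub>Q \<or> q \<sqsubseteq>\<^sub>Q s}"
    by (rule bi_idealI[OF quotient_lattice quotient_lattice]) (simp_all add: Sup_bot Sup_le)
  have le: "\<pi> x \<sqsubseteq>\<^sub>Q s" if "\<epsilon> y" "(x, y) \<in> \<Delta> a \<or> (y, x) \<in> \<Delta> a" for x y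
  proof -
    have x: "x \<in> carrier H" using that comult_terms[OF _ a(1)] by blast
    have "x \<sqsubseteq> a" using that counit_left_le_iff[OF a(1) a(1)] counit_right_le_iff[OF a(1) a(1)] le_refl[OF a(1)]
      by fast
    then show ?thesis using proj_mono x a by simp
  qed
  have "(\<pi> x, \<pi> y) \<in> {(p, q) \<in> carrier \<Q> \<times> carrier \<Q>. q = \<bottom>\<^sub>Q \<or> p \<sqsubseteq>\<^sub>Q s}"
    if xy: "(x, y) \<in> \<Delta> a" for x y
  proof -
    have "\<not> \<epsilon> y \<or> \<pi> x \<sqsubseteq>\<^sub>Q s" using le[of y x] xy by blast
    then show ?thesis using comult_terms[OF xy a(1)] by (simp add: proj_closed proj_eq_bottom_iff)
  qed
  then have "\<forall>(x, y)\<in>\<Delta> a. (\<pi> x, \<pi> y) \<in> {(p, q) \<in> carrier \<Q> \<times> carrier \<Q>. q = \<bottom>\<^sub>Q \<or> p \<sqsubseteq>\<^sub>Q s}"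
    by (intro ballI) (simp only: split_paired_all prod.case)
  then have "\<Delta>\<^sub>Q s \<subseteq> {(p, q) \<in> carrier \<Q> \<times> carrier \<Q>. q = \<bottom>\<^sub>Q \<or> p \<sqsubseteq>\<^sub>Q s}"
    using quotient_comult_subset_iff[OF a(1) 1] a(2) by simp
  then show "q \<noteq> \<bottom>\<^sub>Q \<Longrightarrow> p \<sqsubseteq>\<^sub>Q s" using pq by auto
  have "(\<pi> x, \<pi> y) \<in> {(p, q) \<in> carrier \<Q> \<times> carrier \<Q>. p = \<bottom>\<^sub>Q \<or> q \<sqsubseteq>\<^sub>Q s}"
    if xy: "(x, y) \<in> \<Delta> a" for x y
  proof -
    have "\<not> \<epsilon> x \<or> \<pi> y \<sqsubseteq>\<^sub>Q s" using le[of x y] xy by blast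
    then show ?thesis using comult_terms[OF xy a(1)] by (simp add: proj_closed proj_eq_bottom_iff)
  qed
  then have "\<forall>(x, y)\<in>\<Delta> a. (\<pi> x, \<pi> y) \<in> {(p, q) \<in> carrier \<Q> \<times> carrier \<Q>. p = \<bottom>\<^sub>Q \<or> q \<sqsubseteq>\<^sub>Q s}"
    by (intro ballI) (simp only: split_paired_all prod.case)
  then have "\<Delta>\<^sub>Q s \<subseteq> {(p, q) \<in> carrier \<Q> \<times> carrier \<Q>. p = \<bottom>\<^sub>Q \<or> q \<sqsubseteq>\<^sub>Q s}"
    using quotient_comult_subset_iff[OF a(1) 2] a(2) by simp
  then show "p \<noteq> \<bottom>\<^sub>Q \<Longrightarrow> q \<sqsubseteq>\<^sub>Q s" using pq by auto
qed

abbreviation nonzero :: "'a set \<Rightarrow> bool"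
  where "nonzero p \<equiv> p \<in> carrier \<Q> \<and> p \<noteq> \<bottom>\<^sub>Q"

lemma quotient_comult_unit: "(hunit \<Q>, hunit \<Q>) \<in> \<Delta>\<^sub>Q (hunit \<Q>)"
  unfolding quotient_unit
  by (rule proj_terms[OF unit_closed])
    (simp add: comult_unit hpair_def bi_ideal_pure(2)[OF lattice lattice unit_closed unit_closed])

text \<open>
  If \<open>0 \<noteq> x \<le> 1\<close>, then the terms \<open>(p, q)\<close> of \<open>\<Delta>(x)\<close> with nonzero entries satisfy \<open>p \<le> x\<close> and
  \<open>q \<le> 1\<close>, so that \<open>1\<close>, the join of the elements \<open>p S(q)\<close>, is at most \<open>x S(1) \<le> x\<close>;
  here \<open>S(1) \<le> 1\<close> because \<open>(1, 1)\<close> is a term of \<open>\<Delta>(1)\<close>.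
\<close>

lemma quotient_unit_atom:
  assumes x: "nonzero x" and le: "x \<sqsubseteq>\<^sub>Q hunit \<Q>"
  shows "x = hunit \<Q>"
proof (rule quotient.le_antisym[OF le])
  have S1: "hantipode \<Q> (hunit \<Q>) \<sqsubseteq>\<^sub>Q hunit \<Q>"
  proof -
    show ?thesis
      using quotient_comult_unit quotient_antipode_le_iff(1)[OF quotient_unit_closed quotient_unit_nonzero quotient_unit_closed]
        quotient.le_refl[OF quotient_unit_closed] quotient_prod_unit(1)[OF quotient_antipode_closed[OF quotient_unit_closed]]
      by fastforce
  qed
  show "hunit \<Q> \<sqsubseteq>\<^sub>Q x"
    unfolding quotient_antipode_le_iff(1)[OF conjunct1[OF x] conjunct2[OF x] conjunct1[OF x]]
  proof safe
    fix p q assume pq: "(p, q) \<in> \<Delta>\<^sub>Q x"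
    then have c: "p \<in> carrier \<Q>" "q \<in> carrier \<Q>" "hantipode \<Q> q \<in> carrier \<Q>"
      using quotient_comult_terms x quotient_antipode_closed by blast+
    show "p \<cdot>\<^sub>Q hantipode \<Q> q \<sqsubseteq>\<^sub>Q x"
    proof (cases "p = \<bottom>\<^sub>Q \<or> q = \<bottom>\<^sub>Q")
      case True
      then have "p \<cdot>\<^sub>Q hantipode \<Q> q = \<bottom>\<^sub>Q"
        using c quotient_prod_eq_bottom_iff[OF c(1,3)] quotient_antipode_eq_bottom_iff[OF c(2)] by blast
      then show ?thesis using x by (simp add: quotient.bottom_lower)
    next
      case False
      then have px: "p \<sqsubseteq>\<^sub>Q x" and qx: "q \<sqsubseteq>\<^sub>Q x"
        using quotient_counit_terms[OF conjunct1[OF x] pq] by auto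
      have "q \<sqsubseteq>\<^sub>Q hunit \<Q>"
        by (rule quotient.le_trans[OF qx le]) (use c x quotient_unit_closed in auto)
      then have "hantipode \<Q> q \<sqsubseteq>\<^sub>Q hantipode \<Q> (hunit \<Q>)"
        by (rule sup_mor_mono[OF quotient_lattice quotient_lattice quotient_antipode_mor c(2) quotient_unit_closed])
      then have "hantipode \<Q> q \<sqsubseteq>\<^sub>Q hunit \<Q>"
        by (rule quotient.le_trans[OF _ S1]) (use c quotient_unit_closed quotient_antipode_closed in auto)
      then have "p \<cdot>\<^sub>Q hantipode \<Q> q \<sqsubseteq>\<^sub>Q x \<cdot>\<^sub>Q hunit \<Q>"
        using px c x by (intro quotient_prod_mono) (auto simp: quotient_unit_closed)
      then show ?thesis using x by (simp add: quotient_prod_unit)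
    qed
  qed
qed (use x quotient_unit_closed in auto)

lemma antipode_inverse:
  assumes s: "s \<in> carrier \<Q>" and pq: "(p, q) \<in> \<Delta>\<^sub>Q s" and n: "p \<noteq> \<bottom>\<^sub>Q" "q \<noteq> \<bottom>\<^sub>Q"
  shows "p \<cdot>\<^sub>Q hantipode \<Q> q = hunit \<Q>" "hantipode \<Q> p \<cdot>\<^sub>Q q = hunit \<Q>"
proof -
  have c: "p \<in> carrier \<Q>" "q \<in> carrier \<Q>" using quotient_comult_terms[OF pq s] by auto
  have "s \<noteq> \<bottom>\<^sub>Q" using quotient_counit_terms(1)[OF s pq n(2)] n(1) c quotient_le_bottom_iff by auto
  note le = quotient_antipode_le_iff[OF s this quotient_unit_closed]
  show "p \<cdot>\<^sub>Q hantipode \<Q> q = hunit \<Q>"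
    by (rule quotient_unit_atom)
      (use le(1) pq n c quotient.le_refl[OF quotient_unit_closed] in
        \<open>auto simp: quotient_prod_closed quotient_antipode_closed quotient_prod_eq_bottom_iff quotient_antipode_eq_bottom_iff\<close>)
  show "hantipode \<Q> p \<cdot>\<^sub>Q q = hunit \<Q>"
    by (rule quotient_unit_atom)
      (use le(2) pq n c quotient.le_refl[OF quotient_unit_closed] in
        \<open>auto simp: quotient_prod_closed quotient_antipode_closed quotient_prod_eq_bottom_iff quotient_antipode_eq_bottom_iff\<close>)
qed

text \<open>
  For a term \<open>(u, v)\<close> of \<open>\<Delta>(q)\<close> with nonzero entries, \<open>u \<le> q\<close> makes \<open>(p, u)\<close> a term of \<open>\<Delta>(s)\<close>.
  Thus \<open>S(u)\<close> is a right inverse of \<open>p\<close> and a left inverse of \<open>v\<close>, whence \<open>p = v\<close>. By the counit axiom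
  \<open>q\<close> is the join of these \<open>v\<close>.
\<close>

lemma comult_diagonal:
  assumes s: "s \<in> carrier \<Q>" and pq: "(p, q) \<in> \<Delta>\<^sub>Q s" and n: "p \<noteq> \<bottom>\<^sub>Q" "q \<noteq> \<bottom>\<^sub>Q"
  shows "p = q"
proof -
  have c: "p \<in> carrier \<Q>" "q \<in> carrier \<Q>" using quotient_comult_terms[OF pq s] by auto
  have eq: "p = v" if uv: "(u, v) \<in> \<Delta>\<^sub>Q q" "u \<noteq> \<bottom>\<^sub>Q" "v \<noteq> \<bottom>\<^sub>Q" for u v
  proof -
    have uvc: "u \<in> carrier \<Q>" "v \<in> carrier \<Q>" using quotient_comult_terms[OF uv(1) c(2)] by auto
    have "u \<sqsubseteq>\<^sub>Q q" by (rule quotient_counit_terms(1)[OF c(2) uv(1,3)])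
    then have pu: "(p, u) \<in> \<Delta>\<^sub>Q s"
      using bi_ideal_mono[OF quotient_lattice quotient_lattice quotient_comult_closed[OF s] pq c(1) uvc(1)]
        quotient.le_refl[OF c(1)] by blast
    have Su: "hantipode \<Q> u \<in> carrier \<Q>" using uvc by (simp add: quotient_antipode_closed)
    have "p = p \<cdot>\<^sub>Q (hantipode \<Q> u \<cdot>\<^sub>Q v)"
      using antipode_inverse(2)[OF c(2) uv] c by (simp add: quotient_prod_unit)
    also have "\<dots> = (p \<cdot>\<^sub>Q hantipode \<Q> u) \<cdot>\<^sub>Q v"
      using quotient_prod_assoc[OF c(1) Su uvc(2)] by simp
    also have "\<dots> = v"
      using antipode_inverse(1)[OF s pu n(1) uv(2)] uvc by (simp add: quotient_prod_unit)
    finally show ?thesis .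
  qed
  obtain b where b: "b \<in> carrier H" "q = \<pi> b" using c(2) by (rule quotient_cases)
  then have eb: "\<epsilon> b" using n(2) by (simp add: proj_eq_bottom_iff)
  have eq': "\<pi> y = p" if "(x, y) \<in> \<Delta> b" "\<epsilon> x" "\<epsilon> y" for x y
    using eq[of "\<pi> x" "\<pi> y"] proj_terms[OF b(1) that(1)] comult_terms[OF that(1) b(1)] that b(2)
    by (simp add: proj_eq_bottom_iff)
  show ?thesis
  proof (rule quotient.le_antisym)
    obtain x y where xy: "(x, y) \<in> \<Delta> b" "\<epsilon> x" "\<epsilon> y" using eb counit_terms_iff[OF b(1)] by blast
    then have "\<pi> y \<sqsubseteq>\<^sub>Q \<pi> b"
      using counit_left_le_iff[OF b(1) b(1)] le_refl[OF b(1)] comult_terms[OF xy(1) b(1)] b(1)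
      by (intro proj_mono) auto
    then show "p \<sqsubseteq>\<^sub>Q q" using eq'[OF xy] b(2) by simp
    have "b \<sqsubseteq> \<iota> p"
      unfolding counit_left_le_iff[OF b(1) incl_closed[OF c(1)]]
    proof safe
      fix x y assume xy: "(x, y) \<in> \<Delta> b" "\<epsilon> x"
      then have y: "y \<in> carrier H" using comult_terms[OF xy(1) b(1)] by simp
      show "y \<sqsubseteq> \<iota> p"
      proof (cases "\<epsilon> y")
        case True
        then show ?thesis
          using eq'[OF xy True] proj_le_iff[OF y c(1)] quotient.le_refl[OF c(1)] by simp
      next
        case False
        then show ?thesis
          using counit_iff[OF y] le_trans[OF _ kernel_le_incl[OF c(1)] y kernel_closed incl_closed[OF c(1)]]
          by simp
      qed
    qed
    then show "q \<sqsubseteq>\<^sub>Q p" using b proj_le_iff[OF b(1) c(1)] by simp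
  qed (use c in auto)
qed

definition grouplike :: "'a set set"
  where "grouplike = {g \<in> carrier \<Q>. g \<noteq> \<bottom>\<^sub>Q \<and> (g, g) \<in> \<Delta>\<^sub>Q g}"

text \<open>
  Coproducts are closed under passage to smaller entries, so a nonzero \<open>x\<close> below \<open>p\<close> gives a term
  \<open>(x, p)\<close>, which has to be diagonal.
\<close>

lemma comult_atom:
  assumes s: "s \<in> carrier \<Q>" and pp: "(p, p) \<in> \<Delta>\<^sub>Q s" "p \<noteq> \<bottom>\<^sub>Q"
    and x: "nonzero x" "x \<sqsubseteq>\<^sub>Q p"
  shows "x = p"
proof -
  have c: "p \<in> carrier \<Q>" using quotient_comult_terms[OF pp(1) s] by simp
  have "(x, p) \<in> \<Delta>\<^sub>Q s"
    using bi_ideal_mono[OF quotient_lattice quotient_lattice quotient_comult_closed[OF s] pp(1)] x c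
      quotient.le_refl[OF c] by blast
  then show ?thesis using comult_diagonal[OF s] x(1) pp(2) by blast
qed

lemma comult_grouplike:
  assumes s: "s \<in> carrier \<Q>" and pq: "(p, q) \<in> \<Delta>\<^sub>Q s" and n: "p \<noteq> \<bottom>\<^sub>Q" "q \<noteq> \<bottom>\<^sub>Q"
  shows "p \<in> grouplike"
proof -
  have pp: "(p, p) \<in> \<Delta>\<^sub>Q s" using comult_diagonal[OF assms] pq by simp
  have c: "p \<in> carrier \<Q>" using quotient_comult_terms[OF pq s] by auto
  obtain b where b: "b \<in> carrier H" "p = \<pi> b" using c by (rule quotient_cases)
  then have "\<epsilon> b" using n(1) by (simp add: proj_eq_bottom_iff)
  then obtain x y where xy: "(x, y) \<in> \<Delta> b" "\<epsilon> x" "\<epsilon> y" using counit_terms_iff[OF b(1)] by blast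
  note xyc = comult_terms[OF xy(1) b(1)]
  have D: "(\<pi> x, \<pi> y) \<in> \<Delta>\<^sub>Q p" using proj_terms[OF b(1) xy(1)] b(2) by simp
  have nz: "\<pi> x \<noteq> \<bottom>\<^sub>Q" "\<pi> y \<noteq> \<bottom>\<^sub>Q" using xy xyc by (simp_all add: proj_eq_bottom_iff)
  have "\<pi> x = p" "\<pi> y = p"
    using comult_atom[OF s pp n(1)] quotient_counit_terms[OF c D] nz xyc by (simp_all add: proj_closed)
  then show ?thesis using D c n by (simp add: grouplike_def)
qed

lemma grouplike_closed: "g \<in> grouplike \<Longrightarrow> g \<in> carrier \<Q>"
  and grouplike_nonzero: "g \<in> grouplike \<Longrightarrow> g \<noteq> \<bottom>\<^sub>Q"
  and grouplike_comult: "g \<in> grouplike \<Longrightarrow> (g, g) \<in> \<Delta>\<^sub>Q g"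
  by (simp_all add: grouplike_def)

lemma grouplike_atom:
  assumes "g \<in> grouplike" "nonzero x" "x \<sqsubseteq>\<^sub>Q g"
  shows "x = g"
  using comult_atom[of g g x] assms by (simp add: grouplike_def)

lemma grouplike_not_le_bottom: "g \<in> grouplike \<Longrightarrow> \<not> g \<sqsubseteq>\<^sub>Q \<bottom>\<^sub>Q"
  by (simp add: quotient_le_bottom_iff grouplike_closed grouplike_nonzero)

lemma le_iff_grouplike:
  assumes s: "s \<in> carrier \<Q>" and k: "k \<in> carrier \<Q>"
  shows "s \<sqsubseteq>\<^sub>Q k \<longleftrightarrow> (\<forall>g\<in>grouplike. g \<sqsubseteq>\<^sub>Q s \<longrightarrow> g \<sqsubseteq>\<^sub>Q k)"
proof
  show "\<forall>g\<in>grouplike. g \<sqsubseteq>\<^sub>Q s \<longrightarrow> g \<sqsubseteq>\<^sub>Q k" if "s \<sqsubseteq>\<^sub>Q k"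
    using quotient.le_trans[OF _ that] s k grouplike_closed by blast
next
  assume *: "\<forall>g\<in>grouplike. g \<sqsubseteq>\<^sub>Q s \<longrightarrow> g \<sqsubseteq>\<^sub>Q k"
  obtain a where a: "a \<in> carrier H" "s = \<pi> a" using s by (rule quotient_cases)
  have "a \<sqsubseteq> \<iota> k"
    unfolding counit_right_le_iff[OF a(1) incl_closed[OF k]]
  proof safe
    fix x y assume xy: "(x, y) \<in> \<Delta> a" "\<epsilon> y"
    note c = comult_terms[OF xy(1) a(1)]
    show "x \<sqsubseteq> \<iota> k"
    proof (cases "\<epsilon> x")
      case True
      have D: "(\<pi> x, \<pi> y) \<in> \<Delta>\<^sub>Q s" using proj_terms[OF a(1) xy(1)] a(2) by simp
      have nz: "\<pi> x \<noteq> \<bottom>\<^sub>Q" "\<pi> y \<noteq> \<bottom>\<^sub>Q" using xy True c by (simp_all add: proj_eq_bottom_iff)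
      have "\<pi> x \<sqsubseteq>\<^sub>Q k"
        using * comult_grouplike[OF s D nz] quotient_counit_terms(1)[OF s D nz(2)] by blast
      then show ?thesis using proj_le_iff[OF _ k] c by simp
    next
      case False
      then show ?thesis
        using counit_iff[of x] le_trans[OF _ kernel_le_incl[OF k] _ kernel_closed incl_closed[OF k], of x] c
        by simp
    qed
  qed
  then show "s \<sqsubseteq>\<^sub>Q k" using a proj_le_iff[OF a(1) k] by simp
qed

lemma grouplike_below:
  assumes "nonzero s"
  obtains g where "g \<in> grouplike" "g \<sqsubseteq>\<^sub>Q s"
  using le_iff_grouplike[of s "\<bottom>\<^sub>Q"] assms quotient_le_bottom_iff[of s] by auto

text \<open>
  The diagonal pairs \<open>(x, x)\<close> with \<open>x\<close> grouplike and below a member of \<open>A\<close>, together with the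
  pairs having a zero entry, form a bi-ideal, because grouplike elements are atoms. It contains
  \<open>\<Delta>(a)\<close> for all \<open>a\<close> in \<open>A\<close>, hence also the coproduct of their join, and thus \<open>(g, g)\<close>.
\<close>

lemma grouplike_prime:
  assumes g: "g \<in> grouplike" and A: "A \<subseteq> carrier \<Q>" and le: "g \<sqsubseteq>\<^sub>Q \<Squnion>\<^sub>Q A"
  shows "\<exists>a\<in>A. g \<sqsubseteq>\<^sub>Q a"
proof -
  let ?b = "\<bottom>\<^sub>Q"
  let ?P = "\<lambda>x y. x = ?b \<or> y = ?b \<or> x = y \<and> x \<in> grouplike \<and> (\<exists>a\<in>A. x \<sqsubseteq>\<^sub>Q a)"
  let ?J = "{(x, y) \<in> carrier \<Q> \<times> carrier \<Q>. ?P x y}"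
  have sup_le: "x \<sqsubseteq>\<^sub>Q \<Squnion>\<^sub>Q X" if "X \<subseteq> carrier \<Q>" "x \<in> X" for x X
    by (rule quotient.sup_upper[OF that])
  have Sup_atom: "?P (\<Squnion>\<^sub>Q X) y \<longleftrightarrow> (\<forall>x\<in>X. ?P x y)" if X: "X \<subseteq> carrier \<Q>" and y: "y \<in> carrier \<Q>" for X y
  proof (intro iffI ballI)
    fix x assume P: "?P (\<Squnion>\<^sub>Q X) y" and x: "x \<in> X"
    show "?P x y"
    proof (cases "x = ?b")
      case False
      have xc: "x \<in> carrier \<Q>" using X x by auto
      have "\<Squnion>\<^sub>Q X \<noteq> ?b" using sup_le[OF X x] False quotient_le_bottom_iff[OF xc] by metis
      moreover have "\<Squnion>\<^sub>Q X \<in> grouplike \<Longrightarrow> x = \<Squnion>\<^sub>Q X"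
        using grouplike_atom sup_le[OF X x] xc False by blast
      ultimately show ?thesis using P by metis
    qed simp
  next
    assume P: "\<forall>x\<in>X. ?P x y"
    show "?P (\<Squnion>\<^sub>Q X) y"
    proof (cases "y = ?b \<or> (\<forall>x\<in>X. x = ?b)")
      case True
      then have "y = ?b \<or> \<Squnion>\<^sub>Q X = ?b"
        using complete_lattice_sup_le_iff[OF quotient_lattice X quotient.bottom_closed] X
          quotient_le_bottom_iff[of "\<Squnion>\<^sub>Q X"] quotient.le_refl[OF quotient.bottom_closed] by auto
      then show ?thesis by blast
    next
      case False
      then obtain x where x: "x \<in> X" "x \<noteq> ?b" "y \<noteq> ?b" by blast
      have "x = y" "y \<in> grouplike" "\<exists>a\<in>A. y \<sqsubseteq>\<^sub>Q a" using bspec[OF P x(1)] x(2,3) by metis+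
      moreover have "\<Squnion>\<^sub>Q X \<sqsubseteq>\<^sub>Q y"
        unfolding complete_lattice_sup_le_iff[OF quotient_lattice X y]
      proof
        fix z assume "z \<in> X"
        then have "z = ?b \<or> z = y" using bspec[OF P] x(3) by metis
        then show "z \<sqsubseteq>\<^sub>Q y" using quotient.le_refl[OF y] quotient.bottom_lower[OF y] by metis
      qed
      ultimately have "\<Squnion>\<^sub>Q X = y"
        using quotient.le_antisym[of "\<Squnion>\<^sub>Q X" y] sup_le[OF X x(1)] X y by auto
      then show ?thesis using \<open>y \<in> grouplike\<close> \<open>\<exists>a\<in>A. y \<sqsubseteq>\<^sub>Q a\<close> by auto
    qed
  qed
  have sym: "?P x y \<longleftrightarrow> ?P y x" for x y by auto
  have J: "bi_ideal \<Q> \<Q> ?J"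
  proof (rule bi_idealI[OF quotient_lattice quotient_lattice Sup_atom])
    show "?P l (\<Squnion>\<^sub>Q B) \<longleftrightarrow> (\<forall>b\<in>B. ?P l b)" if "l \<in> carrier \<Q>" "B \<subseteq> carrier \<Q>" for l B
      unfolding sym[of l] by (rule Sup_atom[OF that(2,1)])
  qed
  have diag: "?P x y" if a: "a \<in> A" and xy: "(x, y) \<in> \<Delta>\<^sub>Q a" for a x y
  proof -
    have ac: "a \<in> carrier \<Q>" using a A by auto
    show ?thesis
    proof (cases "x = ?b \<or> y = ?b")
      case False
      then have "x = y" "x \<in> grouplike" "x \<sqsubseteq>\<^sub>Q a"
        using comult_diagonal[OF ac xy] comult_grouplike[OF ac xy] quotient_counit_terms(1)[OF ac xy] by auto
      then show ?thesis using a by (intro disjI2) auto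
    qed auto
  qed
  have sub: "\<Delta>\<^sub>Q a \<subseteq> ?J" if a: "a \<in> A" for a
  proof (rule subrelI)
    fix x y assume xy: "(x, y) \<in> \<Delta>\<^sub>Q a"
    have "a \<in> carrier \<Q>" using a A by auto
    then show "(x, y) \<in> ?J" using quotient_comult_terms[OF xy] diag[OF a xy] by simp
  qed
  have S: "\<Squnion>\<^sub>Q A \<in> carrier \<Q>" using A by simp
  have "\<Delta>\<^sub>Q g \<subseteq> \<Delta>\<^sub>Q (\<Squnion>\<^sub>Q A)"
    using sup_mor_mono[OF quotient_lattice quotient_tensor_lattice quotient_comult_mor grouplike_closed[OF g] S le]
    by (simp add: tensor_simps)
  moreover have "\<Delta>\<^sub>Q (\<Squnion>\<^sub>Q A) \<subseteq> ?J"
    using sup_mor_le_iff[OF quotient_tensor_lattice quotient_comult_mor A, of ?J] J sub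
    by (simp add: tensor_simps)
  ultimately have "(g, g) \<in> ?J" using grouplike_comult[OF g] by blast
  then show ?thesis using grouplike_nonzero[OF g] by auto
qed


section \<open>The remnant group and its characters\<close>

text \<open>
  The indicator function of the point \<open>g\<close> of the group, pulled back to \<open>H\<close>.
\<close>

definition char :: "'a set \<Rightarrow> 'a \<Rightarrow> bool"
  where "char g a \<longleftrightarrow> a \<in> carrier H \<and> g \<sqsubseteq>\<^sub>Q \<pi> a"

lemma grouplike_le_Sup_iff:
  assumes "g \<in> grouplike" "A \<subseteq> carrier \<Q>"
  shows "g \<sqsubseteq>\<^sub>Q \<Squnion>\<^sub>Q A \<longleftrightarrow> (\<exists>a\<in>A. g \<sqsubseteq>\<^sub>Q a)"
proof
  assume "\<exists>a\<in>A. g \<sqsubseteq>\<^sub>Q a"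
  then obtain a where a: "a \<in> A" "g \<sqsubseteq>\<^sub>Q a" by blast
  then show "g \<sqsubseteq>\<^sub>Q \<Squnion>\<^sub>Q A"
    using quotient.le_trans[OF a(2) quotient.sup_upper[OF assms(2) a(1)]] assms grouplike_closed by auto
qed (rule grouplike_prime[OF assms])

lemma char_functional:
  assumes g: "g \<in> grouplike"
  shows "char g \<in> functionals H UNIV"
  unfolding functionals_bool_iff sup_mor_unit_lat_iff
proof (intro conjI allI impI)
  fix A assume A: "A \<subseteq> carrier H"
  then have "\<pi> (\<Squnion> A) = \<Squnion>\<^sub>Q (\<pi> ` A)" "\<pi> ` A \<subseteq> carrier \<Q>"
    using proj_mor by (auto simp: sup_mor_def)
  then show "char g (\<Squnion> A) \<longleftrightarrow> (\<exists>a\<in>A. char g a)"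
    using A grouplike_le_Sup_iff[OF g] by (auto simp: char_def)
qed (simp add: char_def)

text \<open>
  The characters are orthogonal idempotents for convolution: coproducts in \<open>Q\<close> are diagonal, and a
  grouplike element below \<open>\<pi>(a)\<close> is, being join-prime, detected by a single term of \<open>\<Delta>(a)\<close>.
\<close>

lemma char_comult:
  assumes g: "g \<in> grouplike" and h: "h \<in> grouplike" and a: "a \<in> carrier H"
  shows "(\<exists>(x, y)\<in>\<Delta> a. char g x \<and> char h y) \<longleftrightarrow> g = h \<and> char g a"
proof (intro iffI)
  assume "\<exists>(x, y)\<in>\<Delta> a. char g x \<and> char h y"
  then obtain x y where xy: "(x, y) \<in> \<Delta> a" "g \<sqsubseteq>\<^sub>Q \<pi> x" "h \<sqsubseteq>\<^sub>Q \<pi> y"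
    by (auto simp: char_def)
  have pa: "\<pi> a \<in> carrier \<Q>" by (rule proj_closed[OF a])
  have D: "(g, h) \<in> \<Delta>\<^sub>Q (\<pi> a)"
    using bi_ideal_mono[OF quotient_lattice quotient_lattice quotient_comult_closed[OF pa]
        proj_terms[OF a xy(1)] grouplike_closed[OF g] grouplike_closed[OF h] xy(2,3)] .
  show "g = h \<and> char g a"
    using comult_diagonal[OF pa D] quotient_counit_terms(1)[OF pa D] grouplike_nonzero g h a
    by (simp add: char_def)
next
  assume gh: "g = h \<and> char g a"
  show "\<exists>(x, y)\<in>\<Delta> a. char g x \<and> char h y"
  proof (rule ccontr)
    assume no: "\<not> (\<exists>(x, y)\<in>\<Delta> a. char g x \<and> char h y)"
    let ?J = "{(p, q) \<in> carrier \<Q> \<times> carrier \<Q>. \<not> (g \<sqsubseteq>\<^sub>Q p \<and> g \<sqsubseteq>\<^sub>Q q)}"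
    have J: "bi_ideal \<Q> \<Q> ?J"
      by (rule bi_idealI[OF quotient_lattice quotient_lattice]) (auto simp: grouplike_le_Sup_iff[OF g])
    have "(\<pi> x, \<pi> y) \<in> ?J" if "(x, y) \<in> \<Delta> a" for x y
      using no that gh comult_terms[OF that a] by (auto simp: char_def proj_closed)
    then have "\<Delta>\<^sub>Q (\<pi> a) \<subseteq> ?J"
      unfolding quotient_comult_subset_iff[OF a J] by (intro ballI) (simp only: split_paired_all prod.case)
    moreover have "\<Delta>\<^sub>Q g \<subseteq> \<Delta>\<^sub>Q (\<pi> a)"
      using sup_mor_mono[OF quotient_lattice quotient_tensor_lattice quotient_comult_mor
          grouplike_closed[OF g] proj_closed[OF a]] conjunct2[OF gh]
      by (simp add: tensor_simps char_def)
    ultimately have "(g, g) \<in> ?J" using grouplike_comult[OF g] by blast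
    then show False using quotient.le_refl[OF grouplike_closed[OF g]] by simp
  qed
qed

lemma char_incl: "g \<in> grouplike \<Longrightarrow> char g (\<iota> g)"
  by (simp add: char_def incl_closed proj_incl grouplike_closed quotient.le_refl)

lemma char_incl_iff: "g \<in> grouplike \<Longrightarrow> h \<in> grouplike \<Longrightarrow> char g (\<iota> h) \<longleftrightarrow> g = h"
  using grouplike_atom[of h g] char_incl[of g]
  by (auto simp: char_def incl_closed proj_incl grouplike_closed grouplike_nonzero)

lemma grouplike_unit: "hunit \<Q> \<in> grouplike"
  by (simp add: grouplike_def quotient_comult_unit quotient_unit_closed quotient_unit_nonzero)

lemma grouplike_prod:
  assumes g: "g \<in> grouplike" and h: "h \<in> grouplike"
  shows "g \<cdot>\<^sub>Q h \<in> grouplike"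
proof -
  have ig: "\<iota> g \<in> carrier H" and ih: "\<iota> h \<in> carrier H" by (simp_all add: incl_closed grouplike_closed g h)
  obtain x y where xy: "(x, y) \<in> \<Delta> (\<iota> g)" "char g x" "char g y"
    using char_comult[OF g g ig] char_incl[OF g] by blast
  obtain x' y' where xy': "(x', y') \<in> \<Delta> (\<iota> h)" "char h x'" "char h y'"
    using char_comult[OF h h ih] char_incl[OF h] by blast
  have c: "g \<in> carrier \<Q>" "h \<in> carrier \<Q>" using grouplike_closed g h by auto
  have gh: "g \<cdot>\<^sub>Q h \<in> carrier \<Q>" using c by (rule quotient_prod_closed)
  have le: "g \<cdot>\<^sub>Q h \<sqsubseteq>\<^sub>Q \<pi> (u \<cdot> v)" if "char g u" "char h v" for u v
    using that c by (auto simp: char_def proj_mult proj_closed intro!: quotient_prod_mono)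
  have "(\<pi> (x \<cdot> x'), \<pi> (y \<cdot> y')) \<in> \<Delta>\<^sub>Q (\<pi> (\<iota> g \<cdot> \<iota> h))"
    by (rule proj_terms[OF hprod_closed[OF ig ih] mult_terms[OF ig ih xy(1) xy'(1)]])
  then have "(\<pi> (x \<cdot> x'), \<pi> (y \<cdot> y')) \<in> \<Delta>\<^sub>Q (g \<cdot>\<^sub>Q h)"
    using quotient_prod[OF c] by simp
  then have "(g \<cdot>\<^sub>Q h, g \<cdot>\<^sub>Q h) \<in> \<Delta>\<^sub>Q (g \<cdot>\<^sub>Q h)"
    using bi_ideal_mono[OF quotient_lattice quotient_lattice quotient_comult_closed[OF gh] _ gh gh]
      le[OF xy(2) xy'(2)] le[OF xy(3) xy'(3)] by blast
  then show ?thesis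
    using gh grouplike_nonzero[OF g] grouplike_nonzero[OF h]
    by (simp add: grouplike_def quotient_prod_eq_bottom_iff[OF c])
qed

text \<open>
  The inverse is found below \<open>S(g)\<close>: any grouplike \<open>k \<le> S(g)\<close> satisfies \<open>k g \<le> S(g) g = 1\<close>, and
  \<open>1\<close> is an atom. This avoids showing that \<open>S\<close> reverses coproducts.
\<close>

lemma grouplike_inverse:
  assumes g: "g \<in> grouplike"
  shows "\<exists>k\<in>grouplike. k \<cdot>\<^sub>Q g = hunit \<Q>"
proof -
  note c = grouplike_closed[OF g]
  have Sg: "nonzero (hantipode \<Q> g)"
    using grouplike_nonzero[OF g] by (simp add: quotient_antipode_closed quotient_antipode_eq_bottom_iff c)
  then obtain k where k: "k \<in> grouplike" "k \<sqsubseteq>\<^sub>Q hantipode \<Q> g" by (rule grouplike_below)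
  note kc = grouplike_closed[OF k(1)]
  have "k \<cdot>\<^sub>Q g \<sqsubseteq>\<^sub>Q hantipode \<Q> g \<cdot>\<^sub>Q g"
    by (rule quotient_prod_mono) (use kc c k Sg quotient.le_refl in auto)
  then have le: "k \<cdot>\<^sub>Q g \<sqsubseteq>\<^sub>Q hunit \<Q>"
    using antipode_inverse(2)[OF c grouplike_comult[OF g]] grouplike_nonzero[OF g] by simp
  have "k \<cdot>\<^sub>Q g = hunit \<Q>"
    by (rule quotient_unit_atom[OF _ le])
      (simp add: quotient_prod_closed quotient_prod_eq_bottom_iff kc c grouplike_nonzero g k(1))
  then show ?thesis using k(1) by blast
qed

lemma remnant_simps:
  "carrier (remnant H) = grouplike" "p \<otimes>\<^bsub>remnant H\<^esub> q = p \<cdot>\<^sub>Q q" "\<one>\<^bsub>remnant H\<^esub> = hunit \<Q>"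
proof -
  have "\<Delta>\<^sub>Q g = g \<odot>\<^bsub>\<Q>\<^esub> g \<longleftrightarrow> (g, g) \<in> \<Delta>\<^sub>Q g" if g: "nonzero g" for g
  proof
    assume "\<Delta>\<^sub>Q g = g \<odot>\<^bsub>\<Q>\<^esub> g"
    then show "(g, g) \<in> \<Delta>\<^sub>Q g"
      using bi_ideal_pure(2)[OF quotient_lattice quotient_lattice] g by (simp add: hpair_def)
  next
    assume gg: "(g, g) \<in> \<Delta>\<^sub>Q g"
    have G: "g \<in> grouplike" using g gg by (simp add: grouplike_def)
    have c: "g \<in> carrier \<Q>" using g by simp
    note P = bi_ideal_pure[OF quotient_lattice quotient_lattice c c]
    show "\<Delta>\<^sub>Q g = g \<odot>\<^bsub>\<Q>\<^esub> g"
      unfolding hpair_def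
    proof (rule equalityI)
      show "pure \<Q> \<Q> g g \<subseteq> \<Delta>\<^sub>Q g"
        using pure_subset_iff[OF quotient_lattice quotient_lattice quotient_comult_closed[OF c] c c] gg by simp
      show "\<Delta>\<^sub>Q g \<subseteq> pure \<Q> \<Q> g g"
      proof (rule subrelI)
        fix x y assume xy: "(x, y) \<in> \<Delta>\<^sub>Q g"
        note xyc = quotient_comult_terms[OF xy c]
        show "(x, y) \<in> pure \<Q> \<Q> g g"
        proof (cases "x = \<bottom>\<^sub>Q \<or> y = \<bottom>\<^sub>Q")
          case True
          then show ?thesis
            using bi_ideal_bot[OF quotient_lattice quotient_lattice P(1)] xyc by metis
        next
          case False
          have "x = g"
            by (rule grouplike_atom[OF G]) (use False xyc quotient_counit_terms(1)[OF c xy] in simp_all)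
          moreover have "y = g"
            by (rule grouplike_atom[OF G]) (use False xyc quotient_counit_terms(2)[OF c xy] in simp_all)
          ultimately show ?thesis using P(2) by simp
        qed
      qed
    qed
  qed
  then show "carrier (remnant H) = grouplike" by (auto simp: remnant_def Let_def grouplike_def)
qed (simp_all add: remnant_def Let_def)

lemma remnant_group: "group (remnant H)"
  by (rule groupI)
    (simp_all add: remnant_simps grouplike_prod grouplike_unit grouplike_closed quotient_prod_assoc
      quotient_prod_unit grouplike_inverse)

lemma quotient_eq_Sup_grouplike:
  assumes q: "q \<in> carrier \<Q>"
  shows "q = \<Squnion>\<^sub>Q {g \<in> grouplike. g \<sqsubseteq>\<^sub>Q q}"
proof (rule complete_lattice_eqI[OF quotient_lattice q])
  have sub: "{g \<in> grouplike. g \<sqsubseteq>\<^sub>Q q} \<subseteq> carrier \<Q>" by (auto intro: grouplike_closed)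
  then show "\<Squnion>\<^sub>Q {g \<in> grouplike. g \<sqsubseteq>\<^sub>Q q} \<in> carrier \<Q>" by (rule quotient.sup_closed)
  show "q \<sqsubseteq>\<^sub>Q k \<longleftrightarrow> \<Squnion>\<^sub>Q {g \<in> grouplike. g \<sqsubseteq>\<^sub>Q q} \<sqsubseteq>\<^sub>Q k" if k: "k \<in> carrier \<Q>" for k
    unfolding le_iff_grouplike[OF q k] complete_lattice_sup_le_iff[OF quotient_lattice sub k] by blast
qed

lemma quotient_prod_Sup:
  assumes "A \<subseteq> carrier \<Q>" "q \<in> carrier \<Q>"
  shows "(\<Squnion>\<^sub>Q A) \<cdot>\<^sub>Q q = \<Squnion>\<^sub>Q ((\<lambda>p. p \<cdot>\<^sub>Q q) ` A)"
    and "q \<cdot>\<^sub>Q (\<Squnion>\<^sub>Q A) = \<Squnion>\<^sub>Q ((\<lambda>p. q \<cdot>\<^sub>Q p) ` A)"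
  using quotient_prod_bimor' assms by (simp_all add: sup_bimor_def sup_mor_def)

lemma char_mult:
  assumes z: "z \<in> grouplike" and a: "a \<in> carrier H" and b: "b \<in> carrier H"
  shows "char z (a \<cdot> b) \<longleftrightarrow> (\<exists>x\<in>grouplike. \<exists>y\<in>grouplike. x \<cdot>\<^sub>Q y = z \<and> char x a \<and> char y b)"
proof
  assume "\<exists>x\<in>grouplike. \<exists>y\<in>grouplike. x \<cdot>\<^sub>Q y = z \<and> char x a \<and> char y b"
  then show "char z (a \<cdot> b)"
    using a b by (auto simp: char_def hprod_closed proj_mult grouplike_closed proj_closed intro!: quotient_prod_mono)
next
  assume "char z (a \<cdot> b)"
  then have le: "z \<sqsubseteq>\<^sub>Q \<pi> a \<cdot>\<^sub>Q \<pi> b" using a b by (simp add: char_def proj_mult)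
  let ?X = "{g \<in> grouplike. g \<sqsubseteq>\<^sub>Q \<pi> a}" and ?Y = "{g \<in> grouplike. g \<sqsubseteq>\<^sub>Q \<pi> b}"
  have pa: "\<pi> a \<in> carrier \<Q>" and pb: "\<pi> b \<in> carrier \<Q>" using a b by (simp_all add: proj_closed)
  have X: "?X \<subseteq> carrier \<Q>" and Y: "?Y \<subseteq> carrier \<Q>" by (auto intro: grouplike_closed)
  have "\<pi> a \<cdot>\<^sub>Q \<pi> b = \<Squnion>\<^sub>Q ((\<lambda>x. x \<cdot>\<^sub>Q \<pi> b) ` ?X)"
    by (rule HOL.trans[OF arg_cong[OF quotient_eq_Sup_grouplike[OF pa], of "\<lambda>p. p \<cdot>\<^sub>Q \<pi> b"]
          quotient_prod_Sup(1)[OF X pb]])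
  then obtain x where x: "x \<in> ?X" "z \<sqsubseteq>\<^sub>Q x \<cdot>\<^sub>Q \<pi> b"
    using grouplike_prime[OF z, of "(\<lambda>x. x \<cdot>\<^sub>Q \<pi> b) ` ?X"] le X pb quotient_prod_closed
    by (auto simp: image_subset_iff grouplike_closed)
  have xc: "x \<in> carrier \<Q>" using x X by auto
  have "x \<cdot>\<^sub>Q \<pi> b = \<Squnion>\<^sub>Q ((\<lambda>y. x \<cdot>\<^sub>Q y) ` ?Y)"
    by (rule HOL.trans[OF arg_cong[OF quotient_eq_Sup_grouplike[OF pb], of "\<lambda>p. x \<cdot>\<^sub>Q p"]
          quotient_prod_Sup(2)[OF Y xc]])
  then obtain y where y: "y \<in> ?Y" "z \<sqsubseteq>\<^sub>Q x \<cdot>\<^sub>Q y"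
    using grouplike_prime[OF z, of "(\<lambda>y. x \<cdot>\<^sub>Q y) ` ?Y"] x(2) Y xc quotient_prod_closed
    by (auto simp: image_subset_iff grouplike_closed)
  have "z = x \<cdot>\<^sub>Q y"
    using grouplike_atom[OF grouplike_prod _ y(2)] x y grouplike_closed[OF z] grouplike_nonzero[OF z] by simp
  then show "\<exists>x\<in>grouplike. \<exists>y\<in>grouplike. x \<cdot>\<^sub>Q y = z \<and> char x a \<and> char y b"
    using x y a b by (auto simp: char_def)
qed

lemma counit_iff_char:
  assumes "a \<in> carrier H"
  shows "\<epsilon> a \<longleftrightarrow> (\<exists>g\<in>grouplike. char g a)"
proof
  assume "\<epsilon> a"
  then have "nonzero (\<pi> a)" using assms by (simp add: proj_closed proj_eq_bottom_iff)
  then show "\<exists>g\<in>grouplike. char g a" using grouplike_below[of "\<pi> a"] assms by (auto simp: char_def)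
next
  assume "\<exists>g\<in>grouplike. char g a"
  then have "\<pi> a \<noteq> \<bottom>\<^sub>Q" using grouplike_not_le_bottom by (auto simp: char_def)
  then show "\<epsilon> a" using assms by (simp add: proj_eq_bottom_iff)
qed

text \<open>
  A functional that annihilates the kernel is a functional on \<open>Q\<close>, which is generated by its
  grouplike elements; so it is the join of the characters of the points at which it holds.
\<close>

lemma functional_char:
  assumes \<phi>: "\<phi> \<in> functionals H UNIV" and D: "\<not> \<phi> \<D>" and a: "a \<in> carrier H"
  shows "\<phi> a \<longleftrightarrow> (\<exists>g\<in>grouplike. char g a \<and> \<phi> (\<iota> g))"
proof -
  have f: "\<phi> \<in> sup_mor H unit_lat" using \<phi> by (simp add: functionals_bool_iff)
  interpret U: complete_lattice unit_lat by (rule unit_lat_complete_lattice)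
  have "\<bottom>\<^bsub>unit_lat\<^esub> = False"
    using bottom_eq_sup_empty[OF unit_lat_complete_lattice] by (simp add: Sup_unit_lat)
  then have D': "\<phi> \<D> = \<bottom>\<^bsub>unit_lat\<^esub>" using D by simp
  note d = descend[OF unit_lat_complete_lattice f D']
  let ?X = "{g \<in> grouplike. g \<sqsubseteq>\<^sub>Q \<pi> a}"
  have X: "?X \<subseteq> carrier \<Q>" by (auto intro: grouplike_closed)
  have "\<phi> a \<longleftrightarrow> \<phi> (\<iota> (\<Squnion>\<^sub>Q ?X))"
    using d(1)[OF a] quotient_eq_Sup_grouplike[OF proj_closed[OF a]] by simp
  also have "\<dots> \<longleftrightarrow> (\<exists>g\<in>?X. \<phi> (\<iota> g))"
    using d(2) X unfolding sup_mor_unit_lat_iff by blast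
  finally show ?thesis using a by (auto simp: char_def)
qed

end


section \<open>Conjugation in a quantale\<close>

context quantale
begin

definition conjugate :: "'b \<Rightarrow> 'b \<Rightarrow> 'b \<Rightarrow> 'b"
  where "conjugate u v a = u \<bullet> a \<bullet> v"

lemma conjugate_closed: "u \<in> A \<Longrightarrow> v \<in> A \<Longrightarrow> a \<in> A \<Longrightarrow> conjugate u v a \<in> A"
  by (simp add: conjugate_def mult_closed)

lemma conjugate_one: "u \<in> A \<Longrightarrow> v \<in> A \<Longrightarrow> u \<bullet> v = one \<Longrightarrow> conjugate u v one = one"
  by (simp add: conjugate_def one_right)

lemma conjugate_mult:
  assumes "u \<in> A" "v \<in> A" "a \<in> A" "b \<in> A" "v \<bullet> u = one"
  shows "conjugate u v a \<bullet> conjugate u v b = conjugate u v (a \<bullet> b)"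
proof -
  have "v \<bullet> (u \<bullet> c) = c" if "c \<in> A" for c
    using assoc[of v u c] assms that by (simp add: one_left)
  then show ?thesis using assms by (simp add: conjugate_def assoc mult_closed)
qed

lemma conjugate_mono:
  assumes "u \<in> A" "v \<in> A" "a \<in> A" "b \<in> A" "a \<le> b"
  shows "conjugate u v a \<le> conjugate u v b"
  unfolding conjugate_def using assms by (intro mult_mono mult_closed) auto

lemma conjugate_Sup:
  assumes "u \<in> A" "v \<in> A" "X \<subseteq> A"
  shows "conjugate u v (Sup X) = Sup (conjugate u v ` X)"
proof -
  have "(\<bullet>) u ` X \<subseteq> A" using assms by (auto simp: mult_closed)
  then show ?thesis
    using assms by (simp add: conjugate_def[abs_def] mult_Sup Sup_mult image_image)
qed

text \<open>
  The algebra common to both hexagon laws. \<open>P\<close> and \<open>N\<close> are two legs of \<open>\<R>\<close> with inverses \<open>P'\<close>,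
  \<open>N'\<close>; \<open>X\<close> concerns a variable on which \<open>N\<close> does not act, and \<open>T\<close> one on which \<open>P\<close> does not act.
  The inner conjugation by \<open>N\<close> passes \<open>X\<close>, and the outer one by \<open>P\<close> passes \<open>T\<close>.
\<close>

lemma conjugate_step:
  assumes A: "P \<in> A" "P' \<in> A" "N \<in> A" "N' \<in> A" "C \<in> A" "E \<in> A" "X \<in> A" "F \<in> A" "T \<in> A" "G \<in> A"
    and X: "X \<bullet> N' = N' \<bullet> X" and T: "T \<bullet> P = P \<bullet> T"
    and EX: "E \<bullet> X \<le> C" and F: "F \<le> conjugate N N' E" and FX: "F \<bullet> X = T \<bullet> G"
  shows "T \<bullet> conjugate P P' G \<le> conjugate (P \<bullet> N) (N' \<bullet> P') C"
proof -
  have "T \<bullet> conjugate P P' G = P \<bullet> (F \<bullet> X) \<bullet> P'"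
    using T A FX by (simp add: conjugate_def) (metis assoc mult_closed)
  also have "\<dots> \<le> P \<bullet> (conjugate N N' E \<bullet> X) \<bullet> P'"
    using A F by (intro mult_mono mult_closed conjugate_closed) auto
  also have "conjugate N N' E \<bullet> X = conjugate N N' (E \<bullet> X)"
    using A X by (simp add: conjugate_def assoc mult_closed)
  also have "P \<bullet> conjugate N N' (E \<bullet> X) \<bullet> P' \<le> P \<bullet> conjugate N N' C \<bullet> P'"
    using A EX by (intro mult_mono mult_closed conjugate_closed conjugate_mono) auto
  also have "\<dots> = conjugate (P \<bullet> N) (N' \<bullet> P') C"
    using A by (simp add: conjugate_def assoc mult_closed)
  finally show ?thesis .
qed

end

lemma (in quantale_hom) conjugate:
  assumes "u \<in> A" "v \<in> A" "a \<in> A"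
  shows "f (Q.conjugate u v a) = Q'.conjugate (f u) (f v) (f a)"
  using assms by (simp add: Q.conjugate_def Q'.conjugate_def mult Q.mult_closed)


section \<open>The braiding of the characters\<close>

context co_quasitriangular
begin

abbreviation A1 :: "('a \<Rightarrow> bool) set" where "A1 \<equiv> functionals H UNIV"
abbreviation A2 :: "('a \<Rightarrow> 'a \<Rightarrow> bool) set" where "A2 \<equiv> functionals H A1"
abbreviation A3 :: "('a \<Rightarrow> 'a \<Rightarrow> 'a \<Rightarrow> bool) set" where "A3 \<equiv> functionals H A2"

abbreviation mult1 (infixl \<open>\<star>\<^sub>1\<close> 70) where "mult1 \<equiv> conv (\<and>)"
abbreviation mult2 (infixl \<open>\<star>\<^sub>2\<close> 70) where "mult2 \<equiv> conv mult1"
abbreviation mult3 (infixl \<open>\<star>\<^sub>3\<close> 70) where "mult3 \<equiv> conv mult2"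

abbreviation one1 :: "'a \<Rightarrow> bool" where "one1 \<equiv> const_functional True"
abbreviation one2 :: "'a \<Rightarrow> 'a \<Rightarrow> bool" where "one2 \<equiv> const_functional one1"
abbreviation one3 :: "'a \<Rightarrow> 'a \<Rightarrow> 'a \<Rightarrow> bool" where "one3 \<equiv> const_functional one2"

sublocale Q1: quantale A1 mult1 one1
  by (rule quantale_functionals[OF quantale_bool])

sublocale Q2: quantale A2 mult2 one2
  by (rule quantale_functionals[OF Q1.quantale_axioms])

sublocale Q3: quantale A3 mult3 one3
  by (rule quantale_functionals[OF Q2.quantale_axioms])

lemma one2_iff: "one2 a b \<longleftrightarrow> a \<in> carrier H \<and> b \<in> carrier H \<and> \<epsilon> a \<and> \<epsilon> b"
  by (auto simp: const_functional_def)

lemma mult1_iff: "(\<phi> \<star>\<^sub>1 \<psi>) a \<longleftrightarrow> a \<in> carrier H \<and> (\<exists>(x, y)\<in>\<Delta> a. \<phi> x \<and> \<psi> y)"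
  by (simp add: conv_def terms_Sup_bool)

lemma mult2_iff:
  "(\<phi> \<star>\<^sub>2 \<psi>) a b \<longleftrightarrow> a \<in> carrier H \<and> b \<in> carrier H \<and>
    (\<exists>(x, y)\<in>\<Delta> a. \<exists>(x', y')\<in>\<Delta> b. \<phi> x x' \<and> \<psi> y y')"
  by (auto simp: conv_def terms_Sup_apply terms_Sup_bool)

lemma A2I:
  assumes "\<And>b. b \<in> carrier H \<Longrightarrow> (\<lambda>a. \<phi> a b) \<in> sup_mor H unit_lat"
    and "\<And>a. a \<in> carrier H \<Longrightarrow> \<phi> a \<in> sup_mor H unit_lat"
    and out: "\<And>a b. a \<notin> carrier H \<or> b \<notin> carrier H \<Longrightarrow> \<not> \<phi> a b"
  shows "\<phi> \<in> A2"
proof (rule functionalsI)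
  show "\<phi> a \<in> A1" if "a \<in> carrier H" for a
    using assms(2)[OF that] out by (simp add: functionals_bool_iff)
  show "\<phi> a = bot" if "a \<notin> carrier H" for a using out that by (auto simp: fun_eq_iff)
  show "\<phi> (\<Squnion> X) = Sup (\<phi> ` X)" if "X \<subseteq> carrier H" for X
  proof
    fix b
    show "\<phi> (\<Squnion> X) b = Sup (\<phi> ` X) b"
      using assms(1)[of b] out that unfolding sup_mor_unit_lat_iff
      by (cases "b \<in> carrier H") auto
  qed
qed

lemma A2_guardI:
  assumes "\<And>b. b \<in> carrier H \<Longrightarrow> (\<lambda>a. P a b) \<in> sup_mor H unit_lat"
    and "\<And>a. a \<in> carrier H \<Longrightarrow> P a \<in> sup_mor H unit_lat"
  shows "(\<lambda>a b. a \<in> carrier H \<and> b \<in> carrier H \<and> P a b) \<in> A2"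
proof (rule A2I)
  have guard: "(\<lambda>a. a \<in> carrier H \<and> Q a) \<in> sup_mor H unit_lat" if "Q \<in> sup_mor H unit_lat" for Q
    using that unfolding sup_mor_unit_lat_iff by (auto simp: subset_iff)
  show "(\<lambda>a. a \<in> carrier H \<and> b \<in> carrier H \<and> P a b) \<in> sup_mor H unit_lat" if "b \<in> carrier H" for b
    using guard[OF assms(1)[OF that]] that by simp
  show "(\<lambda>b. a \<in> carrier H \<and> b \<in> carrier H \<and> P a b) \<in> sup_mor H unit_lat" if "a \<in> carrier H" for a
    using guard[OF assms(2)[OF that]] that by simp
qed auto

lemma A2_D:
  assumes "\<phi> \<in> A2"
  shows "b \<in> carrier H \<Longrightarrow> (\<lambda>a. \<phi> a b) \<in> A1" "\<phi> a b \<Longrightarrow> a \<in> carrier H" "\<phi> a b \<Longrightarrow> b \<in> carrier H"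
proof -
  show a: "a \<in> carrier H" if "\<phi> a b" for a b
    using functionals_outside[OF assms, of a] that by (cases "a \<in> carrier H") auto
  show "b \<in> carrier H" if "\<phi> a b" for a b
    using functionals_outside[OF functionals_closed[OF assms a[OF that]], of b] that by auto
  show "(\<lambda>a. \<phi> a b) \<in> A1" if "b \<in> carrier H"
    unfolding functionals_bool_iff sup_mor_unit_lat_iff
    using functionals_Sup[OF assms] a by auto
qed

definition Rf :: "'a \<Rightarrow> 'a \<Rightarrow> bool"
  where "Rf a b \<longleftrightarrow> a \<in> carrier H \<and> b \<in> carrier H \<and> R (a \<odot> b)"

definition Rf' :: "'a \<Rightarrow> 'a \<Rightarrow> bool"
  where "Rf' a b \<longleftrightarrow> a \<in> carrier H \<and> b \<in> carrier H \<and> Rinv (a \<odot> b)"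

lemma pairing_A2:
  assumes P: "P \<in> sup_mor (tensor H H) unit_lat"
  shows "(\<lambda>a b. a \<in> carrier H \<and> b \<in> carrier H \<and> P (a \<odot> b)) \<in> A2"
proof -
  have p: "sup_bimor H H (tensor H H) (pure H H)" by (rule pure_bimor[OF lattice lattice])
  have 1: "(\<lambda>a. P (a \<odot> b)) \<in> sup_mor H unit_lat" if "b \<in> carrier H" for b
    unfolding hpair_def
    by (rule sup_mor_comp[OF _ P]) (use p that in \<open>simp add: sup_bimor_def\<close>)
  have 2: "(\<lambda>b. P (a \<odot> b)) \<in> sup_mor H unit_lat" if "a \<in> carrier H" for a
    unfolding hpair_def
    by (rule sup_mor_comp[OF _ P]) (use p that in \<open>simp add: sup_bimor_def\<close>)
  show ?thesis
    by (rule A2_guardI[OF 1 2])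
qed

lemma Rf_A2: "Rf \<in> A2"
  using pairing_A2[OF R_mor] by (simp add: Rf_def[abs_def])

lemma Rf'_A2: "Rf' \<in> A2"
  using pairing_A2[OF Rinv_mor] by (simp add: Rf'_def[abs_def])

lemma Rf_inverse: "Rf \<star>\<^sub>2 Rf' = one2" "Rf' \<star>\<^sub>2 Rf = one2"
proof -
  have "(Rf \<star>\<^sub>2 Rf') a b = one2 a b \<and> (Rf' \<star>\<^sub>2 Rf) a b = one2 a b" for a b
  proof (cases "a \<in> carrier H \<and> b \<in> carrier H")
    case True
    then have c: "a \<in> carrier H" "b \<in> carrier H" by auto
    note t = comult_terms[OF _ c(1)] comult_terms[OF _ c(2)]
    have "(\<exists>(x, y)\<in>\<Delta> a. \<exists>(x', y')\<in>\<Delta> b. Rf x x' \<and> Rf' y y') \<longleftrightarrow>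
      (\<exists>(x, y)\<in>\<Delta> a. \<exists>(x', y')\<in>\<Delta> b. R (x \<odot> x') \<and> Rinv (y \<odot> y'))"
      unfolding Rf_def Rf'_def using t by (fast intro: bexI)
    moreover have "(\<exists>(x, y)\<in>\<Delta> a. \<exists>(x', y')\<in>\<Delta> b. Rf' x x' \<and> Rf y y') \<longleftrightarrow>
      (\<exists>(x, y)\<in>\<Delta> a. \<exists>(x', y')\<in>\<Delta> b. Rinv (x \<odot> x') \<and> R (y \<odot> y'))"
      unfolding Rf_def Rf'_def using t by (fast intro: bexI)
    ultimately show ?thesis
      using R_Rinv[OF c] Rinv_R[OF c] c unfolding ext_unit_lat by (simp add: mult2_iff one2_iff)
  qed (auto simp: mult2_iff one2_iff)
  then show "Rf \<star>\<^sub>2 Rf' = one2" "Rf' \<star>\<^sub>2 Rf = one2" by (auto simp: fun_eq_iff)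
qed

abbreviation ad :: "('a \<Rightarrow> 'a \<Rightarrow> bool) \<Rightarrow> 'a \<Rightarrow> 'a \<Rightarrow> bool"
  where "ad \<equiv> Q2.conjugate Rf Rf'"

lemma ad_closed: "\<phi> \<in> A2 \<Longrightarrow> ad \<phi> \<in> A2"
  by (rule Q2.conjugate_closed[OF Rf_A2 Rf'_A2])

definition char2 :: "'a set \<Rightarrow> 'a set \<Rightarrow> 'a \<Rightarrow> 'a \<Rightarrow> bool"
  where "char2 x y a b \<longleftrightarrow> char x a \<and> char y b"

lemma char_carrier: "char g a \<Longrightarrow> a \<in> carrier H"
  by (simp add: char_def)

lemma char2_A2:
  assumes "x \<in> grouplike" "y \<in> grouplike"
  shows "char2 x y \<in> A2"
  using char_functional[OF assms(1)] char_functional[OF assms(2)]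
  by (intro A2I) (auto simp: char2_def functionals_bool_iff sup_mor_unit_lat_iff)

lemma char2_mult:
  assumes "x \<in> grouplike" "y \<in> grouplike" "x' \<in> grouplike" "y' \<in> grouplike"
  shows "char2 x y \<star>\<^sub>2 char2 x' y' = (if x = x' \<and> y = y' then char2 x y else bot)"
proof (intro ext)
  fix a b
  have "(char2 x y \<star>\<^sub>2 char2 x' y') a b \<longleftrightarrow> a \<in> carrier H \<and> b \<in> carrier H \<and>
    (\<exists>(u, v)\<in>\<Delta> a. char x u \<and> char x' v) \<and> (\<exists>(u, v)\<in>\<Delta> b. char y u \<and> char y' v)"
    unfolding mult2_iff char2_def by fast
  also have "\<dots> \<longleftrightarrow> x = x' \<and> y = y' \<and> char2 x y a b"
    using char_comult[of x x' a] char_comult[of y y' b] assms char_carrier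
    unfolding char2_def by metis
  finally show "(char2 x y \<star>\<^sub>2 char2 x' y') a b = (if x = x' \<and> y = y' then char2 x y else bot) a b"
    by auto
qed

lemma one2_eq_Sup: "one2 = Sup ((\<lambda>p. char2 (fst p) (snd p)) ` (grouplike \<times> grouplike))"
proof (intro ext)
  fix a b
  have "one2 a b \<longleftrightarrow> (\<exists>x\<in>grouplike. \<exists>y\<in>grouplike. char2 x y a b)"
    unfolding one2_iff char2_def
    using counit_iff_char[of a] counit_iff_char[of b] char_carrier[of _ a] char_carrier[of _ b] by blast
  then show "one2 a b = Sup ((\<lambda>p. char2 (fst p) (snd p)) ` (grouplike \<times> grouplike)) a b"
    by simp
qed

text \<open>
  A functional below \<open>\<epsilon> \<otimes> \<epsilon>\<close> vanishes when one of its arguments lies in the kernel, so it is determined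
  by its values at pairs of grouplike elements.
\<close>

lemma below_one2:
  assumes \<phi>: "\<phi> \<in> A2" and le: "\<phi> \<le> one2" and a: "a \<in> carrier H" and b: "b \<in> carrier H"
  shows "\<phi> a b \<longleftrightarrow> (\<exists>g\<in>grouplike. \<exists>h\<in>grouplike. char2 g h a b \<and> \<phi> (\<iota> g) (\<iota> h))"
proof -
  have D: "\<not> \<phi> \<D> b" "\<not> \<phi> x \<D>" for x b
    using le counit_kernel one2_iff by (auto dest!: le_funD)
  have "\<phi> a b \<longleftrightarrow> (\<exists>g\<in>grouplike. char g a \<and> \<phi> (\<iota> g) b)"
    by (rule functional_char[OF A2_D(1)[OF \<phi> b] D(1) a])
  also have "\<dots> \<longleftrightarrow> (\<exists>g\<in>grouplike. char g a \<and> (\<exists>h\<in>grouplike. char h b \<and> \<phi> (\<iota> g) (\<iota> h)))"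
    using functional_char[OF functionals_closed[OF \<phi>] D(2) b] incl_closed[OF grouplike_closed] by blast
  finally show ?thesis by (auto simp: char2_def)
qed

lemma ad_below_one2:
  assumes "\<phi> \<in> A2" "\<phi> \<le> one2"
  shows "ad \<phi> \<le> one2"
  using Q2.conjugate_mono[OF Rf_A2 Rf'_A2 assms(1) Q2.one_closed assms(2)]
    Q2.conjugate_one[OF Rf_A2 Rf'_A2 Rf_inverse(1)] by simp

lemma char2_below_one2: "x \<in> grouplike \<Longrightarrow> y \<in> grouplike \<Longrightarrow> char2 x y \<le> one2"
  unfolding one2_eq_Sup by (rule Sup_upper) force

text \<open>
  The relation that \<open>r(g, h) = (y, x)\<close>. The order of \<open>x\<close> and \<open>y\<close> is reversed on the two sides because
  the braiding flips the tensor factors.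
\<close>

definition braids :: "'a set \<Rightarrow> 'a set \<Rightarrow> 'a set \<Rightarrow> 'a set \<Rightarrow> bool"
  where "braids g h y x \<longleftrightarrow> ad (char2 x y) (\<iota> g) (\<iota> h)"

lemma braids_iff_le:
  assumes G: "g \<in> grouplike" "h \<in> grouplike" "x \<in> grouplike" "y \<in> grouplike"
  shows "braids g h y x \<longleftrightarrow> char2 g h \<le> ad (char2 x y)"
proof
  note ad = ad_closed[OF char2_A2[OF G(3,4)]]
  have le: "ad (char2 x y) \<le> one2" by (rule ad_below_one2[OF char2_A2 char2_below_one2]) (rule G)+
  show "char2 g h \<le> ad (char2 x y)" if "braids g h y x"
  proof (intro le_funI le_boolI)
    fix a b assume ab: "char2 g h a b"
    then have c: "a \<in> carrier H" "b \<in> carrier H" by (auto simp: char2_def char_carrier)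
    show "ad (char2 x y) a b"
      using below_one2[OF ad le c] ab that G unfolding braids_def by blast
  qed
  show "braids g h y x" if "char2 g h \<le> ad (char2 x y)"
    using that char_incl[OF G(1)] char_incl[OF G(2)] by (auto simp: braids_def char2_def dest!: le_funD)
qed

lemma ad_Sup_char2:
  assumes "X \<subseteq> grouplike \<times> grouplike"
  shows "ad (Sup ((\<lambda>p. char2 (fst p) (snd p)) ` X)) (\<iota> g) (\<iota> h) \<longleftrightarrow>
    (\<exists>p\<in>X. braids g h (snd p) (fst p))"
proof -
  have "(\<lambda>p. char2 (fst p) (snd p)) ` X \<subseteq> A2" using assms char2_A2 by auto
  then have "ad (Sup ((\<lambda>p. char2 (fst p) (snd p)) ` X)) = Sup (ad ` (\<lambda>p. char2 (fst p) (snd p)) ` X)"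
    by (rule Q2.conjugate_Sup[OF Rf_A2 Rf'_A2])
  then show ?thesis by (simp add: braids_def image_image)
qed

text \<open>
  Conjugation fixes the unit, which is the join of the \<open>char2 x y\<close>, so one of the conjugates holds at any
  given pair.
\<close>

lemma braids_exists:
  assumes "g \<in> grouplike" "h \<in> grouplike"
  shows "\<exists>x\<in>grouplike. \<exists>y\<in>grouplike. braids g h y x"
proof -
  have "one2 (\<iota> g) (\<iota> h)"
    using assms char_incl counit_iff_char by (auto simp: one2_iff incl_closed grouplike_closed)
  then have "ad one2 (\<iota> g) (\<iota> h)"
    using Q2.conjugate_one[OF Rf_A2 Rf'_A2 Rf_inverse(1)] by simp
  then show ?thesis using ad_Sup_char2[of "grouplike \<times> grouplike" g h] unfolding one2_eq_Sup by auto
qed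

text \<open>
  If both conjugates dominate \<open>char2 g h\<close>, then so does their product, because \<open>char2 g h\<close> is
  idempotent; but conjugates of orthogonal idempotents have product zero.
\<close>

lemma braids_unique:
  assumes G: "g \<in> grouplike" "h \<in> grouplike" "x \<in> grouplike" "y \<in> grouplike"
      "x' \<in> grouplike" "y' \<in> grouplike"
    and b: "braids g h y x" "braids g h y' x'"
  shows "x = x' \<and> y = y'"
proof (rule ccontr)
  assume neg: "\<not> (x = x' \<and> y = y')"
  have "char2 x y \<star>\<^sub>2 char2 x' y' = bot" unfolding char2_mult[OF G(3-6)] using neg by (rule if_not_P)
  then have "ad (char2 x y) \<star>\<^sub>2 ad (char2 x' y') = ad bot"
    using Q2.conjugate_mult[OF Rf_A2 Rf'_A2 char2_A2[OF G(3,4)] char2_A2[OF G(5,6)] Rf_inverse(2)] by simp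
  also have "\<dots> = bot"
    using Q2.mult_bot[OF Rf_A2] Q2.bot_mult[OF Rf'_A2] by (simp add: Q2.conjugate_def)
  finally have "ad (char2 x y) \<star>\<^sub>2 ad (char2 x' y') = bot" .
  moreover have "char2 g h \<star>\<^sub>2 char2 g h \<le> ad (char2 x y) \<star>\<^sub>2 ad (char2 x' y')"
    using b braids_iff_le G by (intro Q2.mult_mono ad_closed char2_A2) auto
  ultimately have "char2 g h \<le> bot" using char2_mult[OF G(1,2,1,2)] by simp
  then show False using char_incl[OF G(1)] char_incl[OF G(2)] by (auto simp: char2_def dest!: le_funD)
qed

lemma functional_ext:
  assumes \<chi>: "\<chi> \<in> A1" and \<beta>: "\<And>u v. (u, v) \<in> x \<Longrightarrow> \<beta> u v \<in> carrier H"
  shows "\<chi> (ext H \<beta> x) \<longleftrightarrow> (\<exists>(u, v)\<in>x. \<chi> (\<beta> u v))"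
proof -
  have "(\<lambda>(u, v). \<beta> u v) ` x \<subseteq> carrier H" using \<beta> by auto
  then show ?thesis unfolding ext_def using functionals_Sup[OF \<chi>] by (auto simp: case_prod_unfold)
qed

lemma functional_scale:
  assumes "\<chi> \<in> A1"
  shows "\<chi> (scale H t a) \<longleftrightarrow> t \<and> \<chi> a"
  using functionals_Sup[OF assms, of "{}"] bottom_eq_sup_empty[OF lattice] by (simp add: scale_def)

lemma mult_pullback_A2: "\<chi> \<in> A1 \<Longrightarrow> mult_pullback \<chi> \<in> A2"
  by (rule quantale_hom.closed[OF quantale_hom_mult_pullback[OF quantale_bool]])

text \<open>
  The commutation axiom of \<open>\<R>\<close>, evaluated at \<open>\<chi>\<close>, reads \<open>\<R> M' = M \<R>\<close> for the functionals
  \<open>M' = \<chi>(b.a)\<close> and \<open>M = \<chi>(a.b)\<close>.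
\<close>

lemma ad_flip_mult_pullback:
  assumes \<chi>: "\<chi> \<in> A1"
  shows "ad (\<lambda>a b. mult_pullback \<chi> b a) = mult_pullback \<chi>"
proof -
  let ?M = "mult_pullback \<chi>" and ?M' = "\<lambda>a b. mult_pullback \<chi> b a"
  note MA = mult_pullback_A2[OF \<chi>]
  have M_iff: "?M u v \<longleftrightarrow> u \<in> carrier H \<and> v \<in> carrier H \<and> \<chi> (u \<cdot> v)" for u v
    by (auto simp: mult_pullback_def)
  have "(Rf \<star>\<^sub>2 ?M') b a = (?M \<star>\<^sub>2 Rf) b a" for b a
  proof (cases "a \<in> carrier H \<and> b \<in> carrier H")
    case True
    then have a: "a \<in> carrier H" and b: "b \<in> carrier H" by auto
    note t = comult_terms[OF _ a] comult_terms[OF _ b]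
    have sweedler: "\<chi> (ext H (\<lambda>a1 a2. ext H (\<lambda>b1 b2. scale H (s a1 a2 b1 b2) (m a1 a2 b1 b2)) (\<Delta> b)) (\<Delta> a))
      \<longleftrightarrow> (\<exists>(a1, a2)\<in>\<Delta> a. \<exists>(b1, b2)\<in>\<Delta> b. s a1 a2 b1 b2 \<and> \<chi> (m a1 a2 b1 b2))"
      if m: "\<And>a1 a2 b1 b2. (a1, a2) \<in> \<Delta> a \<Longrightarrow> (b1, b2) \<in> \<Delta> b \<Longrightarrow> m a1 a2 b1 b2 \<in> carrier H" for s m
    proof -
      have sc: "scale H (s a1 a2 b1 b2) (m a1 a2 b1 b2) \<in> carrier H"
        if "(a1, a2) \<in> \<Delta> a" "(b1, b2) \<in> \<Delta> b" for a1 a2 b1 b2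
        using m[OF that] by (simp add: scale_def)
      have "\<chi> (ext H (\<lambda>b1 b2. scale H (s a1 a2 b1 b2) (m a1 a2 b1 b2)) (\<Delta> b)) \<longleftrightarrow>
        (\<exists>(b1, b2)\<in>\<Delta> b. s a1 a2 b1 b2 \<and> \<chi> (m a1 a2 b1 b2))" if "(a1, a2) \<in> \<Delta> a" for a1 a2
        by (subst functional_ext[OF \<chi> sc[OF that]]) (simp_all add: functional_scale[OF \<chi>])
      then show ?thesis
        by (subst functional_ext[OF \<chi> ext_closed'[OF lattice sc]]) (auto intro!: bex_cong)
    qed
    have "(Rf \<star>\<^sub>2 ?M') b a \<longleftrightarrow> (\<exists>(a1, a2)\<in>\<Delta> a. \<exists>(b1, b2)\<in>\<Delta> b. R (b1 \<odot> a1) \<and> \<chi> (a2 \<cdot> b2))"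
      unfolding mult2_iff Rf_def M_iff using a b t by fast
    also have "\<dots> \<longleftrightarrow> (\<exists>(a1, a2)\<in>\<Delta> a. \<exists>(b1, b2)\<in>\<Delta> b. R (b2 \<odot> a2) \<and> \<chi> (b1 \<cdot> a1))"
      using arg_cong[OF R_comm[OF a b], of \<chi>] sweedler[of "\<lambda>a1 a2 b1 b2. a2 \<cdot> b2" "\<lambda>a1 a2 b1 b2. R (b1 \<odot> a1)"]
        sweedler[of "\<lambda>a1 a2 b1 b2. b1 \<cdot> a1" "\<lambda>a1 a2 b1 b2. R (b2 \<odot> a2)"] t by (simp add: hprod_closed)
    also have "\<dots> \<longleftrightarrow> (?M \<star>\<^sub>2 Rf) b a"
      unfolding mult2_iff Rf_def M_iff using a b t by fast
    finally show ?thesis .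
  qed (auto simp: mult2_iff)
  then have "Rf \<star>\<^sub>2 ?M' = ?M \<star>\<^sub>2 Rf" by (intro ext)
  then have "ad ?M' = ?M \<star>\<^sub>2 Rf \<star>\<^sub>2 Rf'" by (simp only: Q2.conjugate_def)
  also have "\<dots> = ?M \<star>\<^sub>2 one2" unfolding Q2.assoc[OF MA Rf_A2 Rf'_A2] Rf_inverse(1) ..
  also have "\<dots> = ?M" by (rule Q2.one_right[OF MA])
  finally show ?thesis .
qed

text \<open>
  For \<open>z = g h\<close> and \<open>\<chi> = \<chi>\<^sub>z\<close> the functional \<open>M\<close> of \<open>ad_flip_mult_pullback\<close> holds at \<open>(g, h)\<close>, while \<open>M'\<close> is
  the join of the \<open>char2 x y\<close> with \<open>y x = z\<close>. So the image of \<open>(g, h)\<close> has product \<open>z\<close>.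
\<close>

lemma braids_mult:
  assumes G: "g \<in> grouplike" "h \<in> grouplike" "x \<in> grouplike" "y \<in> grouplike"
    and b: "braids g h y x"
  shows "y \<cdot>\<^sub>Q x = g \<cdot>\<^sub>Q h"
proof -
  let ?z = "g \<cdot>\<^sub>Q h"
  have z: "?z \<in> grouplike" by (rule grouplike_prod[OF G(1,2)])
  let ?M = "mult_pullback (char ?z)" and ?M' = "\<lambda>a b. mult_pullback (char ?z) b a"
  let ?X = "{p \<in> grouplike \<times> grouplike. snd p \<cdot>\<^sub>Q fst p = ?z}"
  have M': "?M' = Sup ((\<lambda>p. char2 (fst p) (snd p)) ` ?X)"
  proof (intro ext)
    fix a b
    have "?M' a b \<longleftrightarrow> (\<exists>x\<in>grouplike. \<exists>y\<in>grouplike. y \<cdot>\<^sub>Q x = ?z \<and> char2 x y a b)"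
    proof (cases "a \<in> carrier H \<and> b \<in> carrier H")
      case True
      then have "?M' a b \<longleftrightarrow> (\<exists>y\<in>grouplike. \<exists>x\<in>grouplike. y \<cdot>\<^sub>Q x = ?z \<and> char y b \<and> char x a)"
        using char_mult[OF z, of b a] by (simp add: mult_pullback_def)
      then show ?thesis unfolding char2_def by metis
    next
      case False
      then have "\<not> ?M' a b" by (auto simp: mult_pullback_def)
      then show ?thesis unfolding char2_def using False char_carrier by metis
    qed
    then show "?M' a b = Sup ((\<lambda>p. char2 (fst p) (snd p)) ` ?X) a b" by auto
  qed
  have "?M (\<iota> g) (\<iota> h)"
    using char_mult[OF z, of "\<iota> g" "\<iota> h"] char_incl G
    by (auto simp: mult_pullback_def incl_closed grouplike_closed)
  then have "ad ?M' (\<iota> g) (\<iota> h)" by (simp only: ad_flip_mult_pullback[OF char_functional[OF z]])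
  then have "ad (Sup ((\<lambda>p. char2 (fst p) (snd p)) ` ?X)) (\<iota> g) (\<iota> h)" by (simp only: M')
  then have "\<exists>p\<in>?X. braids g h (snd p) (fst p)" by (subst (asm) ad_Sup_char2) auto
  then obtain x' y' where x': "x' \<in> grouplike" "y' \<in> grouplike" "y' \<cdot>\<^sub>Q x' = ?z" "braids g h y' x'"
    by auto
  then show ?thesis using braids_unique[OF G x'(1,2) b x'(4)] by simp
qed


section \<open>Unit laws\<close>

text \<open>
  \<open>\<R>(1, -)\<close> is idempotent, by the law for \<open>\<R>(1.1, c)\<close>, and invertible; similarly for \<open>\<R>(-, 1)\<close>.
\<close>

lemma Rf_unit: "Rf (hunit H) = one1" "Rf' (hunit H) = one1"
  "(\<lambda>a. Rf a (hunit H)) = one1" "(\<lambda>a. Rf' a (hunit H)) = one1"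
proof -
  interpret l: quantale_hom A2 mult2 one2 A1 mult1 one1 "\<lambda>\<phi>. \<phi> (hunit H)"
    by (rule quantale_hom_eval_unit[OF Q1.quantale_axioms])
  interpret r: quantale_hom A2 mult2 one2 A1 mult1 one1 "\<lambda>\<phi> a. \<phi> a (hunit H)"
    by (rule quantale_hom_postcomp[OF quantale_hom_eval_unit[OF quantale_bool]])
  have il: "Rf' (hunit H) \<star>\<^sub>1 Rf (hunit H) = one1"
    using l.mult[OF Rf'_A2 Rf_A2] l.one Rf_inverse(2) by simp
  have ir: "(\<lambda>a. Rf' a (hunit H)) \<star>\<^sub>1 (\<lambda>a. Rf a (hunit H)) = one1"
    using r.mult[OF Rf'_A2 Rf_A2] r.one Rf_inverse(2) by simp
  have "(Rf (hunit H) \<star>\<^sub>1 Rf (hunit H)) c = Rf (hunit H) c" for c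
    using R_mult_left[OF unit_closed unit_closed, of c] comult_terms[of _ _ c] unit_closed
    unfolding mult1_iff Rf_def ext_unit_lat by (fastforce simp: mult_unit)
  then have idl: "Rf (hunit H) \<star>\<^sub>1 Rf (hunit H) = Rf (hunit H)" by (rule HOL.ext)
  have "((\<lambda>a. Rf a (hunit H)) \<star>\<^sub>1 (\<lambda>a. Rf a (hunit H))) c = Rf c (hunit H)" for c
    using R_mult_right[OF _ unit_closed unit_closed, of c] comult_terms[of _ _ c] unit_closed
    unfolding mult1_iff Rf_def ext_unit_lat by (fastforce simp: mult_unit)
  then have idr: "(\<lambda>a. Rf a (hunit H)) \<star>\<^sub>1 (\<lambda>a. Rf a (hunit H)) = (\<lambda>a. Rf a (hunit H))" by (rule HOL.ext)
  note cl = l.closed[OF Rf_A2] l.closed[OF Rf'_A2] and cr = r.closed[OF Rf_A2] r.closed[OF Rf'_A2]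
  show L: "Rf (hunit H) = one1" by (rule Q1.idempotent_unit[OF cl idl il])
  show Rr: "(\<lambda>a. Rf a (hunit H)) = one1" by (rule Q1.idempotent_unit[OF cr idr ir])
  show "Rf' (hunit H) = one1" using il Q1.one_right[OF cl(2)] by (simp add: L)
  show "(\<lambda>a. Rf' a (hunit H)) = one1" using ir Q1.one_right[OF cr(2)] by (simp add: Rr)
qed

lemma char_unit: "char (hunit \<Q>) (hunit H)"
  using quotient.le_refl[OF quotient_unit_closed] unit_closed by (simp add: char_def quotient_unit)

lemma braids_at:
  assumes G: "x \<in> grouplike" "y \<in> grouplike" "g \<in> grouplike" "h \<in> grouplike"
    and ab: "a \<in> carrier H" "b \<in> carrier H" "\<pi> a = g" "\<pi> b = h"
  shows "ad (char2 x y) a b \<longleftrightarrow> braids g h y x"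
proof -
  have "char u a \<longleftrightarrow> char u (\<iota> g)" "char u b \<longleftrightarrow> char u (\<iota> h)" for u
    using ab G(3,4) by (simp_all add: char_def incl_closed grouplike_closed proj_incl)
  then have "char2 u w a b \<longleftrightarrow> u = g \<and> w = h" if "u \<in> grouplike" "w \<in> grouplike" for u w
    using char_incl_iff[OF that(1) G(3)] char_incl_iff[OF that(2) G(4)] by (simp only: char2_def)
  moreover have "ad (char2 x y) a b \<longleftrightarrow>
    (\<exists>g\<in>grouplike. \<exists>h\<in>grouplike. char2 g h a b \<and> ad (char2 x y) (\<iota> g) (\<iota> h))"
    by (rule below_one2[OF ad_closed[OF char2_A2[OF G(1,2)]]
          ad_below_one2[OF char2_A2[OF G(1,2)] char2_below_one2[OF G(1,2)]] ab(1,2)])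
  ultimately show ?thesis unfolding braids_def using G(3,4) by metis
qed

lemma braids_unit:
  assumes g: "g \<in> grouplike"
  shows "braids (hunit \<Q>) g g (hunit \<Q>)" "braids g (hunit \<Q>) (hunit \<Q>) g"
proof -
  interpret l: quantale_hom A2 mult2 one2 A1 mult1 one1 "\<lambda>\<phi>. \<phi> (hunit H)"
    by (rule quantale_hom_eval_unit[OF Q1.quantale_axioms])
  interpret r: quantale_hom A2 mult2 one2 A1 mult1 one1 "\<lambda>\<phi> a. \<phi> a (hunit H)"
    by (rule quantale_hom_postcomp[OF quantale_hom_eval_unit[OF quantale_bool]])
  have cg: "char g \<in> A1" by (rule char_functional[OF g])
  have 1: "char2 (hunit \<Q>) g (hunit H) = char g" "(\<lambda>a. char2 g (hunit \<Q>) a (hunit H)) = char g"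
    using char_unit by (auto simp: char2_def fun_eq_iff)
  have "ad (char2 (hunit \<Q>) g) (hunit H) = char g"
    using l.conjugate[OF Rf_A2 Rf'_A2 char2_A2[OF grouplike_unit g]]
    by (simp add: 1 Rf_unit Q1.conjugate_def Q1.one_left Q1.one_right cg)
  then have "ad (char2 (hunit \<Q>) g) (hunit H) (\<iota> g)" using char_incl[OF g] by simp
  then show "braids (hunit \<Q>) g g (hunit \<Q>)"
    using braids_at[OF grouplike_unit g grouplike_unit g unit_closed, of "\<iota> g"]
    by (simp add: quotient_unit incl_closed grouplike_closed g proj_incl)
  have "(\<lambda>a. ad (char2 g (hunit \<Q>)) a (hunit H)) = char g"
    using r.conjugate[OF Rf_A2 Rf'_A2 char2_A2[OF g grouplike_unit]]
    by (simp add: 1 Rf_unit Q1.conjugate_def Q1.one_left Q1.one_right cg)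
  then have "ad (char2 g (hunit \<Q>)) (\<iota> g) (hunit H)" using char_incl[OF g] by (simp add: fun_eq_iff)
  then show "braids g (hunit \<Q>) (hunit \<Q>) g"
    using braids_at[OF g grouplike_unit g grouplike_unit, of "\<iota> g" "hunit H"]
    by (simp add: quotient_unit incl_closed grouplike_closed g proj_incl unit_closed)
qed


section \<open>Hexagon laws\<close>

text \<open>
  A functional of the first variable, constant in one or two further variables.
\<close>

definition scal1 :: "('a \<Rightarrow> bool) \<Rightarrow> 'a \<Rightarrow> 'a \<Rightarrow> bool"
  where "scal1 \<chi> a = (if \<chi> a then one1 else bot)"

definition scal2 :: "('a \<Rightarrow> bool) \<Rightarrow> 'a \<Rightarrow> 'a \<Rightarrow> 'a \<Rightarrow> bool"
  where "scal2 \<chi> a = (if \<chi> a then one2 else bot)"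

lemma scal1_hom: "quantale_hom A1 mult1 one1 A2 mult2 one2 scal1"
  using quantale_hom_postcomp[OF quantale_hom_scalars[OF Q1.quantale_axioms]]
  by (simp add: scal1_def[abs_def])

lemma scal2_hom: "quantale_hom A1 mult1 one1 A3 mult3 one3 scal2"
  using quantale_hom_postcomp[OF quantale_hom_scalars[OF Q2.quantale_axioms]]
  by (simp add: scal2_def[abs_def])

text \<open>
  The functionals \<open>\<phi>(b, c)\<close>, \<open>\<phi>(a, c)\<close> and \<open>\<phi>(a, b)\<close> of three variables \<open>a, b, c\<close>, constant (that is,
  \<open>\<epsilon>\<close>) in the variable that does not occur.
\<close>

definition leg23 :: "('a \<Rightarrow> 'a \<Rightarrow> bool) \<Rightarrow> 'a \<Rightarrow> 'a \<Rightarrow> 'a \<Rightarrow> bool"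
  where "leg23 = const_functional"

definition leg13 :: "('a \<Rightarrow> 'a \<Rightarrow> bool) \<Rightarrow> 'a \<Rightarrow> 'a \<Rightarrow> 'a \<Rightarrow> bool"
  where "leg13 \<phi> = (\<lambda>a. const_functional (\<phi> a))"

definition leg12 :: "('a \<Rightarrow> 'a \<Rightarrow> bool) \<Rightarrow> 'a \<Rightarrow> 'a \<Rightarrow> 'a \<Rightarrow> bool"
  where "leg12 \<phi> = (\<lambda>a. scal1 (\<phi> a))"

sublocale leg23: quantale_hom A2 mult2 one2 A3 mult3 one3 leg23
  unfolding leg23_def by (rule quantale_hom_const[OF Q2.quantale_axioms])

sublocale leg13: quantale_hom A2 mult2 one2 A3 mult3 one3 leg13
  unfolding leg13_def by (rule quantale_hom_postcomp[OF quantale_hom_const[OF Q1.quantale_axioms]])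

sublocale leg12: quantale_hom A2 mult2 one2 A3 mult3 one3 leg12
  unfolding leg12_def by (rule quantale_hom_postcomp[OF scal1_hom])

sublocale mult12: quantale_hom A2 mult2 one2 A3 mult3 one3 mult_pullback
  by (rule quantale_hom_mult_pullback[OF Q1.quantale_axioms])

sublocale mult23: quantale_hom A2 mult2 one2 A3 mult3 one3 "\<lambda>\<phi> a. mult_pullback (\<phi> a)"
  by (rule quantale_hom_postcomp[OF quantale_hom_mult_pullback[OF quantale_bool]])

lemma scal1_A2: "\<chi> \<in> A1 \<Longrightarrow> scal1 \<chi> \<in> A2"
  using quantale_hom.closed[OF scal1_hom] .

lemma const_A2: "\<chi> \<in> A1 \<Longrightarrow> const_functional \<chi> \<in> A2"
  by (rule const_functional_closed[OF Q1.quantale_axioms])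

lemma scal1_const:
  assumes "\<psi> \<in> A1" "\<chi> \<in> A1"
  shows "const_functional \<psi> \<star>\<^sub>2 scal1 \<chi> = (\<lambda>a. if \<chi> a then \<psi> else bot)"
    and "scal1 \<chi> \<star>\<^sub>2 const_functional \<psi> = (\<lambda>a. if \<chi> a then \<psi> else bot)"
  unfolding conv_const_left[OF Q1.quantale_axioms assms(1) scal1_A2[OF assms(2)]]
    conv_const_right[OF Q1.quantale_axioms assms(1) scal1_A2[OF assms(2)]]
  using assms by (auto simp: scal1_def Q1.one_left Q1.one_right Q1.mult_bot Q1.bot_mult fun_eq_iff)

lemma scal2_leg23:
  assumes "\<psi> \<in> A2" "\<chi> \<in> A1"
  shows "leg23 \<psi> \<star>\<^sub>3 scal2 \<chi> = (\<lambda>a. if \<chi> a then \<psi> else bot)"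
    and "scal2 \<chi> \<star>\<^sub>3 leg23 \<psi> = (\<lambda>a. if \<chi> a then \<psi> else bot)"
  unfolding leg23_def conv_const_left[OF Q2.quantale_axioms assms(1) quantale_hom.closed[OF scal2_hom assms(2)]]
    conv_const_right[OF Q2.quantale_axioms assms(1) quantale_hom.closed[OF scal2_hom assms(2)]]
  using assms by (auto simp: scal2_def Q2.one_left Q2.one_right Q2.mult_bot Q2.bot_mult fun_eq_iff)

lemma A2_apply_A1: "\<phi> \<in> A2 \<Longrightarrow> \<phi> a \<in> A1"
  using functionals_closed[of \<phi> H A1 a] functionals_outside[of \<phi> H A1 a] Q1.bot_closed
  by (cases "a \<in> carrier H") simp_all

text \<open>
  A functional of the middle variable passes the leg on the outer two, as
  \<open>conjugate_step\<close> requires of \<open>X\<close> and \<open>N\<close>.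
\<close>

lemma leg13_mult_middle:
  assumes "\<phi> \<in> A2" "\<chi> \<in> A1"
  shows "leg13 \<phi> \<star>\<^sub>3 leg23 (scal1 \<chi>) = (\<lambda>a b. if \<chi> b then \<phi> a else bot)"
    and "leg23 (scal1 \<chi>) \<star>\<^sub>3 leg13 \<phi> = (\<lambda>a b. if \<chi> b then \<phi> a else bot)"
  unfolding leg23_def conv_const_right[OF Q2.quantale_axioms scal1_A2[OF assms(2)] leg13.closed[OF assms(1)]]
    conv_const_left[OF Q2.quantale_axioms scal1_A2[OF assms(2)] leg13.closed[OF assms(1)]]
  unfolding leg13_def scal1_const[OF A2_apply_A1[OF assms(1)] assms(2)] by - (rule HOL.refl)+

text \<open>
  Likewise for a functional of the third variable and the leg on the first two, in the role of \<open>T\<close> and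
  \<open>P\<close>.
\<close>

lemma leg12_mult_third:
  assumes "\<phi> \<in> A2" "\<chi> \<in> A1"
  shows "leg12 \<phi> \<star>\<^sub>3 leg23 (const_functional \<chi>) = (\<lambda>a b. if \<phi> a b then \<chi> else bot)"
    and "leg23 (const_functional \<chi>) \<star>\<^sub>3 leg12 \<phi> = (\<lambda>a b. if \<phi> a b then \<chi> else bot)"
  unfolding leg23_def conv_const_right[OF Q2.quantale_axioms const_A2[OF assms(2)] leg12.closed[OF assms(1)]]
    conv_const_left[OF Q2.quantale_axioms const_A2[OF assms(2)] leg12.closed[OF assms(1)]]
  unfolding leg12_def scal1_const[OF assms(2) A2_apply_A1[OF assms(1)]] by - (rule HOL.refl)+

lemma mult12_Rf: "mult_pullback Rf = leg23 Rf \<star>\<^sub>3 leg13 Rf"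
proof (intro ext)
  fix a b c
  have "(leg23 Rf \<star>\<^sub>3 leg13 Rf) a b c \<longleftrightarrow> (Rf \<star>\<^sub>2 const_functional (Rf a)) b c"
    unfolding leg23_def conv_const_left[OF Q2.quantale_axioms Rf_A2 leg13.closed[OF Rf_A2]]
    by (simp add: leg13_def)
  also have "\<dots> \<longleftrightarrow> (Rf b \<star>\<^sub>1 Rf a) c"
    unfolding conv_const_right[OF Q1.quantale_axioms A2_apply_A1[OF Rf_A2] Rf_A2] ..
  also have "\<dots> \<longleftrightarrow> mult_pullback Rf a b c"
  proof (cases "a \<in> carrier H \<and> b \<in> carrier H \<and> c \<in> carrier H")
    case True
    then show ?thesis
      using R_mult_left[of a b c] comult_terms[of _ _ c]
      unfolding mult1_iff Rf_def ext_unit_lat mult_pullback_def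
      by (simp add: hprod_closed) fast
  next
    case False
    then show ?thesis unfolding mult1_iff mult_pullback_def Rf_def by auto
  qed
  finally show "mult_pullback Rf a b c = (leg23 Rf \<star>\<^sub>3 leg13 Rf) a b c" ..
qed

lemma mult23_Rf: "(\<lambda>a. mult_pullback (Rf a)) = leg12 Rf \<star>\<^sub>3 leg13 Rf"
proof (intro ext)
  fix a b c
  have "(leg12 Rf \<star>\<^sub>3 leg13 Rf) a b c \<longleftrightarrow> a \<in> carrier H \<and>
    (\<exists>(x, y)\<in>\<Delta> a. (scal1 (Rf x) \<star>\<^sub>2 const_functional (Rf y)) b c)"
    by (simp add: conv_def[of mult2] terms_Sup_apply terms_Sup_bool leg12_def leg13_def)
  also have "\<dots> \<longleftrightarrow> a \<in> carrier H \<and> (\<exists>(x, y)\<in>\<Delta> a. Rf x b \<and> Rf y c)"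
    unfolding scal1_const(2)[OF A2_apply_A1[OF Rf_A2] A2_apply_A1[OF Rf_A2]] by auto
  also have "\<dots> \<longleftrightarrow> mult_pullback (Rf a) b c"
  proof (cases "a \<in> carrier H \<and> b \<in> carrier H \<and> c \<in> carrier H")
    case True
    then show ?thesis
      using R_mult_right[of a b c] comult_terms[of _ _ a]
      unfolding Rf_def ext_unit_lat mult_pullback_def
      by (simp add: hprod_closed) fast
  next
    case False
    then show ?thesis unfolding mult_pullback_def Rf_def by auto
  qed
  finally show "mult_pullback (Rf a) b c = (leg12 Rf \<star>\<^sub>3 leg13 Rf) a b c" ..
qed

text \<open>
  An invertible element has only one inverse, so the factorization of \<open>\<R>\<close> composed with a product
  also factors \<open>\<R>\<^sup>-\<^sup>1\<close>, in the opposite order.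
\<close>

lemma leg_inverse:
  assumes P: "quantale_hom A2 mult2 one2 A3 mult3 one3 P"
    and f: "quantale_hom A2 mult2 one2 A3 mult3 one3 f"
    and eq: "f Rf = P Rf \<star>\<^sub>3 leg13 Rf"
  shows "f Rf' = leg13 Rf' \<star>\<^sub>3 P Rf'"
proof (rule Q3.inverse_unique)
  interpret P: quantale_hom A2 mult2 one2 A3 mult3 one3 P by (rule P)
  interpret f: quantale_hom A2 mult2 one2 A3 mult3 one3 f by (rule f)
  note c = P.closed[OF Rf_A2] P.closed[OF Rf'_A2] leg13.closed[OF Rf_A2] leg13.closed[OF Rf'_A2]
  show "f Rf \<in> A3" "f Rf' \<in> A3" "leg13 Rf' \<star>\<^sub>3 P Rf' \<in> A3"
    by (intro f.closed Q3.mult_closed c Rf_A2 Rf'_A2)+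
  show "f Rf' \<star>\<^sub>3 f Rf = one3" using f.mult[OF Rf'_A2 Rf_A2] f.one Rf_inverse by simp
  have N: "leg13 Rf \<star>\<^sub>3 (leg13 Rf' \<star>\<^sub>3 P Rf') = P Rf'"
    using leg13.mult[OF Rf_A2 Rf'_A2] leg13.one Rf_inverse Q3.assoc[OF c(3,4,2)] Q3.one_left[OF c(2)] by simp
  have "P Rf \<star>\<^sub>3 P Rf' = one3" using P.mult[OF Rf_A2 Rf'_A2] P.one Rf_inverse by simp
  then show "f Rf \<star>\<^sub>3 (leg13 Rf' \<star>\<^sub>3 P Rf') = one3"
    unfolding eq using Q3.assoc[OF c(1,3) Q3.mult_closed[OF c(4,2)]] N by simp
qed

text \<open>
  Here \<open>f\<close> is composition with a product in one of the two slots of \<open>\<R>\<close>, which by \<open>eq\<close> splits into the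
  legs \<open>P\<close> and \<open>leg13\<close>; the functional \<open>\<chi>\<close> acts on the middle variable, which \<open>leg13\<close> leaves alone.
\<close>

lemma hexagon:
  assumes P: "quantale_hom A2 mult2 one2 A3 mult3 one3 P"
    and f: "quantale_hom A2 mult2 one2 A3 mult3 one3 f"
    and eq: "f Rf = P Rf \<star>\<^sub>3 leg13 Rf"
    and mem: "C \<in> A2" "E \<in> A2" "F \<in> A2" "G \<in> A2" "T \<in> A3" "\<chi> \<in> A1"
    and T: "T \<star>\<^sub>3 P Rf = P Rf \<star>\<^sub>3 T"
    and E: "leg13 E \<star>\<^sub>3 leg23 (scal1 \<chi>) \<le> f C" and F: "F \<le> ad E"
    and FT: "leg13 F \<star>\<^sub>3 leg23 (scal1 \<chi>) = T \<star>\<^sub>3 P G"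
  shows "T \<star>\<^sub>3 P (ad G) \<le> f (ad C)"
proof -
  interpret P: quantale_hom A2 mult2 one2 A3 mult3 one3 P by (rule P)
  interpret f: quantale_hom A2 mult2 one2 A3 mult3 one3 f by (rule f)
  have "T \<star>\<^sub>3 Q3.conjugate (P Rf) (P Rf') (P G) \<le>
    Q3.conjugate (P Rf \<star>\<^sub>3 leg13 Rf) (leg13 Rf' \<star>\<^sub>3 P Rf') (f C)"
  proof (rule Q3.conjugate_step[where E = "leg13 E" and X = "leg23 (scal1 \<chi>)" and F = "leg13 F"])
    show "leg23 (scal1 \<chi>) \<star>\<^sub>3 leg13 Rf' = leg13 Rf' \<star>\<^sub>3 leg23 (scal1 \<chi>)"
      by (simp add: leg13_mult_middle Rf'_A2 mem)
    show "leg13 F \<le> Q3.conjugate (leg13 Rf) (leg13 Rf') (leg13 E)"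
      unfolding leg13.conjugate[OF Rf_A2 Rf'_A2 mem(2), symmetric]
      by (rule leg13.mono[OF mem(3) ad_closed[OF mem(2)] F])
  qed (use T E FT mem in \<open>auto intro!: P.closed f.closed leg13.closed leg23.closed scal1_A2 Rf_A2 Rf'_A2\<close>)
  then show ?thesis
    unfolding eq[symmetric] leg_inverse[OF P f eq, symmetric]
    by (simp add: P.conjugate f.conjugate Rf_A2 Rf'_A2 mem)
qed

text \<open>
  In \<open>hexagon\<close> the inner conjugation is the step from \<open>(g, x)\<close> to \<open>(u, v)\<close> and the outer one that from
  \<open>(h, f)\<close> to \<open>(x, y)\<close>. The latter does not involve the first variable, which provides \<open>T\<close>.
\<close>

lemma braids_mult_left:
  assumes G: "g \<in> grouplike" "h \<in> grouplike" "f \<in> grouplike" "x \<in> grouplike" "y \<in> grouplike"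
      "u \<in> grouplike" "v \<in> grouplike"
    and hf: "braids h f x y" and gx: "braids g x u v"
  shows "braids (g \<cdot>\<^sub>Q h) f u (v \<cdot>\<^sub>Q y)"
proof -
  have vy: "v \<cdot>\<^sub>Q y \<in> grouplike" and gh: "g \<cdot>\<^sub>Q h \<in> grouplike" using G by (simp_all add: grouplike_prod)
  have "scal2 (char g) \<star>\<^sub>3 leg23 (ad (char2 y x)) \<le> mult_pullback (ad (char2 (v \<cdot>\<^sub>Q y) u))"
  proof (rule hexagon[OF leg23.quantale_hom_axioms mult12.quantale_hom_axioms mult12_Rf, where
        E = "char2 v u" and F = "char2 g x" and \<chi> = "char y"])
    show "scal2 (char g) \<star>\<^sub>3 leg23 Rf = leg23 Rf \<star>\<^sub>3 scal2 (char g)"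
      using scal2_leg23[OF Rf_A2 char_functional[OF G(1)]] by simp
    show "leg13 (char2 v u) \<star>\<^sub>3 leg23 (scal1 (char y)) \<le> mult_pullback (char2 (v \<cdot>\<^sub>Q y) u)"
      unfolding leg13_mult_middle[OF char2_A2[OF G(7,6)] char_functional[OF G(5)]]
    proof (intro le_funI le_boolI)
      fix a b c assume "(if char y b then char2 v u a else bot) c"
      then have *: "char y b" "char v a" "char u c" by (auto simp: char2_def split: if_splits)
      then have "char (v \<cdot>\<^sub>Q y) (a \<cdot> b)"
        using char_mult[OF vy char_carrier[OF *(2)] char_carrier[OF *(1)]] G by blast
      then show "mult_pullback (char2 (v \<cdot>\<^sub>Q y) u) a b c"
        using * char_carrier by (auto simp: mult_pullback_def char2_def)
    qed
    show "leg13 (char2 g x) \<star>\<^sub>3 leg23 (scal1 (char y)) = scal2 (char g) \<star>\<^sub>3 leg23 (char2 y x)"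
      unfolding leg13_mult_middle[OF char2_A2[OF G(1,4)] char_functional[OF G(5)]]
        scal2_leg23[OF char2_A2[OF G(5,4)] char_functional[OF G(1)]]
      by (intro ext) (auto simp: char2_def)
    show "char2 g x \<le> ad (char2 v u)" using gx braids_iff_le G by simp
  qed (use G vy char2_A2 char_functional quantale_hom.closed[OF scal2_hom] in auto)
  then have "(\<lambda>a. if char g a then ad (char2 y x) else bot) \<le> mult_pullback (ad (char2 (v \<cdot>\<^sub>Q y) u))"
    using scal2_leg23(2)[OF ad_closed[OF char2_A2[OF G(5,4)]] char_functional[OF G(1)]] by simp
  then have "(if char g (\<iota> g) then ad (char2 y x) else bot) (\<iota> h) (\<iota> f) \<le>
    mult_pullback (ad (char2 (v \<cdot>\<^sub>Q y) u)) (\<iota> g) (\<iota> h) (\<iota> f)"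
    by (auto simp: le_fun_def)
  then have "ad (char2 (v \<cdot>\<^sub>Q y) u) (\<iota> g \<cdot> \<iota> h) (\<iota> f)"
    using hf char_incl[OF G(1)] G by (simp add: braids_def mult_pullback_def incl_closed grouplike_closed)
  then show ?thesis
    using braids_at[OF vy G(6) gh G(3), of "\<iota> g \<cdot> \<iota> h" "\<iota> f"] G
    by (simp add: hprod_closed incl_closed grouplike_closed proj_incl quotient_prod)
qed

text \<open>
  Here the inner conjugation is the step from \<open>(y, f)\<close> to \<open>(u, v)\<close> and the outer one that from \<open>(g, h)\<close> to
  \<open>(x, y)\<close>; the third variable provides \<open>T\<close>.
\<close>

lemma braids_mult_right:
  assumes G: "g \<in> grouplike" "h \<in> grouplike" "f \<in> grouplike" "x \<in> grouplike" "y \<in> grouplike"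
      "u \<in> grouplike" "v \<in> grouplike"
    and gh: "braids g h x y" and yf: "braids y f u v"
  shows "braids g (h \<cdot>\<^sub>Q f) (x \<cdot>\<^sub>Q u) v"
proof -
  have xu: "x \<cdot>\<^sub>Q u \<in> grouplike" and hf: "h \<cdot>\<^sub>Q f \<in> grouplike" using G by (simp_all add: grouplike_prod)
  have "leg23 (const_functional (char f)) \<star>\<^sub>3 leg12 (ad (char2 y x)) \<le>
    (\<lambda>a. mult_pullback (ad (char2 v (x \<cdot>\<^sub>Q u)) a))"
  proof (rule hexagon[OF leg12.quantale_hom_axioms mult23.quantale_hom_axioms mult23_Rf, where
        E = "char2 v u" and F = "char2 y f" and \<chi> = "char x"])
    show "leg23 (const_functional (char f)) \<star>\<^sub>3 leg12 Rf = leg12 Rf \<star>\<^sub>3 leg23 (const_functional (char f))"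
      using leg12_mult_third[OF Rf_A2 char_functional[OF G(3)]] by simp
    show "leg13 (char2 v u) \<star>\<^sub>3 leg23 (scal1 (char x)) \<le> (\<lambda>a. mult_pullback (char2 v (x \<cdot>\<^sub>Q u) a))"
      unfolding leg13_mult_middle[OF char2_A2[OF G(7,6)] char_functional[OF G(4)]]
    proof (intro le_funI le_boolI)
      fix a b c assume "(if char x b then char2 v u a else bot) c"
      then have *: "char x b" "char v a" "char u c" by (auto simp: char2_def split: if_splits)
      then have "char (x \<cdot>\<^sub>Q u) (b \<cdot> c)"
        using char_mult[OF xu char_carrier[OF *(1)] char_carrier[OF *(3)]] G by blast
      then show "mult_pullback (char2 v (x \<cdot>\<^sub>Q u) a) b c"
        using * char_carrier by (auto simp: mult_pullback_def char2_def)
    qed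
    show "leg13 (char2 y f) \<star>\<^sub>3 leg23 (scal1 (char x)) =
      leg23 (const_functional (char f)) \<star>\<^sub>3 leg12 (char2 y x)"
      unfolding leg13_mult_middle[OF char2_A2[OF G(5,3)] char_functional[OF G(4)]]
        leg12_mult_third[OF char2_A2[OF G(5,4)] char_functional[OF G(3)]]
      by (intro ext) (auto simp: char2_def)
    show "char2 y f \<le> ad (char2 v u)" using yf braids_iff_le G by simp
  qed (use G xu char2_A2 char_functional in \<open>auto intro!: leg23.closed const_A2\<close>)
  then have "(\<lambda>a b. if ad (char2 y x) a b then char f else bot) \<le>
    (\<lambda>a. mult_pullback (ad (char2 v (x \<cdot>\<^sub>Q u)) a))"
    using leg12_mult_third(2)[OF ad_closed[OF char2_A2[OF G(5,4)]] char_functional[OF G(3)]] by simp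
  then have "(if ad (char2 y x) (\<iota> g) (\<iota> h) then char f else bot) (\<iota> f) \<le>
    mult_pullback (ad (char2 v (x \<cdot>\<^sub>Q u)) (\<iota> g)) (\<iota> h) (\<iota> f)"
    by (auto simp: le_fun_def)
  then have "ad (char2 v (x \<cdot>\<^sub>Q u)) (\<iota> g) (\<iota> h \<cdot> \<iota> f)"
    using gh char_incl[OF G(3)] G by (simp add: braids_def mult_pullback_def incl_closed grouplike_closed)
  then show ?thesis
    using braids_at[OF G(7) xu G(1) hf, of "\<iota> g" "\<iota> h \<cdot> \<iota> f"] G
    by (simp add: hprod_closed incl_closed grouplike_closed proj_incl quotient_prod)
qed


section \<open>The induced braiding on the quotient\<close>

text \<open>
  The arguments are exchanged because \<open>\<Gamma>\<close> flips the tensor factors. The functional is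
  join-preserving because \<open>k\<close> is a bi-ideal, and \<open>\<Gamma>(a, b) \<le> k\<close> iff its conjugate fails at \<open>(a, b)\<close>
  (\<open>braiding_terms\<close>). Hence \<open>\<Gamma>\<close> preserves joins because functionals are closed under convolution.
\<close>

definition not_below :: "('a \<times> 'a) set \<Rightarrow> 'a \<Rightarrow> 'a \<Rightarrow> bool"
  where "not_below k a b \<longleftrightarrow> a \<in> carrier H \<and> b \<in> carrier H \<and> (b, a) \<notin> k"

lemma not_below_A2:
  assumes k: "bi_ideal H H k"
  shows "not_below k \<in> A2"
  unfolding not_below_def[abs_def]
  by (rule A2_guardI) (use k in \<open>auto simp: sup_mor_unit_lat_iff bi_ideal_def\<close>)

lemma ad_iff:
  assumes "a \<in> carrier H" "b \<in> carrier H" "\<phi> \<in> A2"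
  shows "ad \<phi> a b \<longleftrightarrow> (\<exists>(a1, t)\<in>\<Delta> a. \<exists>(a2, a3)\<in>\<Delta> t. \<exists>(b1, s)\<in>\<Delta> b. \<exists>(b2, b3)\<in>\<Delta> s.
    R (a1 \<odot> b1) \<and> Rinv (a3 \<odot> b3) \<and> \<phi> a2 b2)"
proof -
  have t: "(x, y) \<in> \<Delta> c \<Longrightarrow> c \<in> carrier H \<Longrightarrow> x \<in> carrier H" "(x, y) \<in> \<Delta> c \<Longrightarrow> c \<in> carrier H \<Longrightarrow> y \<in> carrier H"
    for x y c using comult_terms by auto
  have "ad \<phi> = Rf \<star>\<^sub>2 (\<phi> \<star>\<^sub>2 Rf')"
    unfolding Q2.conjugate_def by (rule Q2.assoc[OF Rf_A2 assms(3) Rf'_A2])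
  then have "ad \<phi> a b \<longleftrightarrow> (\<exists>(a1, t)\<in>\<Delta> a. \<exists>(b1, s)\<in>\<Delta> b. Rf a1 b1 \<and> (\<phi> \<star>\<^sub>2 Rf') t s)"
    using assms by (simp add: mult2_iff)
  also have "\<dots> \<longleftrightarrow> (\<exists>(a1, t)\<in>\<Delta> a. \<exists>(a2, a3)\<in>\<Delta> t. \<exists>(b1, s)\<in>\<Delta> b. \<exists>(b2, b3)\<in>\<Delta> s.
    R (a1 \<odot> b1) \<and> Rinv (a3 \<odot> b3) \<and> \<phi> a2 b2)" (is "?l \<longleftrightarrow> ?r")
  proof
    assume ?l
    then obtain a1 t b1 s where 1: "(a1, t) \<in> \<Delta> a" "(b1, s) \<in> \<Delta> b" "Rf a1 b1" "(\<phi> \<star>\<^sub>2 Rf') t s" by blast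
    from 1(4) obtain a2 a3 b2 b3 where 2: "(a2, a3) \<in> \<Delta> t" "(b2, b3) \<in> \<Delta> s" "\<phi> a2 b2" "Rf' a3 b3"
      unfolding mult2_iff by blast
    show ?r using 1 2 unfolding Rf_def Rf'_def by blast
  next
    assume ?r
    then obtain a1 t a2 a3 b1 s b2 b3 where 1: "(a1, t) \<in> \<Delta> a" "(a2, a3) \<in> \<Delta> t" "(b1, s) \<in> \<Delta> b"
      "(b2, b3) \<in> \<Delta> s" "R (a1 \<odot> b1)" "Rinv (a3 \<odot> b3)" "\<phi> a2 b2" by blast
    then have c: "a1 \<in> carrier H" "t \<in> carrier H" "b1 \<in> carrier H" "s \<in> carrier H"
      "a3 \<in> carrier H" "b3 \<in> carrier H" using t assms by metis+
    then have "Rf a1 b1" "(\<phi> \<star>\<^sub>2 Rf') t s" unfolding mult2_iff Rf_def Rf'_def using 1 by blast+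
    then show ?l using 1 by blast
  qed
  finally show ?thesis .
qed

abbreviation braiding_terms :: "'a \<Rightarrow> 'a \<Rightarrow> ('a \<times> 'a) set"
  where "braiding_terms a b \<equiv> sweedler3 H (tensor H H) (\<lambda>a1 a2 a3.
    sweedler3 H (tensor H H) (\<lambda>b1 b2 b3.
      scale (tensor H H) (R (a1 \<odot> b1) \<and> Rinv (a3 \<odot> b3)) (b2 \<odot> a2)) b) a"

lemma braiding_terms:
  assumes a: "a \<in> carrier H" and b: "b \<in> carrier H"
  shows "bi_ideal H H (braiding_terms a b)"
    and "bi_ideal H H k \<Longrightarrow> braiding_terms a b \<subseteq> k \<longleftrightarrow> \<not> ad (not_below k) a b"
proof -
  let ?T = "tensor H H"
  interpret T: complete_lattice ?T by (rule tensor_lattice)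
  let ?s = "\<lambda>a1 a2 a3 b1 b2 b3. scale ?T (R (a1 \<odot> b1) \<and> Rinv (a3 \<odot> b3)) (b2 \<odot> a2)"
  have *: "braiding_terms a b \<in> carrier ?T \<and> (braiding_terms a b \<sqsubseteq>\<^bsub>?T\<^esub> k \<longleftrightarrow>
    (\<forall>(a1, t)\<in>\<Delta> a. \<forall>(a2, a3)\<in>\<Delta> t. \<forall>(b1, s)\<in>\<Delta> b. \<forall>(b2, b3)\<in>\<Delta> s.
      \<not> (R (a1 \<odot> b1) \<and> Rinv (a3 \<odot> b3) \<and> not_below k a2 b2)))" if k: "k \<in> carrier ?T" for k
    unfolding sweedler3_def
  proof (intro ext_nested[OF tensor_lattice k])
    fix a1 t a2 a3 b1 s b2 b3
    assume "(a1, t) \<in> \<Delta> a" "(a2, a3) \<in> \<Delta> t" "(b1, s) \<in> \<Delta> b" "(b2, b3) \<in> \<Delta> s"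
    then have c: "b2 \<in> carrier H" "a2 \<in> carrier H" using comult_terms a b by metis+
    have "bi_ideal H H k" using k by (simp add: tensor_simps)
    then show "?s a1 a2 a3 b1 b2 b3 \<in> carrier ?T \<and> (?s a1 a2 a3 b1 b2 b3 \<sqsubseteq>\<^bsub>?T\<^esub> k \<longleftrightarrow>
      \<not> (R (a1 \<odot> b1) \<and> Rinv (a3 \<odot> b3) \<and> not_below k a2 b2))"
      using pure_subset_iff[OF lattice lattice _ c] bi_ideal_pure(1)[OF lattice lattice c]
        T.bottom_lower[OF k] T.bottom_closed c
      by (auto simp: scale_def hpair_def tensor_simps not_below_def)
  qed
  show "bi_ideal H H (braiding_terms a b)" using *[OF T.bottom_closed] by (simp add: tensor_simps)
  show "braiding_terms a b \<subseteq> k \<longleftrightarrow> \<not> ad (not_below k) a b" if k: "bi_ideal H H k"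
  proof -
    have "braiding_terms a b \<subseteq> k \<longleftrightarrow> (\<forall>(a1, t)\<in>\<Delta> a. \<forall>(a2, a3)\<in>\<Delta> t. \<forall>(b1, s)\<in>\<Delta> b. \<forall>(b2, b3)\<in>\<Delta> s.
      \<not> (R (a1 \<odot> b1) \<and> Rinv (a3 \<odot> b3) \<and> not_below k a2 b2))"
      using *[of k] k by (simp add: tensor_simps)
    then show ?thesis unfolding ad_iff[OF a b not_below_A2[OF k]] by blast
  qed
qed

lemma braiding_pure:
  assumes a: "a \<in> carrier H" and b: "b \<in> carrier H"
  shows "braiding H R Rinv (a \<odot> b) = braiding_terms a b"
proof -
  have "sup_bimor H H (tensor H H) braiding_terms"
    unfolding sup_bimor_def
  proof (intro conjI ballI)
    fix c assume c: "c \<in> carrier H"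
    note mem = A2_D(1)[OF ad_closed[OF not_below_A2] c] functionals_closed[OF ad_closed[OF not_below_A2] c]
    show "braiding_terms c \<in> sup_mor H (tensor H H)"
      by (rule sup_morI[OF tensor_lattice lattice])
        (use mem(2) c braiding_terms[OF c] in
          \<open>auto simp: tensor_simps functionals_bool_iff sup_mor_unit_lat_iff subset_iff[of _ "carrier H"]\<close>)
    show "(\<lambda>a. braiding_terms a c) \<in> sup_mor H (tensor H H)"
      by (rule sup_morI[OF tensor_lattice lattice])
        (use mem(1) c braiding_terms[OF _ c] in
          \<open>auto simp: tensor_simps functionals_bool_iff sup_mor_unit_lat_iff subset_iff[of _ "carrier H"]\<close>)
  qed
  from ext_pure[OF lattice lattice tensor_lattice this a b] show ?thesis
    by (simp add: braiding_def hpair_def)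
qed

lemma braiding_proj_subset_iff:
  assumes p: "p \<in> carrier \<Q>" and q: "q \<in> carrier \<Q>" and J: "bi_ideal \<Q> \<Q> J"
  shows "tensor_map \<Q> \<Q> \<pi> \<pi> (braiding H R Rinv (\<iota> p \<odot> \<iota> q)) \<subseteq> J \<longleftrightarrow>
    \<not> ad (not_below {(a, b) \<in> carrier H \<times> carrier H. (\<pi> a, \<pi> b) \<in> J}) (\<iota> p) (\<iota> q)"
proof -
  note i = incl_closed[OF p] incl_closed[OF q]
  note bt = braiding_terms(1)[OF i]
  have "tensor_map \<Q> \<Q> \<pi> \<pi> (braiding_terms (\<iota> p) (\<iota> q)) \<subseteq> J \<longleftrightarrow>
    braiding_terms (\<iota> p) (\<iota> q) \<subseteq> {(a, b) \<in> carrier H \<times> carrier H. (\<pi> a, \<pi> b) \<in> J}"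
    unfolding proj_tensor_subset_iff[OF bt J] using bi_ideal_carrier[OF bt] by auto
  then show ?thesis
    unfolding braiding_pure[OF i] braiding_terms(2)[OF i pullback_bi_ideal[OF J]] .
qed

text \<open>
  A bi-ideal of \<open>Q \<otimes> Q\<close> contains all pairs with a zero entry, so its test functional lies below
  \<open>\<epsilon> \<otimes> \<epsilon>\<close>. It is therefore a join of characters, and its conjugate also lies below \<open>\<epsilon> \<otimes> \<epsilon>\<close>: this
  is why the braiding descends to the quotient.
\<close>

lemma not_below_pullback:
  assumes J: "bi_ideal \<Q> \<Q> J"
  defines "\<phi> \<equiv> not_below {(a, b) \<in> carrier H \<times> carrier H. (\<pi> a, \<pi> b) \<in> J}"
  shows "\<phi> \<in> A2" "\<phi> \<le> one2"
    "\<phi> = Sup ((\<lambda>p. char2 (fst p) (snd p)) ` {p \<in> grouplike \<times> grouplike. (snd p, fst p) \<notin> J})"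
proof -
  show A: "\<phi> \<in> A2" unfolding \<phi>_def by (rule not_below_A2[OF pullback_bi_ideal[OF J]])
  show le: "\<phi> \<le> one2"
    using bi_ideal_kills_kernel[OF J] by (auto simp: \<phi>_def not_below_def one2_iff le_fun_def)
  have eq: "\<phi> (\<iota> x) (\<iota> y) \<longleftrightarrow> (y, x) \<notin> J" if "x \<in> grouplike" "y \<in> grouplike" for x y
    using that by (simp add: \<phi>_def not_below_def incl_closed grouplike_closed proj_incl)
  show "\<phi> = Sup ((\<lambda>p. char2 (fst p) (snd p)) ` {p \<in> grouplike \<times> grouplike. (snd p, fst p) \<notin> J})"
  proof (intro ext)
    fix a b
    have "\<phi> a b \<longleftrightarrow> (\<exists>x\<in>grouplike. \<exists>y\<in>grouplike. char2 x y a b \<and> \<phi> (\<iota> x) (\<iota> y))"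
    proof (cases "a \<in> carrier H \<and> b \<in> carrier H")
      case True
      then show ?thesis using below_one2[OF A le] by blast
    next
      case False
      then show ?thesis using A2_D(2,3)[OF A] char_carrier unfolding char2_def by blast
    qed
    also have "\<dots> \<longleftrightarrow> (\<exists>x\<in>grouplike. \<exists>y\<in>grouplike. char2 x y a b \<and> (y, x) \<notin> J)"
      by (intro bex_cong HOL.refl conj_cong eq)
    finally show "\<phi> a b =
      Sup ((\<lambda>p. char2 (fst p) (snd p)) ` {p \<in> grouplike \<times> grouplike. (snd p, fst p) \<notin> J}) a b"
      by auto
  qed
qed

lemma quotient_braiding_bimor:
  "sup_bimor \<Q> \<Q> (tensor \<Q> \<Q>)
    (\<lambda>p q. tensor_map \<Q> \<Q> \<pi> \<pi> (braiding H R Rinv (\<iota> p \<odot> \<iota> q)))" (is "sup_bimor _ _ _ ?\<beta>")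
proof -
  have closed: "?\<beta> p q \<in> carrier (tensor \<Q> \<Q>)" if "p \<in> carrier \<Q>" "q \<in> carrier \<Q>" for p q
    using that by (simp add: tensor_simps braiding_pure incl_closed proj_tensor_closed braiding_terms)
  let ?\<psi> = "\<lambda>J. ad (not_below {(a, b) \<in> carrier H \<times> carrier H. (\<pi> a, \<pi> b) \<in> J})"
  have bot: "\<bottom>\<^bsub>unit_lat\<^esub> = False"
    using bottom_eq_sup_empty[OF unit_lat_complete_lattice] by (simp add: Sup_unit_lat)
  have \<psi>: "(\<lambda>p. ?\<psi> J (\<iota> p) b) \<in> sup_mor \<Q> unit_lat" "(\<lambda>p. ?\<psi> J b (\<iota> p)) \<in> sup_mor \<Q> unit_lat"
    if J: "bi_ideal \<Q> \<Q> J" and b: "b \<in> carrier H" for J b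
  proof -
    note A = ad_closed[OF not_below_pullback(1)[OF J]]
    have D: "\<not> ?\<psi> J \<D> x" "\<not> ?\<psi> J x \<D>" for x
      using le_boolD[OF le_funD[OF le_funD[OF ad_below_one2[OF not_below_pullback(1,2)[OF J]]]]]
        counit_kernel one2_iff by blast+
    show "(\<lambda>p. ?\<psi> J (\<iota> p) b) \<in> sup_mor \<Q> unit_lat"
      using descend(2)[OF unit_lat_complete_lattice, of "\<lambda>a. ?\<psi> J a b"] A2_D(1)[OF A b] D
      by (simp add: functionals_bool_iff bot)
    show "(\<lambda>p. ?\<psi> J b (\<iota> p)) \<in> sup_mor \<Q> unit_lat"
      using descend(2)[OF unit_lat_complete_lattice, of "?\<psi> J b"] functionals_closed[OF A b] D
      by (simp add: functionals_bool_iff bot)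
  qed
  show ?thesis
    unfolding sup_bimor_def
  proof (intro conjI ballI)
    fix p assume p: "p \<in> carrier \<Q>"
    show "?\<beta> p \<in> sup_mor \<Q> (tensor \<Q> \<Q>)"
    proof (rule sup_morI[OF quotient_tensor_lattice quotient_lattice closed[OF p]])
      fix A J assume A: "A \<subseteq> carrier \<Q>" and J: "J \<in> carrier (tensor \<Q> \<Q>)"
      then have J': "bi_ideal \<Q> \<Q> J" by (simp add: tensor_simps)
      have S: "\<Squnion>\<^sub>Q A \<in> carrier \<Q>" using A by simp
      show "?\<beta> p (\<Squnion>\<^sub>Q A) \<sqsubseteq>\<^bsub>tensor \<Q> \<Q>\<^esub> J \<longleftrightarrow> (\<forall>a\<in>A. ?\<beta> p a \<sqsubseteq>\<^bsub>tensor \<Q> \<Q>\<^esub> J)"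
        using \<psi>(2)[OF J' incl_closed[OF p]] A braiding_proj_subset_iff[OF p S J']
          braiding_proj_subset_iff[OF p subsetD[OF A] J']
        by (simp add: tensor_simps sup_mor_unit_lat_iff)
    qed
  next
    fix p assume p: "p \<in> carrier \<Q>"
    show "(\<lambda>q. ?\<beta> q p) \<in> sup_mor \<Q> (tensor \<Q> \<Q>)"
    proof (rule sup_morI[OF quotient_tensor_lattice quotient_lattice closed[OF _ p]])
      fix A J assume A: "A \<subseteq> carrier \<Q>" and J: "J \<in> carrier (tensor \<Q> \<Q>)"
      then have J': "bi_ideal \<Q> \<Q> J" by (simp add: tensor_simps)
      have S: "\<Squnion>\<^sub>Q A \<in> carrier \<Q>" using A by simp
      show "?\<beta> (\<Squnion>\<^sub>Q A) p \<sqsubseteq>\<^bsub>tensor \<Q> \<Q>\<^esub> J \<longleftrightarrow> (\<forall>a\<in>A. ?\<beta> a p \<sqsubseteq>\<^bsub>tensor \<Q> \<Q>\<^esub> J)"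
        using \<psi>(1)[OF J' incl_closed[OF p]] A braiding_proj_subset_iff[OF S p J']
          braiding_proj_subset_iff[OF subsetD[OF A] p J']
        by (simp add: tensor_simps sup_mor_unit_lat_iff)
    qed
  qed
qed

text \<open>
  Both sides are tested against a bi-ideal \<open>J\<close>. The test functional of \<open>J\<close> is the join of the \<open>char2 x' y'\<close> with
  \<open>(y', x')\<close> outside \<open>J\<close>, and \<open>char2 x y\<close> is the only one with a conjugate that holds at \<open>(g, h)\<close>.
\<close>

lemma quotient_braiding_grouplike:
  assumes G: "g \<in> grouplike" "h \<in> grouplike" "x \<in> grouplike" "y \<in> grouplike" and b: "braids g h y x"
  shows "tensor_map \<Q> \<Q> \<pi> \<pi> (braiding H R Rinv (\<iota> g \<odot> \<iota> h)) = pure \<Q> \<Q> y x"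
proof -
  note c = grouplike_closed[OF G(1)] grouplike_closed[OF G(2)] grouplike_closed[OF G(3)] grouplike_closed[OF G(4)]
  let ?t = "tensor_map \<Q> \<Q> \<pi> \<pi> (braiding H R Rinv (\<iota> g \<odot> \<iota> h))"
  have t: "bi_ideal \<Q> \<Q> ?t"
    by (simp add: braiding_pure incl_closed c proj_tensor_closed braiding_terms)
  note P = bi_ideal_pure(1)[OF quotient_lattice quotient_lattice c(4,3)]
  have "?t \<subseteq> J \<longleftrightarrow> pure \<Q> \<Q> y x \<subseteq> J" if J: "bi_ideal \<Q> \<Q> J" for J
  proof -
    have "?t \<subseteq> J \<longleftrightarrow> \<not> (\<exists>p\<in>{p \<in> grouplike \<times> grouplike. (snd p, fst p) \<notin> J}. braids g h (snd p) (fst p))"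
      unfolding braiding_proj_subset_iff[OF c(1,2) J] not_below_pullback(3)[OF J]
      by (subst ad_Sup_char2) auto
    also have "\<dots> \<longleftrightarrow> (y, x) \<in> J"
    proof
      assume "\<not> (\<exists>p\<in>{p \<in> grouplike \<times> grouplike. (snd p, fst p) \<notin> J}. braids g h (snd p) (fst p))"
      then show "(y, x) \<in> J" using b G by force
    next
      assume yx: "(y, x) \<in> J"
      show "\<not> (\<exists>p\<in>{p \<in> grouplike \<times> grouplike. (snd p, fst p) \<notin> J}. braids g h (snd p) (fst p))"
      proof safe
        fix y' x' assume "y' \<in> grouplike" "x' \<in> grouplike" "(snd (x', y'), fst (x', y')) \<notin> J"
          "braids g h (snd (x', y')) (fst (x', y'))"
        then show False using braids_unique[OF G, of x' y'] b yx by simp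
      qed
    qed
    also have "\<dots> \<longleftrightarrow> pure \<Q> \<Q> y x \<subseteq> J"
      by (rule pure_subset_iff[OF quotient_lattice quotient_lattice J c(4,3), symmetric])
    finally show ?thesis .
  qed
  then show ?thesis using t P by blast
qed

definition remnant_braiding :: "'a set \<times> 'a set \<Rightarrow> 'a set \<times> 'a set"
  where "remnant_braiding p =
    (SOME q. q \<in> grouplike \<times> grouplike \<and> braids (fst p) (snd p) (fst q) (snd q))"

lemma remnant_braiding_props:
  assumes "g \<in> grouplike" "h \<in> grouplike"
  shows "remnant_braiding (g, h) \<in> grouplike \<times> grouplike"
    "braids g h (fst (remnant_braiding (g, h))) (snd (remnant_braiding (g, h)))"
proof -
  have "\<exists>q. q \<in> grouplike \<times> grouplike \<and> braids g h (fst q) (snd q)"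
    using braids_exists[OF assms] by force
  from someI_ex[OF this] show "remnant_braiding (g, h) \<in> grouplike \<times> grouplike"
    "braids g h (fst (remnant_braiding (g, h))) (snd (remnant_braiding (g, h)))"
    by (simp_all add: remnant_braiding_def)
qed

lemma remnant_braiding_eqI:
  assumes "g \<in> grouplike" "h \<in> grouplike" "x \<in> grouplike" "y \<in> grouplike" "braids g h y x"
  shows "remnant_braiding (g, h) = (y, x)"
proof (cases "remnant_braiding (g, h)")
  case (Pair y' x')
  then show ?thesis
    using remnant_braiding_props[OF assms(1,2)] braids_unique[OF assms(1-4), of x' y'] assms(5) by simp
qed

lemma remnant_braiding_restricts: "restricts_to H (braiding H R Rinv) remnant_braiding"
proof -
  let ?\<beta> = "\<lambda>p q. tensor_map \<Q> \<Q> \<pi> \<pi> (braiding H R Rinv (\<iota> p \<odot> \<iota> q))"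
  let ?\<xi> = "ext (tensor \<Q> \<Q>) ?\<beta>"
  note ext = ext_mor[OF quotient_lattice quotient_lattice quotient_tensor_lattice quotient_braiding_bimor]
    ext_pure[OF quotient_lattice quotient_lattice quotient_tensor_lattice quotient_braiding_bimor]
  show ?thesis
    unfolding restricts_to_def Let_def remnant_simps
  proof (intro conjI bexI[of _ ?\<xi>] ballI)
    show "remnant_braiding \<in> grouplike \<times> grouplike \<rightarrow> grouplike \<times> grouplike"
      using remnant_braiding_props(1) by auto
    show "?\<xi> (p \<odot>\<^bsub>\<Q>\<^esub> q) = ?\<beta> p q" if "p \<in> carrier \<Q>" "q \<in> carrier \<Q>" for p q
      using ext(2)[OF that] by (simp only: hpair_def)
    show "?\<xi> (g \<odot>\<^bsub>\<Q>\<^esub> h) = fst (remnant_braiding (g, h)) \<odot>\<^bsub>\<Q>\<^esub> snd (remnant_braiding (g, h))"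
      if gh: "g \<in> grouplike" "h \<in> grouplike" for g h
      using ext(2)[OF grouplike_closed[OF gh(1)] grouplike_closed[OF gh(2)]]
        quotient_braiding_grouplike[OF gh _ _ remnant_braiding_props(2)[OF gh]]
        remnant_braiding_props(1)[OF gh]
      by (simp add: hpair_def mem_Times_iff)
  qed (rule ext(1))
qed

lemma remnant_braiding_operator: "braiding_operator (remnant H) remnant_braiding"
proof -
  interpret group "remnant H" by (rule remnant_group)
  show ?thesis
  proof (unfold_locales, unfold remnant_simps)
    show "remnant_braiding \<in> grouplike \<times> grouplike \<rightarrow> grouplike \<times> grouplike"
      using remnant_braiding_props(1) by auto
    show "(case remnant_braiding (g, h) of (x, y) \<Rightarrow> x \<cdot>\<^sub>Q y) = g \<cdot>\<^sub>Q h"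
      if gh: "g \<in> grouplike" "h \<in> grouplike" for g h
      using braids_mult[OF gh _ _ remnant_braiding_props(2)[OF gh]] remnant_braiding_props(1)[OF gh]
      by (simp add: case_prod_unfold mem_Times_iff)
    show "remnant_braiding (hunit \<Q>, g) = (g, hunit \<Q>)" "remnant_braiding (g, hunit \<Q>) = (hunit \<Q>, g)"
      if g: "g \<in> grouplike" for g
      using braids_unit[OF g] g grouplike_unit by (auto intro!: remnant_braiding_eqI)
    fix f g h assume fgh: "f \<in> grouplike" "g \<in> grouplike" "h \<in> grouplike"
    obtain x y where xy: "remnant_braiding (h, f) = (x, y)" by fastforce
    then have xyG: "x \<in> grouplike" "y \<in> grouplike" "braids h f x y"
      using remnant_braiding_props[OF fgh(3,1)] by auto
    obtain u v where uv: "remnant_braiding (g, x) = (u, v)" by fastforce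
    then have uvG: "u \<in> grouplike" "v \<in> grouplike" "braids g x u v"
      using remnant_braiding_props[OF fgh(2) xyG(1)] by auto
    have "remnant_braiding (g \<cdot>\<^sub>Q h, f) = (u, v \<cdot>\<^sub>Q y)"
      by (rule remnant_braiding_eqI)
        (use braids_mult_left[OF fgh(2,3,1) xyG(1,2) uvG(1,2) xyG(3) uvG(3)] fgh uvG xyG in
          \<open>simp_all add: grouplike_prod\<close>)
    then show "remnant_braiding (g \<cdot>\<^sub>Q h, f) =
      (case remnant_braiding (h, f) of (x, y) \<Rightarrow> case remnant_braiding (g, x) of (u, v) \<Rightarrow> (u, v \<cdot>\<^sub>Q y))"
      by (simp add: xy uv)
    obtain x y where xy: "remnant_braiding (g, h) = (x, y)" by fastforce
    then have xyG: "x \<in> grouplike" "y \<in> grouplike" "braids g h x y"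
      using remnant_braiding_props[OF fgh(2,3)] by auto
    obtain u v where uv: "remnant_braiding (y, f) = (u, v)" by fastforce
    then have uvG: "u \<in> grouplike" "v \<in> grouplike" "braids y f u v"
      using remnant_braiding_props[OF xyG(2) fgh(1)] by auto
    have "remnant_braiding (g, h \<cdot>\<^sub>Q f) = (x \<cdot>\<^sub>Q u, v)"
      by (rule remnant_braiding_eqI)
        (use braids_mult_right[OF fgh(2,3,1) xyG(1,2) uvG(1,2) xyG(3) uvG(3)] fgh uvG xyG in
          \<open>simp_all add: grouplike_prod\<close>)
    then show "remnant_braiding (g, h \<cdot>\<^sub>Q f) =
      (case remnant_braiding (g, h) of (x, y) \<Rightarrow> case remnant_braiding (y, f) of (u, v) \<Rightarrow> (x \<cdot>\<^sub>Q u, v))"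
      by (simp add: xy uv)
  qed
qed

end

theorem theorem4p2:
  fixes H :: "('a, 'm) hopf_scheme"
    and R :: "('a \<times> 'a) set \<Rightarrow> bool" and Rinv :: "('a \<times> 'a) set \<Rightarrow> bool"
  assumes "hopf_algebra H"
    and "co_quasitriangular H R Rinv"
  shows "\<exists>r. restricts_to H (braiding H R Rinv) r \<and> braiding_operator (remnant H) r"
  using co_quasitriangular.remnant_braiding_restricts[OF assms(2)]
    co_quasitriangular.remnant_braiding_operator[OF assms(2)] by blast

end
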